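(* Let $N\ge 2$ be arbitrary, let $\alpha_1,\dots,\alpha_N,\beta_1,\dots,\beta_N>0$ satisfy $\min_{1\le j\le N}\beta_j\ \ge\ \max_{1\le j\le N}\alpha_j\ \ge\ 1$, and let $a_j,b_j\ge 0$ for $j=1,\dots,N$ be arbitrary. Then, up to the action by the modular group, $$\operatorname*{arg\,max}_{z\in\mathbb{H}}\ \frac{\sum_{j=1}^N b_j\,\theta(\beta_j,z)}{\sum_{j=1}^N a_j\,\theta(\alpha_j,z)}=e^{i\frac{\pi}{3}}.$$
   Context: $\mathbb{H}=\{z\in\mathbb{C}:\operatorname{Im}(z)>0\}$. For $\alpha>0$ and $z\in\mathbb{H}$, $$\theta(\alpha,z)=\sum_{(m,n)\in\mathbb{Z}^2}e^{-\pi\alpha\frac{|mz+n|^2}{\operatorname{Im}(z)}}.$$ The modular group is $\mathrm{SL}_2(\mathbb{Z})$ acting on $\mathbb{H}$ by $z\mapsto\frac{az+b}{cz+d}$; the functions $\theta(\alpha,\cdot)$ are invariant under it.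
   Formalization: Adds 1/α_j ≤ β_k for all j,k (automatic if all α_j ≥ 1; otherwise the claim can fail). If the quotient is constant (β_k equals α_j or 1/α_j whenever a_j,b_k > 0, or all a_j or all b_j vanish), only that the orbit of e^{iπ/3} consists of maximisers is stated. *)

theory Defs
  imports "HOL-Analysis.Analysis"
begin

definition upper_half_plane :: "complex set" where
  "upper_half_plane = {z. 0 < Im z}"

definition theta :: "real \<Rightarrow> complex \<Rightarrow> real" where
  "theta \<alpha> z = (\<Sum>\<^sub>\<infinity>(m, n) \<in> (UNIV :: (int \<times> int) set).
     exp (- pi * \<alpha> * (cmod (of_int m * z + of_int n))\<^sup>2 / Im z))"

text \<open>If all \<open>a j\<close> vanish, the quotient below is undefined in the usual sense; here it is
  then constantly \<open>0\<close>.\<close>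

definition theta_quotient ::
    "nat \<Rightarrow> (nat \<Rightarrow> real) \<Rightarrow> (nat \<Rightarrow> real) \<Rightarrow> (nat \<Rightarrow> real) \<Rightarrow> (nat \<Rightarrow> real) \<Rightarrow> complex \<Rightarrow> real" where
  "theta_quotient N b \<beta> a \<alpha> z =
     (\<Sum>j = 1..N. b j * theta (\<beta> j) z) / (\<Sum>j = 1..N. a j * theta (\<alpha> j) z)"

definition modular_orbit :: "complex \<Rightarrow> complex set" where
  "modular_orbit z = {(of_int a * z + of_int b) / (of_int c * z + of_int d) | a b c d :: int.
     a * d - b * c = 1}"

definition arg_max_set :: "('a \<Rightarrow> 'b::linorder) \<Rightarrow> 'a set \<Rightarrow> 'a set" where
  "arg_max_set f S = {x. is_arg_max f (\<lambda>y. y \<in> S) x}"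

text \<open>
  Two conventions for the maximisation of \<open>theta_quotient N b \<beta> a \<alpha>\<close> over the upper half plane.

  Range of the parameters. By Poisson summation \<open>theta (1 / \<alpha>) z = \<alpha> * theta \<alpha> z\<close>, so \<open>\<alpha> j\<close> and
  \<open>1 / \<alpha> j\<close> play the same role, up to rescaling \<open>a j\<close>. The bounds \<open>Min \<beta> \<ge> Max \<alpha> \<ge> 1\<close> leave room
  for some \<open>\<alpha> j < 1\<close>, and if \<open>\<beta> k < 1 / \<alpha> j\<close> for some \<open>j\<close>, \<open>k\<close>, then the maximum need not be at
  \<open>exp (\<i> * pi / 3)\<close>: for \<open>\<alpha> = (1/10, 1)\<close>, \<open>\<beta> = (1, 1)\<close>, \<open>a = b = (1, 0)\<close> the quotient is about
  \<open>0.1160\<close> there and about \<open>0.1180\<close> at \<open>\<i>\<close>. The condition \<open>1 / \<alpha> j \<le> \<beta> k\<close>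
  excludes this; it holds automatically when every \<open>\<alpha> j\<close> is at least \<open>1\<close>.

  Constant quotients. If \<open>\<beta> k \<in> {\<alpha> j, 1 / \<alpha> j}\<close> whenever \<open>a j\<close> and \<open>b k\<close> are both positive, the
  quotient is constant and every point is a maximiser. Hence the orbit of \<open>exp (\<i> * pi / 3)\<close>
  always consists of maximisers, and it is the whole set of maximisers outside that case.
\<close>

end

theory Submission
  imports Defs "HOL-Probability.Probability"
begin

text \<open>
  Write \<open>\<alpha> = exp t\<close> and \<open>ntheta x y t = sqrt \<alpha> * theta \<alpha> (x + \<i> y)\<close>. Poisson summation makes
  this an even function of \<open>t\<close>, so it suffices to show that for \<open>z\<close> in the fundamental
  domain, \<open>z \<noteq> \<rho> = exp (\<i> pi / 3)\<close>, the ratio of \<open>ntheta\<close> at \<open>z\<close> and at \<open>\<rho>\<close> strictly decreases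
  for \<open>t \<ge> 0\<close>. Since \<open>ntheta\<close> at \<open>\<rho>\<close> increases and the difference \<open>\<delta>\<close> of the two functions tends to
  \<open>0\<close>, this follows once \<open>\<delta>\<close> is strictly decreasing.

  The derivative of \<open>ntheta\<close> is \<open>- exp (t/2)\<close> times the lattice sum of \<open>(s - 1/2) exp (- s)\<close>,
  \<open>s = \<alpha> * qform\<close>. At \<open>\<rho>\<close> the form is invariant under a rotation of order three of
  the lattice; for a general \<open>z\<close> the values \<open>s * (1 + x\<^sub>i)\<close> on an orbit satisfy
  \<open>\<Sum> (x\<^sub>i - x\<^sub>i\<^sup>2) \<le> 0\<close>, so that a tangent inequality for \<open>(s - 1/2) exp (- s)\<close> compares the two lattice
  sums orbit by orbit. This handles large \<open>\<alpha>\<close> and moderate \<open>y\<close>. For smaller \<open>\<alpha>\<close> the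
  Fourier expansion in \<open>x\<close> reduces the claim to the line \<open>x = 1/2\<close>, where the same method works,
  applied near \<open>t = 0\<close> to a differential inequality for \<open>\<delta>'\<close>. In the cusp \<open>\<delta>\<close> is estimated
  by the leading Fourier terms for small \<open>\<alpha>\<close>, and by the shortest lattice vectors for large \<open>\<alpha>\<close>.
\<close>

section \<open>Poisson summation\<close>

text \<open>The main obstacle is \<open>t = 0\<close>. There the derivative of the even function
  \<open>ntheta\<close> vanishes at every point, so no strict comparison of first derivatives
  survives; the first difference shows in the second derivative, and the comparison is carried out
  at third order and integrated back. The other obstacle is the cusp: at hyperbolic distance
  \<open>d\<close> from rho the relative norms on an orbit fill a part of
  \<open>[exp (- d), exp d]\<close> with mean \<open>cosh d\<close>, and the tangent inequality
  tolerates only bounded \<open>d\<close>. No single estimate reaches both ends, so the quadrant of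
  pairs \<open>(y, exp t)\<close> is cut at \<open>y = 112/100, 3/2\<close> and at
  \<open>exp t = 105/100, 6/5, 19/10\<close>. Two of these cuts come from the smallest nonzero value
  \<open>pi / rho_im\<close> of the form at rho, about 3.6276: multiplied by \<open>105/100\<close>
  and \<open>19/10\<close> it passes \<open>19/5\<close> and \<open>689/100\<close>, where the
  estimate for the six shortest vectors and the tangent inequality begin to hold. The relation
  behind the orbit inequality is Heron's formula: \<open>v\<close>, \<open>rot v\<close>,
  \<open>rot (rot v)\<close> sum to zero, and the area of their triangle relative to the covolume of
  the lattice does not depend on \<open>z\<close>.\<close>

lemma has_sum_geometric_int:
  fixes r :: real
  assumes "0 \<le> r" "r < 1"
  shows "((\<lambda>k::int. r ^ nat \<bar>k\<bar>) has_sum (1 + r) / (1 - r)) UNIV"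
proof -
  have 1: "((\<lambda>n. r ^ n) has_sum (1 / (1 - r))) (UNIV::nat set)"
    using assms geometric_sums[of r] by (intro sums_nonneg_imp_has_sum) auto
  have "range int = {0..}" by (auto simp: image_iff intro: zero_le_imp_eq_int)
  then have 2: "((\<lambda>k::int. r ^ nat \<bar>k\<bar>) has_sum (1 / (1 - r))) {0..}"
    using 1 has_sum_reindex[of int UNIV "\<lambda>k::int. r ^ nat \<bar>k\<bar>" "1 / (1 - r)"] by (simp add: o_def)
  have 3: "((\<lambda>n. r * r ^ n) has_sum (r * (1 / (1 - r)))) (UNIV::nat set)"
    using 1 by (rule has_sum_cmult_right)
  have rg: "range (\<lambda>n. - int n - 1) = {..<0}"
  proof (intro equalityI subsetI)
    fix k :: int assume "k \<in> {..<0}"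
    then have "k = - int (nat (- k - 1)) - 1" by auto
    then show "k \<in> range (\<lambda>n. - int n - 1)" by (rule range_eqI)
  qed auto
  have "nat \<bar>- int n - 1\<bar> = Suc n" for n by auto
  then have 4: "((\<lambda>k::int. r ^ nat \<bar>k\<bar>) has_sum (r * (1 / (1 - r)))) {..<0}"
    using 3 has_sum_reindex[of "\<lambda>n. - int n - 1" UNIV "\<lambda>k::int. r ^ nat \<bar>k\<bar>" "r * (1 / (1 - r))"] rg
    by (simp add: o_def inj_on_def)
  have "((\<lambda>k::int. r ^ nat \<bar>k\<bar>) has_sum (1 / (1 - r) + r * (1 / (1 - r)))) ({0..} \<union> {..<0})"
    by (intro has_sum_Un_disjoint 2 4) auto
  moreover have "{0..} \<union> {..<0} = (UNIV::int set)" by auto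
  moreover have "1 / (1 - r) + r * (1 / (1 - r)) = (1 + r) / (1 - r)"
    by (simp add: add_divide_distrib)
  ultimately show ?thesis by simp
qed

lemma has_sum_product_real:
  fixes f :: "'a \<Rightarrow> real" and g :: "'b \<Rightarrow> real"
  assumes f: "(f has_sum a) A" and g: "(g has_sum b) B"
    and "\<And>x. x \<in> A \<Longrightarrow> f x \<ge> 0" "\<And>y. y \<in> B \<Longrightarrow> g y \<ge> 0"
  shows "((\<lambda>(x, y). f x * g y) has_sum (a * b)) (A \<times> B)"
proof (rule has_sum_SigmaI)
  show "((\<lambda>y. case (x, y) of (x, y) \<Rightarrow> f x * g y) has_sum (f x * b)) B" for x
    using has_sum_cmult_right[OF g] by simp
  show "((\<lambda>x. f x * b) has_sum (a * b)) A"
    by (rule has_sum_cmult_left[OF f])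
  have "(\<lambda>(x,y). f x * g y) summable_on (SIGMA x:A. B)"
    using assms
    by (intro summable_on_SigmaI[where g="\<lambda>x. f x * b"])
      (auto intro!: has_sum_cmult_right summable_on_cmult_left dest: has_sum_imp_summable)
  then show "(\<lambda>(x,y). f x * g y) summable_on A \<times> B" .
qed

lemma summable_exp_abs_int:
  assumes "(0::real) < a"
  shows "(\<lambda>(m::int, n::int). exp (- a * (\<bar>real_of_int m\<bar> + \<bar>real_of_int n\<bar>))) summable_on UNIV"
proof -
  define r where "r = exp (- a)"
  have "0 \<le> r" "r < 1" using assms by (auto simp: r_def)
  note h = has_sum_geometric_int[OF this]
  have "((\<lambda>(m::int, n::int). r ^ nat \<bar>m\<bar> * r ^ nat \<bar>n\<bar>) has_sum ((1 + r) / (1 - r) * ((1 + r) / (1 - r)))) (UNIV \<times> UNIV)"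
    using \<open>0 \<le> r\<close> by (intro has_sum_product_real h) auto
  moreover have "(\<lambda>(m::int, n::int). r ^ nat \<bar>m\<bar> * r ^ nat \<bar>n\<bar>)
      = (\<lambda>(m::int, n::int). exp (- a * (\<bar>real_of_int m\<bar> + \<bar>real_of_int n\<bar>)))"
    by (auto simp: fun_eq_iff r_def exp_of_nat_mult[symmetric] exp_add[symmetric] algebra_simps)
  ultimately show ?thesis using has_sum_imp_summable by fastforce
qed

lemma summable_exp_abs_int1:
  assumes "(0::real) < a"
  shows "(\<lambda>m::int. exp (- a * \<bar>real_of_int m\<bar>)) summable_on UNIV"
proof -
  have "((\<lambda>k::int. exp (- a) ^ nat \<bar>k\<bar>) has_sum (1 + exp (- a)) / (1 - exp (- a))) UNIV"
    using assms by (intro has_sum_geometric_int) auto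
  moreover have "(\<lambda>k::int. exp (- a) ^ nat \<bar>k\<bar>) = (\<lambda>m::int. exp (- a * \<bar>real_of_int m\<bar>))"
    by (auto simp: fun_eq_iff exp_of_nat_mult[symmetric] algebra_simps)
  ultimately show ?thesis using has_sum_imp_summable by fastforce
qed

lemma has_sum_if_finite:
  assumes "finite F"
  shows "((\<lambda>v. if v \<in> F then c else 0 :: real) has_sum real (card F) * c) UNIV"
proof -
  have "((\<lambda>v. if v \<in> F then c else 0 :: real) has_sum (\<Sum>v\<in>F. if v \<in> F then c else 0)) F" by (rule has_sum_finite[OF assms])
  then have "((\<lambda>v. if v \<in> F then c else 0 :: real) has_sum (\<Sum>v\<in>F. if v \<in> F then c else 0)) UNIV"
    by (rule has_sum_cong_neutral[THEN iffD1, rotated -1]) auto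
  then show ?thesis by simp
qed

lemma has_sum_diff_real:
  fixes f :: "'a \<Rightarrow> real"
  assumes "(f has_sum a) A" "(g has_sum b) A"
  shows "((\<lambda>x. f x - g x) has_sum (a - b)) A"
  using has_sum_add[OF assms(1) has_sum_uminusI[OF assms(2)]] by simp

lemma power_le_fact_exp:
  assumes "(0::real) \<le> x"
  shows "x ^ k \<le> fact k * exp x"
proof -
  have "(\<Sum>n\<in>{k}. x ^ n /\<^sub>R fact n) \<le> (\<Sum>n. x ^ n /\<^sub>R fact n)"
    using assms summable_exp_generic[of x] by (intro sum_le_suminf) auto
  then have "x ^ k / fact k \<le> exp x"
    by (simp add: exp_def divide_inverse mult.commute)
  then show ?thesis by (simp add: field_simps)
qed

text \<open>Half of the exponent absorbs the power: \<open>x ^ k \<le> fact k * exp x\<close> at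
  \<open>x = a/2 * c i\<close> leaves a multiple of \<open>exp (- (a/2) * c i)\<close>.\<close>

lemma exp_weight_summable:
  fixes c :: "'i \<Rightarrow> real"
  assumes c: "\<And>i. i \<in> I \<Longrightarrow> 0 \<le> c i"
    and s: "\<And>a. 0 < a \<Longrightarrow> (\<lambda>i. exp (- a * c i)) summable_on I" and a: "0 < a"
  shows "(\<lambda>i. c i ^ k * exp (- a * c i)) summable_on I"
proof (rule summable_on_comparison_test)
  show "(\<lambda>i. (fact k * (2 / a) ^ k) * exp (- (a/2) * c i)) summable_on I"
    by (intro summable_on_cmult_right s) (use a in auto)
  show "0 \<le> c i ^ k * exp (- a * c i)" if "i \<in> I" for i
    using c[OF that] by simp
  show "c i ^ k * exp (- a * c i) \<le> fact k * (2 / a) ^ k * exp (- (a/2) * c i)" if "i \<in> I" for i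
  proof -
    have "(a/2 * c i) ^ k \<le> fact k * exp (a/2 * c i)"
      using c[OF that] a by (intro power_le_fact_exp) auto
    then have "(2/a)^k * (a/2 * c i) ^ k \<le> (2/a)^k * (fact k * exp (a/2 * c i))"
      using a by (intro mult_left_mono) auto
    then have "c i ^ k \<le> (2/a)^k * (fact k * exp (a/2 * c i))"
      using a by (simp add: power_mult_distrib[symmetric])
    then have "c i ^ k * exp (- a * c i) \<le> (2/a)^k * (fact k * exp (a/2 * c i)) * exp (- a * c i)"
      by (intro mult_right_mono) auto
    also have "\<dots> = fact k * (2 / a) ^ k * exp (- (a/2) * c i)"
      by (simp add: exp_add[symmetric] field_simps)
    finally show ?thesis .
  qed
qed

lemma exp_remainder2:
  fixes w :: real
  shows "\<bar>exp w - 1 - w\<bar> \<le> w\<^sup>2 / 2 * exp \<bar>w\<bar>"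
proof (cases "w = 0")
  case False
  obtain t where t: "\<bar>t\<bar> \<le> \<bar>w\<bar>" "exp w = (\<Sum>m<2. w ^ m / fact m) + exp t / fact 2 * w ^ 2"
    using Maclaurin_exp_le[of w 2] by auto
  have 1: "exp w - 1 - w = exp t / 2 * w\<^sup>2"
    using t(2) by (simp add: eval_nat_numeral)
  have "exp t \<le> exp \<bar>w\<bar>" using t(1) by auto
  then show ?thesis
    unfolding 1 using mult_right_mono[of "exp t" "exp \<bar>w\<bar>" "w\<^sup>2"] by (simp add: mult.commute)
qed auto

text \<open>For \<open>\<bar>h\<bar> \<le> a/2\<close> the second-order remainder of each term is at
  most \<open>h\<^sup>2 * c i ^ (k+2) * exp (- (a/2) * c i)\<close>. The factor of
  \<open>h\<^sup>2\<close> is summable and independent of \<open>h\<close>, so the whole series has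
  a quadratic error.\<close>

lemma exp_series_deriv:
  fixes c :: "'i \<Rightarrow> real"
  assumes c: "\<And>i. i \<in> I \<Longrightarrow> 0 \<le> c i"
    and s: "\<And>a. 0 < a \<Longrightarrow> (\<lambda>i. exp (- a * c i)) summable_on I" and a: "0 < a"
  shows "((\<lambda>a. \<Sum>\<^sub>\<infinity>i\<in>I. c i ^ k * exp (- a * c i)) has_real_derivative
           - (\<Sum>\<^sub>\<infinity>i\<in>I. c i ^ Suc k * exp (- a * c i))) (at a)"
proof -
  let ?F = "\<lambda>k a. \<Sum>\<^sub>\<infinity>i\<in>I. c i ^ k * exp (- a * c i)"
  note sm = exp_weight_summable[OF c s]
  define B where "B = ?F (k+2) (a/2)"
  have key: "\<bar>?F k (a + h) - ?F k a + h * ?F (Suc k) a\<bar> \<le> h\<^sup>2 * B" if h: "\<bar>h\<bar> \<le> a/2" for h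
  proof -
    have ah: "0 < a + h" using h a by (auto simp: abs_if split: if_splits)
    have 1: "((\<lambda>i. c i ^ k * exp (- (a+h) * c i) - c i ^ k * exp (- a * c i) + h * (c i ^ Suc k * exp (- a * c i)))
       has_sum (?F k (a + h) - ?F k a + h * ?F (Suc k) a)) I"
      using sm[OF _ _ ah, of k] sm[OF _ _ a, of k] sm[OF _ _ a, of "Suc k"]
      by (intro has_sum_add has_sum_diff_real has_sum_cmult_right has_sum_infsum) auto
    have 2: "((\<lambda>i. h\<^sup>2 * (c i ^ (k+2) * exp (- (a/2) * c i))) has_sum (h\<^sup>2 * B)) I"
      unfolding B_def using sm[of "a/2" "k+2"] a by (intro has_sum_cmult_right has_sum_infsum) auto
    have "norm (?F k (a + h) - ?F k a + h * ?F (Suc k) a) \<le> h\<^sup>2 * B"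
    proof (rule norm_infsum_le[OF 1 2])
      fix i assume i: "i \<in> I"
      have ci: "0 \<le> c i" using c i by auto
      have "c i ^ k * exp (- (a+h) * c i) - c i ^ k * exp (- a * c i) + h * (c i ^ Suc k * exp (- a * c i))
        = c i ^ k * exp (- a * c i) * (exp (- h * c i) - 1 - (- h * c i))"
        by (simp add: exp_add[symmetric] algebra_simps)
      then have "norm (c i ^ k * exp (- (a+h) * c i) - c i ^ k * exp (- a * c i) + h * (c i ^ Suc k * exp (- a * c i)))
        = c i ^ k * exp (- a * c i) * \<bar>exp (- h * c i) - 1 - (- h * c i)\<bar>"
        using ci by (simp add: abs_mult)
      also have "\<dots> \<le> c i ^ k * exp (- a * c i) * ((- h * c i)\<^sup>2 / 2 * exp \<bar>- h * c i\<bar>)"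
        using ci by (intro mult_left_mono exp_remainder2) auto
      also have "\<dots> \<le> c i ^ k * exp (- a * c i) * ((- h * c i)\<^sup>2 * exp (a / 2 * c i))"
        using ci mult_right_mono[OF h ci] by (intro mult_left_mono mult_mono) (auto simp: abs_mult)
      also have "\<dots> = h\<^sup>2 * (c i ^ (k+2) * exp (- (a/2) * c i))"
        by (simp add: exp_add[symmetric] field_simps power2_eq_square)
      finally show "norm (c i ^ k * exp (- (a+h) * c i) - c i ^ k * exp (- a * c i) + h * (c i ^ Suc k * exp (- a * c i)))
        \<le> h\<^sup>2 * (c i ^ (k+2) * exp (- (a/2) * c i))" .
    qed
    then show ?thesis by simp
  qed
  have "((\<lambda>h. (?F k (a + h) - ?F k a) / h + ?F (Suc k) a) \<longlongrightarrow> 0) (at 0)"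
  proof (rule Lim_null_comparison)
    have "\<forall>\<^sub>F h in at 0. h \<in> ball 0 (a/2) - {0}"
      using a by (intro eventually_at_in_open) auto
    then show "\<forall>\<^sub>F h in at 0. norm ((?F k (a + h) - ?F k a) / h + ?F (Suc k) a) \<le> \<bar>h\<bar> * B"
    proof eventually_elim
      case (elim h)
      then have h: "\<bar>h\<bar> \<le> a/2" "h \<noteq> 0" by (auto simp: dist_real_def)
      have "(?F k (a + h) - ?F k a) / h + ?F (Suc k) a = (?F k (a + h) - ?F k a + h * ?F (Suc k) a) / h"
        using h by (simp add: field_simps)
      then have "norm ((?F k (a + h) - ?F k a) / h + ?F (Suc k) a) \<le> h\<^sup>2 * B / \<bar>h\<bar>"
        using key[OF h(1)] h(2) by (simp add: divide_right_mono)
      also have "\<dots> = \<bar>h\<bar> * B" using h(2) by (simp add: power2_eq_square abs_if)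
      finally show ?case .
    qed
    show "((\<lambda>h. \<bar>h\<bar> * B) \<longlongrightarrow> 0) (at 0)"
      by (auto intro!: tendsto_eq_intros)
  qed
  then have "((\<lambda>h. (?F k (a + h) - ?F k a) / h) \<longlongrightarrow> - ?F (Suc k) a) (at 0)"
    using tendsto_diff[OF _ tendsto_const[of "?F (Suc k) a" "at 0"]] by (metis (no_types, lifting) ext add_diff_cancel_right' diff_0)
  then show ?thesis unfolding DERIV_def .
qed

section \<open>Fourier series, the Gaussian integral and one-dimensional Poisson summation\<close>

lemma infsum_uniform:
  fixes f :: "'i \<Rightarrow> real \<Rightarrow> real"
  assumes c: "\<And>i. continuous_on {a..b} (f i)"
    and M: "\<And>i x. x \<in> {a..b} \<Longrightarrow> \<bar>f i x\<bar> \<le> M i" "M summable_on UNIV"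
  shows "continuous_on {a..b} (\<lambda>x. \<Sum>\<^sub>\<infinity>i. f i x)"
    and "((\<lambda>i. integral {a..b} (f i)) has_sum integral {a..b} (\<lambda>x. \<Sum>\<^sub>\<infinity>i. f i x)) UNIV"
proof -
  have u: "uniform_limit {a..b} (\<lambda>X x. \<Sum>i\<in>X. f i x) (\<lambda>x. \<Sum>\<^sub>\<infinity>i. f i x) (finite_subsets_at_top UNIV)"
    using M by (intro Weierstrass_m_test_general) auto
  have cs: "continuous_on {a..b} (\<lambda>x. \<Sum>i\<in>X. f i x)" for X
    by (intro continuous_intros c)
  show "continuous_on {a..b} (\<lambda>x. \<Sum>\<^sub>\<infinity>i. f i x)"
    by (rule uniform_limit_theorem[OF _ u]) (use cs in auto)
  obtain I J where IJ: "\<And>X. ((\<lambda>x. \<Sum>i\<in>X. f i x) has_integral I X) {a..b}"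
    "((\<lambda>x. \<Sum>\<^sub>\<infinity>i. f i x) has_integral J) {a..b}" "(I \<longlongrightarrow> J) (finite_subsets_at_top UNIV)"
    using uniform_limit_integral[OF u cs] by auto
  have "I X = (\<Sum>i\<in>X. integral {a..b} (f i))" if "finite X" for X
  proof -
    have "((\<lambda>x. \<Sum>i\<in>X. f i x) has_integral (\<Sum>i\<in>X. integral {a..b} (f i))) {a..b}"
      using that c by (intro has_integral_sum integrable_integral integrable_continuous_real) auto
    then show ?thesis using IJ(1) has_integral_unique by blast
  qed
  then have "\<forall>\<^sub>F X in finite_subsets_at_top UNIV. I X = (\<Sum>i\<in>X. integral {a..b} (f i))"
    by (intro eventually_finite_subsets_at_top_weakI) auto
  then have "((\<lambda>X. \<Sum>i\<in>X. integral {a..b} (f i)) \<longlongrightarrow> J) (finite_subsets_at_top UNIV)"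
    using IJ(3) by (rule Lim_transform_eventually[rotated])
  then show "((\<lambda>i. integral {a..b} (f i)) has_sum integral {a..b} (\<lambda>x. \<Sum>\<^sub>\<infinity>i. f i x)) UNIV"
    using IJ(2) unfolding has_sum_def by (simp add: integral_unique)
qed

text \<open>By the product formula for cosines, vanishing coefficients annihilate all powers of
  \<open>cos (2 * pi * x)\<close> and so every polynomial in it. Evenness and periodicity make
  \<open>G\<close> a continuous function of that cosine; polynomial approximation then shows that
  the square of \<open>G\<close> has integral zero.\<close>

lemma even_periodic_eq_0:
  fixes G :: "real \<Rightarrow> real"
  assumes cont: "continuous_on {0..1} G" and per: "\<And>x. G (x + 1) = G x" and ev: "\<And>x. G (- x) = G x"
    and coef: "\<And>k::int. integral {0..1} (\<lambda>x. G x * cos (2 * pi * k * x)) = 0"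
  shows "G x = 0"
proof -
  let ?e = "\<lambda>(k::int) x. cos (2 * pi * k * x)"
  have theta_moment: "integral {0..1} (\<lambda>x. G x * ?e k x * cos (2 * pi * x) ^ n) = 0" for n k
  proof (induction n arbitrary: k)
    case (Suc n)
    have "G x * ?e k x * cos (2 * pi * x) ^ Suc n
      = 1/2 * (G x * ?e (k+1) x * cos (2 * pi * x) ^ n) + 1/2 * (G x * ?e (k-1) x * cos (2 * pi * x) ^ n)" for x
    proof -
      have "?e (k+1) x + ?e (k-1) x = 2 * ?e k x * cos (2 * pi * x)"
        by (simp add: algebra_simps cos_add cos_diff)
      then have "?e k x * cos (2 * pi * x) = 1/2 * (?e (k+1) x + ?e (k-1) x)" by simp
      then have "G x * (?e k x * cos (2 * pi * x)) * cos (2 * pi * x) ^ n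
         = G x * (1/2 * (?e (k+1) x + ?e (k-1) x)) * cos (2 * pi * x) ^ n" by simp
      then show ?thesis by (simp add: algebra_simps)
    qed
    note eq = this
    have h: "((\<lambda>x. G x * ?e j x * cos (2 * pi * x) ^ n) has_integral 0) {0..1}" for j
      unfolding has_integral_iff
      by (intro conjI Suc.IH integrable_continuous_real continuous_intros cont)
    have "((\<lambda>x. G x * ?e k x * cos (2 * pi * x) ^ Suc n) has_integral (1/2 * 0 + 1/2 * 0)) {0..1}"
      unfolding eq by (intro has_integral_add has_integral_mult_right h)
    then show ?case by (simp add: integral_unique)
  qed (use coef in simp)
  have poly: "integral {0..1} (\<lambda>x. G x * p (cos (2 * pi * x))) = 0" if p: "real_polynomial_function p" for p
  proof -
    obtain a n where p: "p = (\<lambda>x. \<Sum>i\<le>n. a i * x ^ i)"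
      using p unfolding real_polynomial_function_iff_sum by auto
    have "integral {0..1} (\<lambda>x. G x * p (cos (2 * pi * x)))
       = integral {0..1} (\<lambda>x. \<Sum>i\<le>n. a i * (G x * ?e 0 x * cos (2 * pi * x) ^ i))"
      unfolding p by (simp add: sum_distrib_left algebra_simps)
    also have "\<dots> = (\<Sum>i\<le>n. integral {0..1} (\<lambda>x. a i * (G x * ?e 0 x * cos (2 * pi * x) ^ i)))"
      by (intro integral_sum integrable_continuous_real continuous_intros cont) auto
    also have "\<dots> = 0" by (simp only: integral_mult_right theta_moment) simp
    finally show ?thesis .
  qed
  \<comment> \<open>The branch of \<open>arccos\<close> covers \<open>[0, 1/2]\<close>; a point of
    \<open>[1/2, 1]\<close> is reflected to \<open>1 - x\<close>, where \<open>G\<close> has the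
    same value.\<close>
  define g where "g c = G (arccos c / (2 * pi))" for c
  have gc: "continuous_on {-1..1} g"
    unfolding g_def
    by (rule continuous_on_compose2[OF cont])
       (auto intro!: continuous_intros arccos_lbound order.trans[OF arccos_ubound] simp: field_simps)
  have Gg: "G x = g (cos (2 * pi * x))" if x: "x \<in> {0..1}" for x
  proof (cases "x \<le> 1/2")
    case True
    then have "arccos (cos (2 * pi * x)) = 2 * pi * x" using x by (intro arccos_cos) auto
    then show ?thesis by (simp add: g_def)
  next
    case False
    have "cos (2 * pi * x) = cos (2 * pi * (1 - x))"
      by (simp add: right_diff_distrib cos_diff)
    also have "arccos \<dots> = 2 * pi * (1 - x)" using x False by (intro arccos_cos) auto
    finally have "g (cos (2 * pi * x)) = G (1 - x)" by (simp add: g_def)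
    also have "\<dots> = G (- x)" using per[of "- x"] by simp
    finally show ?thesis using ev by simp
  qed
  define K where "K = integral {0..1} (\<lambda>x. \<bar>G x\<bar>)"
  have K: "K \<ge> 0" unfolding K_def
    by (intro integral_nonneg integrable_continuous_real continuous_intros cont) auto
  have sq: "integral {0..1} (\<lambda>x. G x * G x) \<le> e * K" if e: "e > 0" for e
  proof -
    obtain p where p: "real_polynomial_function p" "\<And>c. c \<in> {-1..1} \<Longrightarrow> \<bar>g c - p c\<bar> < e"
      using Stone_Weierstrass_real_polynomial_function[OF compact_Icc gc e] by auto
    have cp: "continuous_on A (\<lambda>x. p (cos (2 * pi * x)))" for A
    proof -
      have "continuous_on UNIV p"
        using p(1) by (simp add: continuous_on_polymonial_function real_polynomial_function_eq)
      then show ?thesis by (rule continuous_on_compose2) (auto intro!: continuous_intros)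
    qed
    have "integral {0..1} (\<lambda>x. G x * G x) - integral {0..1} (\<lambda>x. G x * p (cos (2 * pi * x)))
      = integral {0..1} (\<lambda>x. G x * G x - G x * p (cos (2 * pi * x)))"
      by (intro integral_diff[symmetric] integrable_continuous_real continuous_intros cont cp)
    also have "\<dots> \<le> integral {0..1} (\<lambda>x. e * \<bar>G x\<bar>)"
    proof (rule integral_le)
      fix x :: real assume x: "x \<in> {0..1}"
      have "G x * G x - G x * p (cos (2 * pi * x)) = G x * (g (cos (2 * pi * x)) - p (cos (2 * pi * x)))"
        using Gg[OF x] by (simp add: right_diff_distrib)
      also have "\<dots> \<le> \<bar>G x\<bar> * \<bar>g (cos (2 * pi * x)) - p (cos (2 * pi * x))\<bar>"
        by (metis abs_ge_self abs_mult)
      also have "\<dots> \<le> \<bar>G x\<bar> * e"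
        using p(2)[of "cos (2 * pi * x)"] by (intro mult_left_mono) auto
      finally show "G x * G x - G x * p (cos (2 * pi * x)) \<le> e * \<bar>G x\<bar>" by (simp add: mult.commute)
    qed (intro integrable_continuous_real continuous_intros cont cp)+
    also have "\<dots> = e * K" by (simp add: K_def)
    finally show ?thesis using poly[OF p(1)] by simp
  qed
  have "integral {0..1} (\<lambda>x. G x * G x) \<le> 0"
  proof (rule field_le_epsilon)
    fix e :: real assume "e > 0"
    then have "e / (K + 1) * K \<le> e" "e / (K+1) > 0" using K by (auto simp: field_simps)
    then show "integral {0..1} (\<lambda>x. G x * G x) \<le> 0 + e" using sq[of "e / (K+1)"] by linarith
  qed
  moreover have "integral {0..1} (\<lambda>x. G x * G x) \<ge> 0"
    by (intro integral_nonneg integrable_continuous_real continuous_intros cont) auto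
  ultimately have "integral {0..1} (\<lambda>x. G x * G x) = 0" by simp
  then have "G x * G x = 0" if "x \<in> {0..1}" for x
    using integral_eq_0_iff[of 0 1 "\<lambda>x. G x * G x"] continuous_on_mult[OF cont cont] that by simp
  then have z: "G x = 0" if "x \<in> {0..1}" for x using that by simp
  have shift: "G (x + real n) = G x" for x n
  proof (induction n)
    case (Suc n)
    show ?case using Suc per[of "x + real n"] by (simp add: algebra_simps)
  qed auto
  have "G (x - of_int \<lfloor>x\<rfloor>) = G x"
    using shift[of x "nat (- \<lfloor>x\<rfloor>)"] shift[of "x - of_int \<lfloor>x\<rfloor>" "nat \<lfloor>x\<rfloor>"]
    by (cases "\<lfloor>x\<rfloor> \<ge> 0") auto
  moreover have "x - of_int \<lfloor>x\<rfloor> \<in> {0..1}"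
    by (simp, linarith)
  ultimately show ?thesis using z by metis
qed

text \<open>This is the characteristic function of the standard normal law after the substitution
  \<open>u = sqrt (2 * pi * s) * x\<close>, with the frequency rescaled to \<open>t\<close>.\<close>

lemma gaussian_fourier:
  fixes s :: real
  assumes s: "0 < s"
  shows "integrable lborel (\<lambda>x. exp (- pi * s * x\<^sup>2) * cos (2 * pi * k * x))"
    and "(LINT x|lborel. exp (- pi * s * x\<^sup>2) * cos (2 * pi * k * x)) = exp (- pi * k\<^sup>2 / s) / sqrt s"
proof -
  define t where "t = 2 * pi * k / sqrt (2 * pi * s)"
  define c where "c = sqrt (2 * pi * s)"
  have c: "c > 0" using s by (simp add: c_def)
  have c2: "c\<^sup>2 = 2 * pi * s" using s by (simp add: c_def)
  let ?h = "\<lambda>u. std_normal_density u * cos (t * u)"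
  have ih: "integrable lborel ?h"
    by (rule Bochner_Integration.integrable_bound[OF integrable_normal_density[of 1 0]])
       (auto simp: abs_mult intro!: mult_left_le)
  interpret N: real_distribution std_normal_distribution by (rule real_dist_normal_dist)
  have "Re (char std_normal_distribution t) = (LINT u|std_normal_distribution. Re (iexp (t * u)))"
    unfolding char_def by (rule integral_Re[symmetric]) (rule N.integrable_iexp, auto)
  also have "\<dots> = (LINT u|std_normal_distribution. cos (t * u))"
    by (simp add: Re_exp)
  also have "\<dots> = (LINT u|lborel. ?h u)"
    by (subst integral_density) (auto simp: normal_density_nonneg)
  finally have Ih: "(LINT u|lborel. ?h u) = exp (- t\<^sup>2 / 2)"
    by (simp add: char_std_normal_distribution)
  have hx: "?h (c * x) = exp (- pi * s * x\<^sup>2) * cos (2 * pi * k * x) / sqrt (2 * pi)" for x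
  proof -
    have "t * (c * x) = 2 * pi * k * x" using c s by (simp add: t_def c_def)
    moreover have "std_normal_density (c * x) = exp (- pi * s * x\<^sup>2) / sqrt (2 * pi)"
      by (simp add: std_normal_density_def power_mult_distrib c2)
    ultimately show ?thesis by (simp only:) simp
  qed
  have "integrable lborel (\<lambda>x. ?h (0 + c * x))"
    using ih c by (subst lborel_integrable_real_affine_iff) auto
  then have i2: "integrable lborel (\<lambda>x. exp (- pi * s * x\<^sup>2) * cos (2 * pi * k * x) / sqrt (2 * pi))"
    by (simp add: hx)
  then have "integrable lborel (\<lambda>x. sqrt (2 * pi) * (exp (- pi * s * x\<^sup>2) * cos (2 * pi * k * x) / sqrt (2 * pi)))"
    by (rule integrable_mult_right)
  then show "integrable lborel (\<lambda>x. exp (- pi * s * x\<^sup>2) * cos (2 * pi * k * x))"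
    by (simp del: real_sqrt_mult)
  have "exp (- t\<^sup>2 / 2) = c * (LINT x|lborel. ?h (0 + c * x))"
    using lborel_integral_real_affine[of c ?h 0] c Ih by simp
  also have "\<dots> = c * ((LINT x|lborel. exp (- pi * s * x\<^sup>2) * cos (2 * pi * k * x)) / sqrt (2 * pi))"
    by (simp add: hx del: real_sqrt_mult)
  also have "\<dots> = sqrt s * (LINT x|lborel. exp (- pi * s * x\<^sup>2) * cos (2 * pi * k * x))"
    by (simp add: c_def real_sqrt_mult)
  finally have "sqrt s * (LINT x|lborel. exp (- pi * s * x\<^sup>2) * cos (2 * pi * k * x)) = exp (- t\<^sup>2 / 2)" ..
  moreover have "- t\<^sup>2 / 2 = - pi * k\<^sup>2 / s"
    using s by (simp add: t_def power_divide power_mult_distrib field_simps power2_eq_square)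
  ultimately show "(LINT x|lborel. exp (- pi * s * x\<^sup>2) * cos (2 * pi * k * x)) = exp (- pi * k\<^sup>2 / s) / sqrt s"
    using s by (simp add: field_simps)
qed

text \<open>Dominated convergence; it links the Lebesgue integral over the line to the gauge
  integrals over \<open>[-N, N]\<close> that a sum over unit intervals produces.\<close>

lemma integral_symmetric_tendsto:
  fixes F :: "real \<Rightarrow> real"
  assumes "integrable lborel F"
  shows "(\<lambda>N. integral {- real N..real N} F) \<longlonglongrightarrow> (LINT x|lborel. F x)"
proof -
  have "(\<lambda>N. LINT x|lborel. indicator {- real N..real N} x *\<^sub>R F x) \<longlonglongrightarrow> (LINT x|lborel. F x)"
  proof (rule integral_dominated_convergence[where w="\<lambda>x. \<bar>F x\<bar>"])
    show "AE x in lborel. (\<lambda>N. indicator {- real N..real N} x *\<^sub>R F x) \<longlonglongrightarrow> F x"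
    proof (rule AE_I2)
      fix x
      have "\<forall>\<^sub>F N in sequentially. \<bar>x\<bar> \<le> real N"
        using filterlim_real_sequentially by (auto simp: filterlim_at_top)
      then have "\<forall>\<^sub>F N in sequentially. indicator {- real N..real N} x *\<^sub>R F x = F x"
        by eventually_elim (auto simp: indicator_def)
      then show "(\<lambda>N. indicator {- real N..real N} x *\<^sub>R F x) \<longlonglongrightarrow> F x"
        by (rule tendsto_eventually)
    qed
  qed (use assms in \<open>auto simp: indicator_def\<close>)
  moreover have "(LINT x|lborel. indicator {- real N..real N} x *\<^sub>R F x) = integral {- real N..real N} F" for N
    using set_borel_integral_eq_integral(2)[of "{- real N..real N}" F]
      integrable_mult_indicator[OF _ assms, of "{- real N..real N}"]
    by (simp add: set_lebesgue_integral_def set_integrable_def)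
  ultimately show ?thesis by simp
qed

lemma exp_square_summable:
  assumes "0 < (c::real)" shows "(\<lambda>n::int. exp (- c * (real_of_int n)\<^sup>2)) summable_on UNIV"
proof (rule summable_on_comparison_test[OF summable_exp_abs_int1[OF assms]])
  fix n :: int
  have "\<bar>n\<bar> \<le> n\<^sup>2"
    using mult_left_mono[of 1 "\<bar>n\<bar>" "\<bar>n\<bar>"] by (cases "n = 0") (auto simp: power2_eq_square)
  then have "real_of_int \<bar>n\<bar> \<le> real_of_int (n\<^sup>2)" by (simp only: of_int_le_iff)
  then show "exp (- c * (real_of_int n)\<^sup>2) \<le> exp (- c * \<bar>real_of_int n\<bar>)"
    using assms by (simp add: mult_left_mono)
qed auto

lemma integral_cos_int:
  fixes m :: int
  shows "((\<lambda>x. cos (2 * pi * m * x)) has_integral (if m = 0 then 1 else 0)) {0..1}"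
proof (cases "m = 0")
  case True
  then show ?thesis using has_integral_const_real[of "1::real" 0 1] by simp
next
  case False
  have "((\<lambda>x. cos (2 * pi * m * x)) has_integral (sin (2 * pi * m * 1) / (2 * pi * m) - sin (2 * pi * m * 0) / (2 * pi * m))) {0..1}"
    using False
    by (intro fundamental_theorem_of_calculus)
      (auto simp: has_real_derivative_iff_has_vector_derivative[symmetric] intro!: derivative_eq_intros)
  moreover have "sin (2 * pi * m * 1) = 0"
    using sin_zero_iff_int2[of "2 * pi * m"] by (auto intro!: exI[of _ "2 * m"])
  ultimately show ?thesis using False by simp
qed

lemma integral_cos_cos_int:
  fixes j k :: int
  shows "((\<lambda>x. cos (2 * pi * j * x) * cos (2 * pi * k * x)) has_integral
    (1/2 * (if j = k then 1 else 0) + 1/2 * (if j = - k then 1 else 0))) {0..1}"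
proof -
  have eq: "cos (2 * pi * j * x) * cos (2 * pi * k * x)
    = 1/2 * cos (2 * pi * of_int (j - k) * x) + 1/2 * cos (2 * pi * of_int (j + k) * x)" for x
    by (simp add: algebra_simps cos_add cos_diff)
  have "((\<lambda>x. 1/2 * cos (2 * pi * of_int (j - k) * x) + 1/2 * cos (2 * pi * of_int (j + k) * x)) has_integral
     (1/2 * (if j - k = 0 then 1 else 0) + 1/2 * (if j + k = 0 then 1 else 0))) {0..1}"
    by (intro has_integral_add has_integral_mult_right integral_cos_int)
  moreover have "j - k = 0 \<longleftrightarrow> j = k" "j + k = 0 \<longleftrightarrow> j = - k" by auto
  ultimately show ?thesis unfolding eq by (simp only:)
qed

text \<open>The window is half open so that the unit intervals \<open>[n, n + 1]\<close> with
  \<open>n\<close> in it tile exactly \<open>[-N, N]\<close>.\<close>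

lemma has_sum_int_tendsto:
  fixes f :: "int \<Rightarrow> real"
  assumes "(f has_sum S) UNIV"
  shows "(\<lambda>N. \<Sum>n\<in>{- int N..<int N}. f n) \<longlonglongrightarrow> S"
proof -
  have "filterlim (\<lambda>N. {- int N..<int N}) (finite_subsets_at_top UNIV) sequentially"
    unfolding filterlim_finite_subsets_at_top
  proof (intro allI impI)
    fix X :: "int set" assume X: "finite X \<and> X \<subseteq> UNIV"
    define B where "B = Max ((\<lambda>n. nat \<bar>n\<bar>) ` X) + 1"
    have "X \<subseteq> {- int N..<int N}" if "N \<ge> B" for N
    proof
      fix n assume "n \<in> X"
      then have "nat \<bar>n\<bar> \<le> Max ((\<lambda>n. nat \<bar>n\<bar>) ` X)" using X by (intro Max_ge) auto
      then have "nat \<bar>n\<bar> < N" using that by (simp add: B_def)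
      then show "n \<in> {- int N..<int N}" by auto
    qed
    then show "\<forall>\<^sub>F N in sequentially. finite {- int N..<int N} \<and> X \<subseteq> {- int N..<int N} \<and> {- int N..<int N} \<subseteq> UNIV"
      by (auto simp: eventually_sequentially)
  qed
  then show ?thesis
    using assms unfolding has_sum_def by (rule filterlim_compose[rotated])
qed

text \<open>Both sides are continuous, even and 1-periodic in \<open>x\<close>, so only their cosine
  coefficients have to agree. On the left, translation of the unit interval unfolds a coefficient
  into the Gaussian integral over the line; on the right, it is read off by orthogonality.\<close>

theorem gauss_poisson:
  fixes s x :: real
  assumes s: "0 < s"
  shows "(\<Sum>\<^sub>\<infinity>n::int. exp (- pi * s * (x + n)\<^sup>2))
    = (\<Sum>\<^sub>\<infinity>k::int. exp (- pi * k\<^sup>2 / s) * cos (2 * pi * k * x)) / sqrt s"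
proof -
  let ?a = "\<lambda>(n::int) x. exp (- pi * s * (x + n)\<^sup>2)"
  let ?b = "\<lambda>(k::int) x. exp (- pi * k\<^sup>2 / s) * cos (2 * pi * k * x)"
  let ?A = "\<lambda>x. \<Sum>\<^sub>\<infinity>n. ?a n x" and ?B = "\<lambda>x. \<Sum>\<^sub>\<infinity>k. ?b k x"
  define G where "G x = ?A x - ?B x / sqrt s" for x
  define Ma where "Ma n = exp (pi * s) * exp (- (pi * s / 2) * (real_of_int n)\<^sup>2)" for n :: int
  define Mb where "Mb k = exp (- (pi / s) * (real_of_int k)\<^sup>2)" for k :: int
  have Ma: "Ma summable_on UNIV" unfolding Ma_def
    using s by (intro summable_on_cmult_right exp_square_summable) auto
  have Mb: "Mb summable_on UNIV" unfolding Mb_def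
    using s by (intro exp_square_summable) auto
  have am: "?a n x \<le> Ma n" if "x \<in> {0..1}" for n x
  proof -
    \<comment> \<open>Half of this square is
      \<open>(x + n)\<^sup>2 - n\<^sup>2 / 2 + x\<^sup>2\<close>, which gives a majorant uniform in
      \<open>x\<close> on the unit interval.\<close>
    have "0 \<le> (2 * x + n)\<^sup>2" by simp
    then have "(x + n)\<^sup>2 \<ge> (real_of_int n)\<^sup>2 / 2 - x\<^sup>2" by (simp add: power2_eq_square algebra_simps)
    moreover have "x\<^sup>2 \<le> 1" using that by (simp add: power_le_one)
    ultimately have "(x + n)\<^sup>2 \<ge> (real_of_int n)\<^sup>2 / 2 - 1" by linarith
    from mult_left_mono[OF this, of "pi * s"] s show ?thesis
      by (simp add: Ma_def exp_add[symmetric] algebra_simps)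
  qed
  have bm: "\<bar>?b k x\<bar> \<le> Mb k" for k x
    by (simp add: Mb_def abs_mult mult_left_le)
  have cA: "continuous_on {0..1} ?A"
  proof (rule infsum_uniform(1)[OF _ _ Ma])
    show "\<bar>?a n x\<bar> \<le> Ma n" if "x \<in> {0..1}" for n x using am[OF that] by simp
  qed (intro continuous_intros)
  have cB: "continuous_on {0..1} ?B"
  proof (rule infsum_uniform(1)[OF _ _ Mb])
    show "\<bar>?b k x\<bar> \<le> Mb k" for k x by (rule bm)
  qed (use s in \<open>auto intro!: continuous_intros\<close>)
  have "G x = 0"
  proof (rule even_periodic_eq_0[of G])
    show "continuous_on {0..1} G" unfolding G_def
      using s by (intro continuous_intros cA cB) auto
    show "G (x + 1) = G x" for x
    proof -
      have "?A x = (\<Sum>\<^sub>\<infinity>n. ?a (n + 1) x)"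
        by (rule infsum_reindex_bij_witness[of _ "\<lambda>n. n + 1" "\<lambda>n. n - 1"]) auto
      also have "\<dots> = ?A (x + 1)" by (simp add: add_ac)
      finally have "?A (x + 1) = ?A x" by simp
      moreover have "cos (2 * pi * real_of_int k * (x + 1)) = cos (2 * pi * real_of_int k * x)" for k
      proof -
        have "cos (2 * pi * real_of_int k * (x + 1)) = cos (2 * pi * real_of_int k * x + 2 * pi * real_of_int k)"
          by (simp add: algebra_simps)
        also have "\<dots> = cos (2 * pi * real_of_int k * x)"
          using cos_eq_periodic_intro[of "2 * pi * real_of_int k * x + 2 * pi * real_of_int k" "2 * pi * real_of_int k * x" k]
          by (simp add: algebra_simps)
        finally show ?thesis .
      qed
      ultimately show ?thesis by (simp add: G_def)
    qed
    show "G (- x) = G x" for x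
    proof -
      have "?A x = (\<Sum>\<^sub>\<infinity>n. ?a (- n) x)"
        by (rule infsum_reindex_bij_witness[of _ uminus uminus]) auto
      also have "\<dots> = ?A (- x)" by (intro infsum_cong) (simp add: power2_eq_square algebra_simps)
      finally show ?thesis by (simp add: G_def)
    qed
    fix k :: int
    let ?F = "\<lambda>x. exp (- pi * s * x\<^sup>2) * cos (2 * pi * k * x)"
    have iF: "?F integrable_on {a..b}" for a b
      by (intro integrable_continuous_real continuous_intros)
    have sA: "((\<lambda>n. integral {0..1} (\<lambda>x. ?a n x * cos (2 * pi * k * x)))
       has_sum integral {0..1} (\<lambda>x. \<Sum>\<^sub>\<infinity>n. ?a n x * cos (2 * pi * k * x))) UNIV"
    proof (rule infsum_uniform(2)[OF _ _ Ma])
      fix n x assume "x \<in> {0..1::real}"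
      then have "?a n x * \<bar>cos (2 * pi * k * x)\<bar> \<le> Ma n * 1"
        by (intro mult_mono am) (auto simp: Ma_def)
      then show "\<bar>?a n x * cos (2 * pi * k * x)\<bar> \<le> Ma n" by (simp add: abs_mult)
    qed (intro continuous_intros)
    have "integral {0..1} (\<lambda>x. ?a n x * cos (2 * pi * k * x)) = integral {real_of_int n..real_of_int n + 1} ?F" for n
    proof -
      have "cos (2 * pi * k * (n + x)) = cos (2 * pi * k * x)" for x :: real
        using cos_eq_periodic_intro[of "2 * pi * k * (n + x)" "2 * pi * k * x" "k * n"]
        by (simp add: algebra_simps)
      then have "(\<lambda>x. ?a n x * cos (2 * pi * k * x)) = ?F \<circ> ((+) (real_of_int n))"
        by (simp add: fun_eq_iff add.commute)
      then show ?thesis using integral_shift_Icc_real[of 0 1 ?F "real_of_int n"] by (simp add: add.commute)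
    qed
    then have "((\<lambda>n. integral {real_of_int n..real_of_int n + 1} ?F)
       has_sum integral {0..1} (\<lambda>x. \<Sum>\<^sub>\<infinity>n. ?a n x * cos (2 * pi * k * x))) UNIV" using sA by simp
    from has_sum_int_tendsto[OF this]
    have L1: "(\<lambda>N. \<Sum>n\<in>{- int N..<int N}. integral {real_of_int n..real_of_int n + 1} ?F)
       \<longlonglongrightarrow> integral {0..1} (\<lambda>x. \<Sum>\<^sub>\<infinity>n. ?a n x * cos (2 * pi * k * x))" .
    have tel: "(\<Sum>n\<in>{- int N..<int N}. integral {real_of_int n..real_of_int n + 1} ?F) = integral {- real N..real N} ?F" for N
    proof (induction N)
      case (Suc N)
      have "{- int (Suc N)..<int (Suc N)} = insert (- int N - 1) (insert (int N) {- int N..<int N})" by auto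
      then have "(\<Sum>n\<in>{- int (Suc N)..<int (Suc N)}. integral {real_of_int n..real_of_int n + 1} ?F)
        = integral {- real N - 1..- real N} ?F + (integral {real N..real N + 1} ?F + integral {- real N..real N} ?F)"
        using Suc by simp
      also have "\<dots> = integral {- real N - 1..- real N} ?F + integral {- real N..real N + 1} ?F"
        using Henstock_Kurzweil_Integration.integral_combine[where a="- real N" and c="real N" and b="real N + 1" and f="?F"] iF by simp
      also have "\<dots> = integral {- real N - 1..real N + 1} ?F"
        using Henstock_Kurzweil_Integration.integral_combine[where a="- real N - 1" and c="- real N" and b="real N + 1" and f="?F"] iF by simp
      finally have "(\<Sum>n\<in>{- int (Suc N)..<int (Suc N)}. integral {real_of_int n..real_of_int n + 1} ?F) = integral {- real N - 1..real N + 1} ?F" .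
    moreover have "- real N - 1 = - real (Suc N)" "real N + 1 = real (Suc N)" by auto
    ultimately show ?case by (simp only:)
    qed auto
    have "integral {0..1} (\<lambda>x. \<Sum>\<^sub>\<infinity>n. ?a n x * cos (2 * pi * k * x)) = exp (- pi * k\<^sup>2 / s) / sqrt s"
      using LIMSEQ_unique[OF L1[unfolded tel] integral_symmetric_tendsto[OF gaussian_fourier(1)[OF s]]]
        gaussian_fourier(2)[OF s] by simp
    then have IA: "integral {0..1} (\<lambda>x. ?A x * cos (2 * pi * k * x)) = exp (- pi * k\<^sup>2 / s) / sqrt s"
      by (simp add: infsum_cmult_left')
    have sB: "((\<lambda>j. integral {0..1} (\<lambda>x. ?b j x * cos (2 * pi * k * x)))
       has_sum integral {0..1} (\<lambda>x. \<Sum>\<^sub>\<infinity>j. ?b j x * cos (2 * pi * k * x))) UNIV"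
    proof (rule infsum_uniform(2)[OF _ _ Mb])
      fix j x
      have "\<bar>?b j x\<bar> * \<bar>cos (2 * pi * k * x)\<bar> \<le> Mb j * 1"
        by (intro mult_mono bm) (auto simp: Mb_def)
      then show "\<bar>?b j x * cos (2 * pi * k * x)\<bar> \<le> Mb j" by (simp add: abs_mult)
    qed (use s in \<open>auto intro!: continuous_intros\<close>)
    let ?w = "\<lambda>j::int. exp (- pi * j\<^sup>2 / s)"
    have "integral {0..1} (\<lambda>x. ?b j x * cos (2 * pi * k * x)) = ?w j * (1/2 * (if j = k then 1 else 0) + 1/2 * (if j = - k then 1 else 0))" for j
      using integral_unique[OF has_integral_mult_right[OF integral_cos_cos_int[of j k], of "?w j"]] by (simp add: mult.assoc)
    then have "((\<lambda>j. ?w j * (1/2 * (if j = k then 1 else 0) + 1/2 * (if j = - k then 1 else 0)))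
       has_sum integral {0..1} (\<lambda>x. \<Sum>\<^sub>\<infinity>j. ?b j x * cos (2 * pi * k * x))) UNIV" using sB by simp
    \<comment> \<open>The indices \<open>j = k\<close> and \<open>j = - k\<close> give one half
      each; for \<open>k = 0\<close> they coincide and the single term has full weight.\<close>
    moreover have "((\<lambda>j. ?w j * (1/2 * (if j = k then 1 else 0) + 1/2 * (if j = - k then 1 else 0)))
       has_sum ?w k) UNIV"
      by (rule has_sum_finite_neutralI[of "{k, - k}"], auto, cases "k = 0", auto)
    ultimately have "integral {0..1} (\<lambda>x. \<Sum>\<^sub>\<infinity>j. ?b j x * cos (2 * pi * k * x)) = ?w k"
      using has_sum_unique by blast
    then have IB: "integral {0..1} (\<lambda>x. ?B x * cos (2 * pi * k * x)) = ?w k"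
      by (simp add: infsum_cmult_left')
    have "integral {0..1} (\<lambda>x. G x * cos (2 * pi * k * x))
      = integral {0..1} (\<lambda>x. ?A x * cos (2 * pi * k * x) - (?B x * cos (2 * pi * k * x)) * (1 / sqrt s))"
      unfolding G_def by (simp add: algebra_simps)
    also have "\<dots> = integral {0..1} (\<lambda>x. ?A x * cos (2 * pi * k * x)) - integral {0..1} (\<lambda>x. (?B x * cos (2 * pi * k * x)) * (1 / sqrt s))"
      using s by (intro integral_diff integrable_continuous_real continuous_intros cA cB) auto
    also have "\<dots> = 0" by (simp only: integral_mult_left IA IB) simp
    finally show "integral {0..1} (\<lambda>x. G x * cos (2 * pi * k * x)) = 0" .
  qed
  then show ?thesis by (simp add: G_def)
qed

section \<open>Derivatives and Fourier expansion of the normalised theta function\<close>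

text \<open>The value \<open>pi * \<bar>m * z + n\<bar>\<^sup>2 / Im z\<close> at
  \<open>z = x + \<i> * y\<close>: a binary quadratic form whose determinant is
  \<open>pi\<^sup>2\<close> for every \<open>z\<close>.\<close>

definition qform :: "real \<Rightarrow> real \<Rightarrow> int \<times> int \<Rightarrow> real" where
  "qform x y v = pi * ((of_int (fst v) * x + of_int (snd v))\<^sup>2 + (of_int (fst v) * y)\<^sup>2) / y"

text \<open>Up to the sign \<open>(- 1) ^ k\<close>, the \<open>k\<close>-th derivative of the theta
  function in its parameter.\<close>

definition theta_moment :: "real \<Rightarrow> real \<Rightarrow> nat \<Rightarrow> real \<Rightarrow> real" where
  "theta_moment x y k a = (\<Sum>\<^sub>\<infinity>v. qform x y v ^ k * exp (- a * qform x y v))"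

definition latsum :: "real \<Rightarrow> real \<Rightarrow> (real \<Rightarrow> real) \<Rightarrow> real \<Rightarrow> real" where
  "latsum x y p t = (\<Sum>\<^sub>\<infinity>v. p (exp t * qform x y v) * exp (- (exp t * qform x y v)))"

definition ntheta :: "real \<Rightarrow> real \<Rightarrow> real \<Rightarrow> real" where
  "ntheta x y t = exp (t / 2) * theta_moment x y 0 (exp t)"

lemma theta_eq_moment:
  assumes "0 < Im z"
  shows "theta \<alpha> z = theta_moment (Re z) (Im z) 0 \<alpha>"
  unfolding theta_def theta_moment_def
proof (rule infsum_cong)
  fix v :: "int \<times> int"
  have "(cmod (of_int (fst v) * z + of_int (snd v)))\<^sup>2
    = (of_int (fst v) * Re z + of_int (snd v))\<^sup>2 + (of_int (fst v) * Im z)\<^sup>2"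
    by (simp add: cmod_power2)
  then show "(case v of (m, n) \<Rightarrow> exp (- pi * \<alpha> * (cmod (of_int m * z + of_int n))\<^sup>2 / Im z)) =
    qform (Re z) (Im z) v ^ 0 * exp (- \<alpha> * qform (Re z) (Im z) v)"
    unfolding case_prod_unfold qform_def by (simp add: mult.assoc mult.left_commute)
qed

lemma qform_nonneg: "0 < y \<Longrightarrow> 0 \<le> qform x y v"
  by (simp add: qform_def)

lemma int_abs_le_square: "\<bar>real_of_int n\<bar> \<le> (real_of_int n)\<^sup>2"
proof -
  have "\<bar>n\<bar> \<le> n\<^sup>2"
    using mult_left_mono[of 1 "\<bar>n\<bar>" "\<bar>n\<bar>"] by (cases "n = 0") (auto simp: power2_eq_square)
  then have "real_of_int \<bar>n\<bar> \<le> real_of_int (n\<^sup>2)" by (simp only: of_int_le_iff)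
  then show ?thesis by simp
qed

text \<open>The form \<open>(m x + n)\<^sup>2 + (m y)\<^sup>2\<close> has trace
  \<open>x\<^sup>2 + y\<^sup>2 + 1\<close> and determinant \<open>y\<^sup>2\<close>, so its smaller
  eigenvalue is at least determinant over trace. The identity in the proof is Cayley-Hamilton: trace
  times matrix minus determinant is the square of the matrix.\<close>

lemma qform_lower:
  assumes y: "0 < y"
  shows "pi * y / (x\<^sup>2 + y\<^sup>2 + 1) * (\<bar>real_of_int m\<bar> + \<bar>real_of_int n\<bar>) \<le> qform x y (m, n)"
proof -
  let ?T = "x\<^sup>2 + y\<^sup>2 + 1" and ?m = "real_of_int m" and ?n = "real_of_int n"
  have T: "0 < ?T" by (simp add: add_nonneg_pos)
  have "?T * ((?m * x + ?n)\<^sup>2 + (?m * y)\<^sup>2) - y\<^sup>2 * (?m\<^sup>2 + ?n\<^sup>2)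
     = ((x\<^sup>2 + y\<^sup>2) * ?m + x * ?n)\<^sup>2 + (x * ?m + ?n)\<^sup>2"
    by (simp add: power2_eq_square algebra_simps)
  also have "\<dots> \<ge> 0" by simp
  finally have "y\<^sup>2 * (?m\<^sup>2 + ?n\<^sup>2) \<le> ?T * ((?m * x + ?n)\<^sup>2 + (?m * y)\<^sup>2)" by simp
  moreover have "y\<^sup>2 * (\<bar>?m\<bar> + \<bar>?n\<bar>) \<le> y\<^sup>2 * (?m\<^sup>2 + ?n\<^sup>2)"
    by (intro mult_left_mono add_mono int_abs_le_square) auto
  ultimately have "y\<^sup>2 * (\<bar>?m\<bar> + \<bar>?n\<bar>) \<le> ?T * ((?m * x + ?n)\<^sup>2 + (?m * y)\<^sup>2)" by linarith
  then have "y * (y * (\<bar>?m\<bar> + \<bar>?n\<bar>)) \<le> ((?m * x + ?n)\<^sup>2 + (?m * y)\<^sup>2) * ?T"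
    by (simp add: power2_eq_square mult.assoc mult.commute)
  then have "y * (\<bar>?m\<bar> + \<bar>?n\<bar>) / ?T \<le> ((?m * x + ?n)\<^sup>2 + (?m * y)\<^sup>2) / y"
    using T y by (simp add: divide_le_eq pos_le_divide_eq mult.commute mult.left_commute)
  then have "pi * (y * (\<bar>?m\<bar> + \<bar>?n\<bar>) / ?T) \<le> pi * (((?m * x + ?n)\<^sup>2 + (?m * y)\<^sup>2) / y)"
    by (intro mult_left_mono) auto
  then show ?thesis by (simp add: qform_def)
qed

lemma qform_exp_summable:
  assumes y: "0 < y" and a: "0 < a"
  shows "(\<lambda>v. exp (- a * qform x y v)) summable_on UNIV"
proof -
  define d where "d = pi * y / (x\<^sup>2 + y\<^sup>2 + 1)"
  have d: "0 < d" using y by (simp add: d_def add_nonneg_pos)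
  have "(\<lambda>(m::int, n::int). exp (- (a * d) * (\<bar>real_of_int m\<bar> + \<bar>real_of_int n\<bar>))) summable_on UNIV"
    by (intro summable_exp_abs_int mult_pos_pos a d)
  then show ?thesis
  proof (rule summable_on_comparison_test)
    fix v :: "int \<times> int"
    obtain m n where v: "v = (m, n)" by (cases v)
    have "a * (d * (\<bar>real_of_int m\<bar> + \<bar>real_of_int n\<bar>)) \<le> a * qform x y (m, n)"
      using qform_lower[OF y, of x m n] a unfolding d_def by (intro mult_left_mono) auto
    then show "exp (- a * qform x y v) \<le> (case v of (m, n) \<Rightarrow> exp (- (a * d) * (\<bar>real_of_int m\<bar> + \<bar>real_of_int n\<bar>)))"
      unfolding v by (simp only: case_prod_conv exp_le_cancel_iff) (simp add: algebra_simps)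
  qed auto
qed

lemma theta_moment_summable:
  assumes "0 < y" "0 < a"
  shows "(\<lambda>v. qform x y v ^ k * exp (- a * qform x y v)) summable_on UNIV"
  using assms by (intro exp_weight_summable qform_nonneg qform_exp_summable)

lemma theta_moment_deriv:
  assumes "0 < y" "0 < a"
  shows "(theta_moment x y k has_real_derivative - theta_moment x y (Suc k) a) (at a)"
  unfolding theta_moment_def using assms by (intro exp_series_deriv qform_nonneg qform_exp_summable)

text \<open>Degree three suffices: three differentiations in \<open>t\<close> lead from
  \<open>1\<close> to \<open>p3\<close>, and \<open>fB\<close> is a combination of \<open>p3\<close>
  and \<open>p2\<close>.\<close>

lemma latsum_cubic:
  assumes y: "0 < y"
  shows "((\<lambda>v. (c0 + c1 * (exp t * qform x y v) + c2 * (exp t * qform x y v)\<^sup>2 + c3 * (exp t * qform x y v)^3) * exp (- (exp t * qform x y v)))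
      has_sum (c0 * theta_moment x y 0 (exp t) + c1 * exp t * theta_moment x y 1 (exp t) + c2 * exp t ^ 2 * theta_moment x y 2 (exp t) + c3 * exp t ^ 3 * theta_moment x y 3 (exp t))) UNIV"
proof -
  have h: "((\<lambda>v. qform x y v ^ k * exp (- exp t * qform x y v)) has_sum theta_moment x y k (exp t)) UNIV" for k
    unfolding theta_moment_def using y by (intro has_sum_infsum theta_moment_summable) auto
  have "((\<lambda>v. c0 * (qform x y v ^ 0 * exp (- exp t * qform x y v)) + c1 * exp t * (qform x y v ^ 1 * exp (- exp t * qform x y v))
      + c2 * exp t ^ 2 * (qform x y v ^ 2 * exp (- exp t * qform x y v)) + c3 * exp t ^ 3 * (qform x y v ^ 3 * exp (- exp t * qform x y v)))
    has_sum (c0 * theta_moment x y 0 (exp t) + c1 * exp t * theta_moment x y 1 (exp t) + c2 * exp t ^ 2 * theta_moment x y 2 (exp t) + c3 * exp t ^ 3 * theta_moment x y 3 (exp t))) UNIV"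
    by (intro has_sum_add has_sum_cmult_right h)
  then show ?thesis by (simp add: algebra_simps power_mult_distrib)
qed

lemma latsum_cubic_eq:
  assumes y: "0 < y" and p: "\<And>s. p s = c0 + c1 * s + c2 * s\<^sup>2 + c3 * s^3"
  shows "((\<lambda>v. p (exp t * qform x y v) * exp (- (exp t * qform x y v))) has_sum latsum x y p t) UNIV"
    and "latsum x y p t = c0 * theta_moment x y 0 (exp t) + c1 * exp t * theta_moment x y 1 (exp t) + c2 * exp t ^ 2 * theta_moment x y 2 (exp t) + c3 * exp t ^ 3 * theta_moment x y 3 (exp t)"
  using latsum_cubic[OF y, of c0 c1 t x c2 c3] unfolding p[symmetric] latsum_def
  by (auto simp: has_sum_iff)

text \<open>Each differentiation in \<open>t\<close> of \<open>exp (t/2) * latsum x y p t\<close> turns \<open>p\<close> into \<open>s p' - s p + p/2\<close>,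
  up to the sign; starting from \<open>p = 1\<close> this gives \<open>p1\<close>, \<open>p2\<close>, \<open>p3\<close>.\<close>

definition p1 :: "real \<Rightarrow> real" where "p1 s = s - 1/2"
definition p2 :: "real \<Rightarrow> real" where "p2 s = s\<^sup>2 - 2 * s + 1/4"
definition p3 :: "real \<Rightarrow> real" where "p3 s = s^3 - 9/2 * s\<^sup>2 + 13/4 * s - 1/8"

lemma p1_cubic: "p1 s = - (1/2) + 1 * s + 0 * s\<^sup>2 + 0 * s^3" by (simp add: p1_def)
lemma p2_cubic: "p2 s = 1/4 + (-2) * s + 1 * s\<^sup>2 + 0 * s^3" by (simp add: p2_def)
lemma p3_cubic: "p3 s = - (1/8) + 13/4 * s + (- 9/2) * s\<^sup>2 + 1 * s^3" by (simp add: p3_def)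

lemma theta_moment_exp_deriv:
  assumes "0 < y"
  shows "((\<lambda>t. theta_moment x y k (exp t)) has_real_derivative - exp t * theta_moment x y (Suc k) (exp t)) (at t)"
  using DERIV_chain2[OF theta_moment_deriv[OF assms, of "exp t" x k] DERIV_exp] by (simp add: mult.commute)

lemma ntheta_deriv:
  assumes y: "0 < y"
  shows "(ntheta x y has_real_derivative - exp (t/2) * latsum x y p1 t) (at t)"
    and "((\<lambda>t. exp (t/2) * latsum x y p1 t) has_real_derivative - exp (t/2) * latsum x y p2 t) (at t)"
    and "((\<lambda>t. exp (t/2) * latsum x y p2 t) has_real_derivative - exp (t/2) * latsum x y p3 t) (at t)"
proof -
  note d = theta_moment_exp_deriv[OF y]
  note e1 = latsum_cubic_eq(2)[OF y p1_cubic] and e2 = latsum_cubic_eq(2)[OF y p2_cubic]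
    and e3 = latsum_cubic_eq(2)[OF y p3_cubic]
  show "(ntheta x y has_real_derivative - exp (t/2) * latsum x y p1 t) (at t)"
    unfolding ntheta_def e1
    by (auto intro!: derivative_eq_intros d simp: algebra_simps)
  show "((\<lambda>t. exp (t/2) * latsum x y p1 t) has_real_derivative - exp (t/2) * latsum x y p2 t) (at t)"
    unfolding e1 e2
    by (auto intro!: derivative_eq_intros d simp: field_simps eval_nat_numeral)
  show "((\<lambda>t. exp (t/2) * latsum x y p2 t) has_real_derivative - exp (t/2) * latsum x y p3 t) (at t)"
    unfolding e2 e3
    by (auto intro!: derivative_eq_intros d simp: field_simps eval_nat_numeral)
qed

text \<open>The first index is the row of the lattice, the second the frequency dual to the column.
  Reversing \<open>t\<close> exchanges the two.\<close>

definition fourier_weight :: "real \<Rightarrow> real \<Rightarrow> int \<times> int \<Rightarrow> real" where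
  "fourier_weight y t v = exp (- pi * y * ((of_int (fst v))\<^sup>2 * exp t + (of_int (snd v))\<^sup>2 * exp (- t)))"

lemma fourier_weight_summable:
  assumes y: "0 < y"
  shows "fourier_weight y t summable_on UNIV"
proof -
  define d where "d = pi * y * min (exp t) (exp (- t))"
  have d: "0 < d" using y by (simp add: d_def)
  have "(\<lambda>(m::int, n::int). exp (- d * (\<bar>real_of_int m\<bar> + \<bar>real_of_int n\<bar>))) summable_on UNIV"
    using d by (rule summable_exp_abs_int)
  then show ?thesis
  proof (rule summable_on_comparison_test)
    fix v :: "int \<times> int"
    obtain m n where v: "v = (m, n)" by (cases v)
    have "min (exp t) (exp (- t)) * \<bar>real_of_int m\<bar> \<le> exp t * (of_int m)\<^sup>2"
      "min (exp t) (exp (- t)) * \<bar>real_of_int n\<bar> \<le> exp (- t) * (of_int n)\<^sup>2"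
      by (intro mult_mono int_abs_le_square; simp)+
    then have "min (exp t) (exp (- t)) * (\<bar>real_of_int m\<bar> + \<bar>real_of_int n\<bar>) \<le> (of_int m)\<^sup>2 * exp t + (of_int n)\<^sup>2 * exp (- t)"
      by (simp add: algebra_simps)
    then have "pi * y * (min (exp t) (exp (- t)) * (\<bar>real_of_int m\<bar> + \<bar>real_of_int n\<bar>)) \<le> pi * y * ((of_int m)\<^sup>2 * exp t + (of_int n)\<^sup>2 * exp (- t))"
      using y by (intro mult_left_mono) auto
    then show "fourier_weight y t v \<le> (case v of (m, n) \<Rightarrow> exp (- d * (\<bar>real_of_int m\<bar> + \<bar>real_of_int n\<bar>)))"
      unfolding v fourier_weight_def d_def by (simp add: mult.assoc)
  qed (simp add: fourier_weight_def)
qed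

text \<open>Poisson summation over the column index at scale \<open>a / y\<close>; the row offset
  \<open>m * x\<close> becomes the phase.\<close>

lemma qform_row_fourier:
  assumes y: "0 < y" and a: "0 < a"
  shows "(\<Sum>\<^sub>\<infinity>n. exp (- a * qform x y (m, n)))
    = sqrt (y / a) * (\<Sum>\<^sub>\<infinity>k::int. exp (- pi * y * ((of_int m)\<^sup>2 * a + (of_int k)\<^sup>2 / a)) * cos (2 * pi * k * (m * x)))"
proof -
  have "(\<Sum>\<^sub>\<infinity>n. exp (- a * qform x y (m, n)))
    = (\<Sum>\<^sub>\<infinity>n::int. exp (- a * pi * y * (of_int m)\<^sup>2) * exp (- pi * (a / y) * (m * x + n)\<^sup>2))"
    using y by (intro infsum_cong) (simp add: qform_def exp_add[symmetric] field_simps power2_eq_square)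
  also have "\<dots> = exp (- a * pi * y * (of_int m)\<^sup>2) * ((\<Sum>\<^sub>\<infinity>k::int. exp (- pi * k\<^sup>2 / (a / y)) * cos (2 * pi * k * (m * x))) / sqrt (a / y))"
    using gauss_poisson[of "a / y" "m * x"] y a by (simp only: infsum_cmult_right') simp
  also have "\<dots> = sqrt (y / a) * (\<Sum>\<^sub>\<infinity>k::int. exp (- a * pi * y * (of_int m)\<^sup>2) * (exp (- pi * k\<^sup>2 / (a / y)) * cos (2 * pi * k * (m * x))))"
    using y a by (simp add: infsum_cmult_right' real_sqrt_divide)
  also have "(\<Sum>\<^sub>\<infinity>k::int. exp (- a * pi * y * (of_int m)\<^sup>2) * (exp (- pi * k\<^sup>2 / (a / y)) * cos (2 * pi * k * (m * x))))
    = (\<Sum>\<^sub>\<infinity>k::int. exp (- pi * y * ((of_int m)\<^sup>2 * a + (of_int k)\<^sup>2 / a)) * cos (2 * pi * k * (m * x)))"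
  proof (rule infsum_cong)
    fix k :: int
    have "exp (- a * pi * y * (of_int m)\<^sup>2) * exp (- pi * k\<^sup>2 / (a / y)) = exp (- pi * y * ((of_int m)\<^sup>2 * a + (of_int k)\<^sup>2 / a))"
      using y a by (simp add: exp_add[symmetric] field_simps)
    then show "exp (- a * pi * y * (of_int m)\<^sup>2) * (exp (- pi * k\<^sup>2 / (a / y)) * cos (2 * pi * k * (m * x)))
      = exp (- pi * y * ((of_int m)\<^sup>2 * a + (of_int k)\<^sup>2 / a)) * cos (2 * pi * k * (m * x))"
      by (simp only: mult.assoc[symmetric])
  qed
  finally show ?thesis .
qed

text \<open>The factor \<open>exp (t / 2)\<close> cancels the \<open>1 / sqrt \<alpha>\<close>
  produced by Poisson summation; this makes the two indices play symmetric roles.\<close>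

theorem ntheta_fourier:
  assumes y: "0 < y"
  shows "ntheta x y t = sqrt y * (\<Sum>\<^sub>\<infinity>v. cos (2 * pi * of_int (fst v) * of_int (snd v) * x) * fourier_weight y t v)"
proof -
  let ?g = "\<lambda>v::int\<times>int. cos (2 * pi * of_int (fst v) * of_int (snd v) * x) * fourier_weight y t v"
  have gs: "?g summable_on UNIV"
    by (rule abs_summable_summable, rule summable_on_comparison_test[OF fourier_weight_summable[OF y, of t]])
      (auto simp: abs_mult fourier_weight_def mult_left_le_one_le)
  have ls: "(\<lambda>v. exp (- exp t * qform x y v)) summable_on UNIV"
    using y by (intro qform_exp_summable) auto
  have "theta_moment x y 0 (exp t) = (\<Sum>\<^sub>\<infinity>m. \<Sum>\<^sub>\<infinity>n. exp (- exp t * qform x y (m, n)))"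
    unfolding theta_moment_def using infsum_Sigma'_banach[of "\<lambda>m n. exp (- exp t * qform x y (m, n))" UNIV "\<lambda>_. UNIV"] ls
    by (simp add: case_prod_unfold)
  also have "\<dots> = (\<Sum>\<^sub>\<infinity>m. sqrt (y / exp t) * (\<Sum>\<^sub>\<infinity>k. ?g (m, k)))"
  proof (rule infsum_cong)
    fix m :: int
    have "(\<Sum>\<^sub>\<infinity>k::int. exp (- pi * y * ((of_int m)\<^sup>2 * exp t + (of_int k)\<^sup>2 / exp t)) * cos (2 * pi * k * (m * x))) = (\<Sum>\<^sub>\<infinity>k. ?g (m, k))"
      by (intro infsum_cong) (simp add: fourier_weight_def exp_minus divide_inverse mult.commute mult.left_commute)
    then show "(\<Sum>\<^sub>\<infinity>n. exp (- exp t * qform x y (m, n))) = sqrt (y / exp t) * (\<Sum>\<^sub>\<infinity>k. ?g (m, k))"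
      unfolding qform_row_fourier[OF y exp_gt_zero] by simp
  qed
  also have "\<dots> = sqrt (y / exp t) * (\<Sum>\<^sub>\<infinity>m. \<Sum>\<^sub>\<infinity>k. ?g (m, k))"
    by (rule infsum_cmult_right')
  also have "(\<Sum>\<^sub>\<infinity>m. \<Sum>\<^sub>\<infinity>k. ?g (m, k)) = infsum ?g UNIV"
    using infsum_Sigma'_banach[of "\<lambda>m k. ?g (m, k)" UNIV "\<lambda>_. UNIV"] gs
    by (simp add: case_prod_unfold)
  finally have "ntheta x y t = exp (t / 2) * (sqrt (y / exp t) * infsum ?g UNIV)" by (simp add: ntheta_def)
  moreover have "exp (t / 2) * sqrt (y / exp t) = sqrt y"
  proof -
    have "exp t = (exp (t / 2))\<^sup>2" using exp_double[of "t / 2"] by simp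
    then have "exp (t / 2) = sqrt (exp t)" by simp
    then show ?thesis by (simp add: real_sqrt_divide)
  qed
  ultimately show ?thesis by (simp add: mult.assoc[symmetric])
qed

lemma fourier_weight_swap: "fourier_weight y (- t) (prod.swap v) = fourier_weight y t v"
  by (simp add: fourier_weight_def add.commute)

text \<open>Swapping row and dual frequency keeps the cosine, which depends only on their product,
  and turns \<open>t\<close> into \<open>- t\<close>.\<close>

lemma ntheta_even:
  assumes y: "0 < y"
  shows "ntheta x y (- t) = ntheta x y t"
proof -
  have "(\<Sum>\<^sub>\<infinity>v. cos (2 * pi * of_int (fst v) * of_int (snd v) * x) * fourier_weight y t v)
    = (\<Sum>\<^sub>\<infinity>v. cos (2 * pi * of_int (fst v) * of_int (snd v) * x) * fourier_weight y (- t) v)"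
  proof (rule infsum_reindex_bij_witness[of _ prod.swap prod.swap])
    fix v :: "int \<times> int"
    show "cos (2 * pi * of_int (fst (prod.swap v)) * of_int (snd (prod.swap v)) * x) * fourier_weight y (- t) (prod.swap v)
      = cos (2 * pi * of_int (fst v) * of_int (snd v) * x) * fourier_weight y t v"
      unfolding fourier_weight_swap by (simp add: mult.commute mult.left_commute)
  qed auto
  then show ?thesis unfolding ntheta_fourier[OF y] by simp
qed

section \<open>Tangent inequalities\<close>

text \<open>It holds for negative \<open>z\<close> too, since the remainder has the even order
  four.\<close>

lemma exp_ge_cubic:
  fixes z :: real
  shows "1 + z + z\<^sup>2/2 + z^3/6 \<le> exp z"
proof -
  obtain t where t: "exp z = (\<Sum>m<4. z ^ m / fact m) + exp t / fact 4 * z ^ 4"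
    using Maclaurin_exp_le[of z 4] by auto
  have "0 \<le> exp t / fact 4 * z ^ 4" by simp
  then show ?thesis unfolding t by (simp add: eval_nat_numeral)
qed

text \<open>The left side touches the right side at \<open>x = 0\<close> with the common slope
  \<open>- A\<close>, where \<open>A = s * (s - 3/2) * exp (- s)\<close>. Its quadratic term is not
  the Taylor one: it is \<open>A * x\<^sup>2\<close>, because \<open>x - x\<^sup>2\<close> is the
  combination whose sum over an orbit has a sign. In the variable \<open>z = s * x\<close> the
  factor \<open>exp (- s)\<close> drops out.\<close>

lemma tangent_bound_p1:
  fixes s x :: real
  assumes s: "689/100 \<le> s" and x: "- (87/200) \<le> x" "x \<le> (77/100)"
  shows "(s - 1/2) * exp (- s) - s * (s - 3/2) * exp (- s) * (x - x\<^sup>2)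
    \<le> (s * (1 + x) - 1/2) * exp (- (s * (1 + x)))"
proof -
  define z where "z = s * x"
  have zb: "- (87/200) * s \<le> z" "z \<le> (77/100) * s"
    using s x mult_left_mono[of x "(77/100)" s] mult_left_mono[of "-(87/200)" x s] by (auto simp: z_def algebra_simps)
  have xz: "x = z / s" using s by (simp add: z_def)
  have "(s - 1/2) - (s - 3/2) * (z - z\<^sup>2 / s) \<le> (s - 1/2 + z) * exp (- z)"
  proof (cases "z \<le> (31/20)")
    case True
    \<comment> \<open>The quotient by \<open>z\<^sup>2\<close> of the gap that remains after
      \<open>exp (- z)\<close> is replaced by its cubic lower bound.\<close>
    have "0 \<le> s / 2 - 9/4 + 3 / (2 * s) - z * (s - 7/2) / 6 - z\<^sup>2 / 6"
    proof (cases "0 \<le> z")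
      case z: True
      have "z * (s - 7/2) \<le> (31/20) * (s - 7/2)" using True s by (intro mult_right_mono) auto
      moreover have "z\<^sup>2 \<le> (31/20)\<^sup>2" using True z by (intro power_mono) auto
      moreover have "0 \<le> s / 2 - 9/4 + 3 / (2 * s) - (31/20) * (s - 7/2) / 6 - (31/20)\<^sup>2 / 6"
      proof -
        have "s * s \<ge> (689/50) * s - (474721/10000)" using zero_le_power2[of "s - (689/100)"]
          by (simp add: power2_eq_square algebra_simps)
        then have "0 \<le> 29/120 * (s * s) - (1397/800) * s + 3/2" using s by simp
        also have "\<dots> = s * (s / 2 - 9/4 - (31/20) * (s - 7/2) / 6 - (31/20)\<^sup>2 / 6) + 3/2"
          by (simp add: power2_eq_square field_simps)
        finally have "0 \<le> (s * (s / 2 - 9/4 - (31/20) * (s - 7/2) / 6 - (31/20)\<^sup>2 / 6) + 3/2) / s" using s by simp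
        also have "\<dots> = s / 2 - 9/4 + 3 / (2 * s) - (31/20) * (s - 7/2) / 6 - (31/20)\<^sup>2 / 6"
          using s by (simp add: add_divide_distrib)
        finally show ?thesis .
      qed
      ultimately show ?thesis by linarith
    next
      case z: False
      have "0 \<le> (- z) * (s - 7/2 + z)" using z zb s by (intro mult_nonneg_nonneg) auto
      moreover have "0 \<le> 3 / (2 * s)" using s by simp
      moreover have "- (z * (s - 7/2) / 6) - z\<^sup>2 / 6 = (- z) * (s - 7/2 + z) / 6"
        by (simp add: power2_eq_square field_simps)
      ultimately show ?thesis using s by linarith
    qed
    then have "0 \<le> z\<^sup>2 * (s / 2 - 9/4 + 3 / (2 * s) - z * (s - 7/2) / 6 - z\<^sup>2 / 6)" by simp
    also have "\<dots> = (s - 1/2 + z) * (1 + (- z) + (- z)\<^sup>2/2 + (- z)^3/6) - ((s - 1/2) - (s - 3/2) * (z - z\<^sup>2 / s))"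
      using s by (simp add: field_simps power2_eq_square power3_eq_cube)
    also have "\<dots> \<le> (s - 1/2 + z) * exp (- z) - ((s - 1/2) - (s - 3/2) * (z - z\<^sup>2 / s))"
      using zb s by (intro diff_right_mono mult_left_mono exp_ge_cubic) auto
    finally show ?thesis by simp
  next
    case False
    \<comment> \<open>For large \<open>z\<close> the left side is already nonpositive: the chord of
      \<open>z\<^sup>2\<close> over \<open>[31/20, 77/100 * s]\<close> bounds
      \<open>z - z\<^sup>2 / s\<close> from below.\<close>
    have "0 \<le> (z - (31/20)) * ((77/100) * s - z)" using False zb by (intro mult_nonneg_nonneg) auto
    then have "z\<^sup>2 \<le> z * ((31/20) + (77/100) * s) - (2387/2000) * s" by (simp add: power2_eq_square field_simps)
    then have "z\<^sup>2 / s \<le> (z * ((31/20) + (77/100) * s) - (2387/2000) * s) / s" using s by (intro divide_right_mono) auto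
    also have "\<dots> = z * ((31/20) / s + (77/100)) - (2387/2000)" using s by (simp add: field_simps)
    finally have 1: "z - z\<^sup>2 / s \<ge> z * ((23/100) - (31/20) / s) + (2387/2000)" by (simp add: algebra_simps)
    have "(31/20) / s \<le> (23/100)" using s by (simp add: field_simps)
    then have "z * ((23/100) - (31/20) / s) \<ge> (31/20) * ((23/100) - (31/20) / s)" using False by (intro mult_right_mono) auto
    moreover have "(31/20) * ((23/100) - (31/20) / s) = 713/2000 - (961/400) / s" by (simp add: field_simps)
    ultimately have 2: "z - z\<^sup>2 / s \<ge> (31/20) - (961/400) / s" using 1 by linarith
    have "0 \<le> (s - (689/100)) * ((11/20) * (s - (689/100)) + (67/20))" using s by (intro mult_nonneg_nonneg) auto
    then have "0 \<le> (s - 3/2) * ((31/20) * s - (961/400)) - s * (s - 1/2)" using s by (simp add: field_simps)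
    then have "0 \<le> ((s - 3/2) * ((31/20) * s - (961/400)) - s * (s - 1/2)) / s" using s by simp
    also have "\<dots> = (s - 3/2) * ((31/20) - (961/400) / s) - (s - 1/2)" using s by (simp add: field_simps)
    finally have "s - 1/2 \<le> (s - 3/2) * ((31/20) - (961/400) / s)" by simp
    also have "\<dots> \<le> (s - 3/2) * (z - z\<^sup>2 / s)" using 2 s by (intro mult_left_mono) auto
    finally have "(s - 1/2) - (s - 3/2) * (z - z\<^sup>2 / s) \<le> 0" by simp
    also have "0 \<le> (s - 1/2 + z) * exp (- z)" using s False by simp
    finally show ?thesis .
  qed
  then have "exp (- s) * ((s - 1/2) - (s - 3/2) * (z - z\<^sup>2 / s)) \<le> exp (- s) * ((s - 1/2 + z) * exp (- z))"
    by (intro mult_left_mono) auto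
  also have "exp (- s) * ((s - 1/2 + z) * exp (- z)) = (s * (1 + x) - 1/2) * exp (- (s * (1 + x)))"
  proof -
    have "exp (- (s * (1 + x))) = exp (- s) * exp (- z)" "s * (1 + x) = s + z"
      by (simp_all add: z_def exp_add[symmetric] algebra_simps)
    then show ?thesis by (simp add: algebra_simps)
  qed
  also have "exp (- s) * ((s - 1/2) - (s - 3/2) * (z - z\<^sup>2 / s))
     = (s - 1/2) * exp (- s) - s * (s - 3/2) * exp (- s) * (x - x\<^sup>2)"
    using s by (simp add: z_def power2_eq_square field_simps)
  finally show ?thesis .
qed

text \<open>With \<open>x = w - 1\<close> the three values of \<open>x - x\<^sup>2\<close> sum to
  exactly \<open>- (w1 + w2 + w3 - 3)\<^sup>2 / 2\<close>, so the corrections in the tangent bounds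
  together can only help.\<close>

lemma orbit_sum_ge:
  fixes \<phi> :: "real \<Rightarrow> real"
  assumes sq: "w1\<^sup>2 + w2\<^sup>2 + w3\<^sup>2 = (w1 + w2 + w3)\<^sup>2 / 2 - 3/2" and A: "0 \<le> A"
    and b: "\<And>w. w \<in> {w1, w2, w3} \<Longrightarrow> a - A * ((w - 1) - (w - 1)\<^sup>2) \<le> \<phi> w"
  shows "3 * a \<le> \<phi> w1 + \<phi> w2 + \<phi> w3"
proof -
  have "((w1 - 1) - (w1 - 1)\<^sup>2) + ((w2 - 1) - (w2 - 1)\<^sup>2) + ((w3 - 1) - (w3 - 1)\<^sup>2)
     = 3 * (w1 + w2 + w3) - (w1\<^sup>2 + w2\<^sup>2 + w3\<^sup>2) - 6"
    by (simp add: power2_eq_square algebra_simps)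
  also have "\<dots> = - ((w1 + w2 + w3 - 3)\<^sup>2 / 2)"
    unfolding sq by (simp add: power2_eq_square field_simps)
  also have "\<dots> \<le> 0" by simp
  finally have "A * (((w1 - 1) - (w1 - 1)\<^sup>2) + ((w2 - 1) - (w2 - 1)\<^sup>2) + ((w3 - 1) - (w3 - 1)\<^sup>2)) \<le> 0"
    using A by (rule mult_nonneg_nonpos[rotated])
  then show ?thesis using b[of w1] b[of w2] b[of w3] by (simp add: algebra_simps)
qed

text \<open>A convex function lies above its horizontal tangent at \<open>c\<close>.\<close>

lemma nonneg_of_second_deriv:
  fixes f f' f'' :: "real \<Rightarrow> real"
  assumes d1: "\<And>z. z \<in> {a..b} \<Longrightarrow> (f has_real_derivative f' z) (at z)"
    and d2: "\<And>z. z \<in> {a..b} \<Longrightarrow> (f' has_real_derivative f'' z) (at z)"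
    and nn: "\<And>z. z \<in> {a..b} \<Longrightarrow> 0 \<le> f'' z"
    and c: "c \<in> {a..b}" "f c = 0" "f' c = 0" and z: "z \<in> {a..b}"
  shows "0 \<le> f z"
proof (cases "c \<le> z")
  case True
  have "f' c \<le> f' w" if w: "w \<in> {c..z}" for w
  proof (rule DERIV_nonneg_imp_nondecreasing[of c w f'])
    fix x assume "c \<le> x" "x \<le> w"
    then have "x \<in> {a..b}" using w c z by auto
    then show "\<exists>y. (f' has_real_derivative y) (at x) \<and> 0 \<le> y" using d2 nn by blast
  qed (use w in auto)
  then have f'0: "0 \<le> f' w" if "w \<in> {c..z}" for w using that c by auto
  have "f c \<le> f z"
  proof (rule DERIV_nonneg_imp_nondecreasing[of c z f])
    fix x assume x: "c \<le> x" "x \<le> z"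
    then have "x \<in> {a..b}" using c z by auto
    then show "\<exists>y. (f has_real_derivative y) (at x) \<and> 0 \<le> y" using d1 f'0[of x] x by auto
  qed (use True in auto)
  then show ?thesis using c by simp
next
  case False
  have "f' w \<le> f' c" if w: "w \<in> {z..c}" for w
  proof (rule DERIV_nonneg_imp_nondecreasing[of w c f'])
    fix x assume "w \<le> x" "x \<le> c"
    then have "x \<in> {a..b}" using w c z by auto
    then show "\<exists>y. (f' has_real_derivative y) (at x) \<and> 0 \<le> y" using d2 nn by blast
  qed (use w in auto)
  then have f'0: "f' w \<le> 0" if "w \<in> {z..c}" for w using that c by auto
  have "f c \<le> f z"
  proof (rule DERIV_nonpos_imp_nonincreasing[of z c f])
    fix x assume x: "z \<le> x" "x \<le> c"
    then have "x \<in> {a..b}" using c z by auto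
    then show "\<exists>y. (f has_real_derivative y) (at x) \<and> y \<le> 0" using d1 f'0[of x] x by auto
  qed (use False in auto)
  then show ?thesis using c by simp
qed

section \<open>Numerical bounds for the exponential\<close>

lemma exp_neg2_ge: "1353/10000 \<le> exp (- 2 :: real)"
proof -
  have e: "exp 1 \<le> (2.71829::real)" "0 \<le> exp (1::real)"
    using e_approx_32 by (auto simp: abs_if split: if_splits)
  have "exp (2::real) = exp 1 * exp 1" by (simp add: exp_add[symmetric])
  also have "\<dots> \<le> 2.71829 * 2.71829" using e by (intro mult_mono) auto
  also have "\<dots> \<le> 10000/1353" by simp
  finally show ?thesis by (simp add: exp_minus field_simps)
qed

text \<open>The last denominator is \<open>44\<close> instead of \<open>120\<close> because it
  absorbs the remainder factor \<open>exp t \<le> exp 1\<close>; \<open>120 / 44\<close> is still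
  above \<open>exp 1\<close>.\<close>

lemma exp_le_quintic:
  fixes x :: real
  assumes "0 \<le> x" "x \<le> 1"
  shows "exp x \<le> 1 + x + x\<^sup>2/2 + x^3/6 + x^4/24 + x^5/44"
proof -
  obtain t where t: "\<bar>t\<bar> \<le> \<bar>x\<bar>" "exp x = (\<Sum>m<5. x ^ m / fact m) + exp t / fact 5 * x ^ 5"
    using Maclaurin_exp_le[of x 5] by auto
  have "exp t \<le> exp 1" using t(1) assms by simp
  also have "\<dots> \<le> 120 / 44" using e_approx_32 by (auto simp: abs_if split: if_splits)
  finally have "exp t / fact 5 \<le> 1 / 44" by (simp add: fact_numeral)
  then have "exp t / fact 5 * x ^ 5 \<le> 1 / 44 * x ^ 5" using assms by (intro mult_right_mono) auto
  then show ?thesis using t(2) by (simp add: eval_nat_numeral)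
qed

lemma exp_ge_quartic:
  fixes x :: real
  assumes "0 \<le> x"
  shows "1 + x + x\<^sup>2/2 + x^3/6 + x^4/24 \<le> exp x"
proof -
  obtain t where t: "exp x = (\<Sum>m<5. x ^ m / fact m) + exp t / fact 5 * x ^ 5"
    using Maclaurin_exp_le[of x 5] by auto
  have "0 \<le> exp t / fact 5 * x ^ 5" using assms by simp
  then show ?thesis unfolding t by (simp add: eval_nat_numeral)
qed

text \<open>A numerical device: an exponent is split into \<open>n\<close> equal small parts, one
  part is bounded by a Taylor polynomial, and the rational bound is raised to the power
  \<open>n\<close>.\<close>

lemma exp_le_power:
  fixes r :: real
  assumes "0 \<le> r" "r \<le> 1" "1 + r + r\<^sup>2/2 + r^3/6 + r^4/24 + r^5/44 \<le> b"
  shows "exp (real n * r) \<le> b ^ n"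
proof -
  have "exp r \<le> b" using exp_le_quintic[OF assms(1,2)] assms(3) by simp
  then have "exp r ^ n \<le> b ^ n" by (intro power_mono) auto
  then show ?thesis by (simp add: exp_of_nat_mult)
qed

lemma exp_ge_power:
  fixes r :: real
  assumes "0 \<le> r" "0 \<le> b" "b \<le> 1 + r + r\<^sup>2/2 + r^3/6 + r^4/24"
  shows "b ^ n \<le> exp (real n * r)"
proof -
  have "b \<le> exp r" using exp_ge_quartic[OF assms(1)] assms(3) by simp
  then have "b ^ n \<le> exp r ^ n" using assms(2) by (intro power_mono) auto
  then show ?thesis by (simp add: exp_of_nat_mult)
qed

lemma three_le_exp: "(3::real) \<le> exp (11/10)"
proof -
  have "(3 :: real) \<le> (1056540/1000000) ^ 20" by (simp add: power_divide)
  also have "\<dots> \<le> exp (real 20 * (11/200))" by (rule exp_ge_power) (simp_all add: power_divide)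
  finally show ?thesis by simp
qed

text \<open>\<open>fB = p3 - (11/5) p2\<close>, \<open>gB = fB - fB'\<close> and \<open>hB = gB - gB'\<close>. The polynomial inequalities for
  these functions become visible after expansion at the end point of the range of \<open>s\<close>.\<close>

definition fB :: "real \<Rightarrow> real" where "fB s = s^3 - 67/10 * s\<^sup>2 + 153/20 * s - 27/40"
definition gB :: "real \<Rightarrow> real" where "gB s = s^3 - 97/10 * s\<^sup>2 + 421/20 * s - 333/40"
definition hB :: "real \<Rightarrow> real" where "hB s = s^3 - 127/10 * s\<^sup>2 + 809/20 * s - 235/8"

lemma fB_deriv: "((\<lambda>z. fB (s + z) * exp (- z)) has_real_derivative - gB (s + z) * exp (- z)) (at z)"
  unfolding fB_def gB_def
  by (auto intro!: derivative_eq_intros simp: field_simps eval_nat_numeral)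

lemma gB_deriv: "((\<lambda>z. - gB (s + z) * exp (- z)) has_real_derivative hB (s + z) * exp (- z)) (at z)"
  unfolding gB_def hB_def
  by (auto intro!: derivative_eq_intros simp: field_simps eval_nat_numeral)

text \<open>The right side is the second derivative of \<open>fB (s + z) * exp (- z)\<close> at
  \<open>z = 2 - v\<close>, for \<open>s = 272/25 + p\<close>; the left side is the polynomial part
  of \<open>2 * gB s / s\<close>, which exceeds it. With the two lower bounds for \<open>hB\<close>
  below, this is the convexity behind the tangent inequality for \<open>fB\<close>; here
  \<open>0 \<le> z \<le> 2\<close>. The number \<open>272/25\<close> is just below
  \<open>3 * pi / rho_im\<close>, the second smallest nonzero value of the form at rho.\<close>

lemma hB_exp_lower_right:
  fixes p v :: real
  assumes p: "0 \<le> p" and v: "0 \<le> v" "v \<le> 2"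
  shows "2 * ((272/25 + p)\<^sup>2 - 97/10 * (272/25 + p) + 421/20) \<le> hB (272/25 + p + 2 - v) * exp (- 2 + v)"
proof -
  \<comment> \<open>As \<open>v \<le> 2\<close>, higher powers reduce to lower ones, and the
    negative coefficients of the expansion are absorbed linearly.\<close>
  have pw: "v^4 \<le> 2 * v^3" "v^6 \<le> 8 * v^3" "p * v^4 \<le> p * (2 * v^3)" "p^2 * v^4 \<le> p^2 * (2 * v^3)"
  proof -
    show 1: "v^4 \<le> 2 * v^3" using v mult_right_mono[of v 2 "v^3"] by (simp add: eval_nat_numeral)
    show "p * v^4 \<le> p * (2 * v^3)" "p^2 * v^4 \<le> p^2 * (2 * v^3)" using 1 p by (auto intro!: mult_left_mono)
    have "v^3 * v^3 \<le> 2^3 * v^3" using v power_mono[of v 2 3] by (intro mult_right_mono) auto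
    then show "v^6 \<le> 8 * v^3" by (simp add: eval_nat_numeral)
  qed
  have v32: "v^3 \<le> 2 * v^2" "p * v^3 \<le> p * (2 * v^2)" "p^2 * v^3 \<le> p^2 * (2 * v^2)"
  proof -
    show 1: "v^3 \<le> 2 * v^2" using v mult_right_mono[of v 2 "v^2"] by (simp add: eval_nat_numeral)
    show "p * v^3 \<le> p * (2 * v^2)" "p^2 * v^3 \<le> p^2 * (2 * v^2)" using 1 p by (auto intro!: mult_left_mono)
  qed
  have v21: "v^2 \<le> 2 * v" "p * v^2 \<le> p * (2 * v)"
  proof -
    show 1: "v^2 \<le> 2 * v" using v mult_right_mono[of v 2 v] by (simp add: eval_nat_numeral)
    show "p * v^2 \<le> p * (2 * v)" using 1 p by (auto intro!: mult_left_mono)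
  qed
  have nn: "0 \<le> v^2" "0 \<le> v^3" "0 \<le> v^5" "0 \<le> p * v" "0 \<le> p * v^2" "0 \<le> p * v^3" "0 \<le> p * v^5"
    "0 \<le> p^2" "0 \<le> p^2 * v" "0 \<le> p^2 * v^2" "0 \<le> p^2 * v^3" "0 \<le> p^3" "0 \<le> p^3 * v" "0 \<le> p^3 * v^2" "0 \<le> p^3 * v^3"
    using p v by auto
  have "0 \<le> (3474641897/1250000000) + (52513446447/1250000000) * v + (25605455997/2500000000) * v^2 + (2152306849/2500000000) * v^3
      + (-156904253/50000000) * v^4 + (517297/1000000) * v^5 + (-451/20000) * v^6 + (110643909/25000000) * p + (538159809/25000000) * p * v
      + (382970709/50000000) * p * v^2 + (82692203/50000000) * p * v^3 + (-30217/31250) * p * v^4 + (1353/20000) * p * v^5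
      + (754841/500000) * p^2 + (1551891/500000) * p^2 * v + (1348941/1000000) * p^2 * v^2 + (381997/1000000) * p^2 * v^3
      + (-1353/20000) * p^2 * v^4 + (1353/10000) * p^3 + (1353/10000) * p^3 * v + (1353/20000) * p^3 * v^2 + (451/20000) * p^3 * v^3"
    using pw v32 v21 nn p v by linarith
  also have "\<dots> = hB (272/25 + p + 2 - v) * (1353/10000 * (1 + v + v\<^sup>2/2 + v^3/6)) - 2 * ((272/25 + p)\<^sup>2 - 97/10 * (272/25 + p) + 421/20)"
    unfolding hB_def by (simp add: field_simps eval_nat_numeral)
  finally have 1: "2 * ((272/25 + p)\<^sup>2 - 97/10 * (272/25 + p) + 421/20) \<le> hB (272/25 + p + 2 - v) * (1353/10000 * (1 + v + v\<^sup>2/2 + v^3/6))"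
    by simp
  have "1353/10000 * (1 + v + v\<^sup>2/2 + v^3/6) \<le> exp (-2) * exp v"
    using exp_neg2_ge exp_ge_cubic[of v] v by (intro mult_mono) auto
  then have 2: "1353/10000 * (1 + v + v\<^sup>2/2 + v^3/6) \<le> exp (- 2 + v)" by (simp only: exp_add)
  define r where "r = p + 2 - v"
  have r: "0 \<le> r" "272/25 + p + 2 - v = 272/25 + r" using p v by (auto simp: r_def)
  have "hB (272/25 + p + 2 - v) = 2440567/12500 + 298053/2500 * r + 997/50 * r^2 + r^3 + (hB (272/25) - 2440567/12500)"
    unfolding r(2) hB_def by (simp add: field_simps eval_nat_numeral)
  moreover have "hB (272/25) \<ge> 2440567/12500 - 1" unfolding hB_def by (simp add: eval_nat_numeral)
  ultimately have "0 \<le> hB (272/25 + p + 2 - v)"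
    using zero_le_power[OF r(1), of 2] zero_le_power[OF r(1), of 3] r(1) by linarith
  then have "hB (272/25 + p + 2 - v) * (1353/10000 * (1 + v + v\<^sup>2/2 + v^3/6)) \<le> hB (272/25 + p + 2 - v) * exp (- 2 + v)"
    using 2 by (intro mult_left_mono)
  then show ?thesis using 1 by linarith
qed

text \<open>The case \<open>z = - v\<close> with \<open>s + z\<close> still at least
  \<open>272/25\<close>: in \<open>q\<close> and \<open>v\<close> all coefficients of the difference
  are nonnegative.\<close>

lemma hB_exp_lower_middle:
  fixes q v :: real
  assumes q: "0 \<le> q" and v: "0 \<le> v"
  shows "2 * ((272/25 + q + v)\<^sup>2 - 97/10 * (272/25 + q + v) + 421/20) \<le> hB (272/25 + q) * exp v"
proof -
  have "0 \<le> (15937849/125000) + (21394949/125000) * v + (23909949/250000) * v^2 + (24409949/750000) * v^3 + (237753/2500) * q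
      + (288053/2500) * q * v + (298053/5000) * q * v^2 + (99351/5000) * q * v^3 + (897/50) * q^2 + (997/50) * q^2 * v + (997/100) * q^2 * v^2
      + (997/300) * q^2 * v^3 + (1) * q^3 + (1) * q^3 * v + (1/2) * q^3 * v^2 + (1/6) * q^3 * v^3" using q v by simp
  also have "\<dots> = hB (272/25 + q) * (1 + v + v\<^sup>2/2 + v^3/6) - 2 * ((272/25 + q + v)\<^sup>2 - 97/10 * (272/25 + q + v) + 421/20)"
    unfolding hB_def by (simp add: field_simps eval_nat_numeral)
  finally have 1: "2 * ((272/25 + q + v)\<^sup>2 - 97/10 * (272/25 + q + v) + 421/20) \<le> hB (272/25 + q) * (1 + v + v\<^sup>2/2 + v^3/6)" by simp
  have "hB (272/25 + q) = 2440567/12500 + 298053/2500 * q + 997/50 * q^2 + q^3 + (hB (272/25) - 2440567/12500)"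
    unfolding hB_def by (simp add: field_simps eval_nat_numeral)
  moreover have "hB (272/25) \<ge> 2440567/12500 - 1" unfolding hB_def by (simp add: eval_nat_numeral)
  ultimately have "0 \<le> hB (272/25 + q)"
    using zero_le_power[OF q, of 2] zero_le_power[OF q, of 3] q by linarith
  then have "hB (272/25 + q) * (1 + v + v\<^sup>2/2 + v^3/6) \<le> hB (272/25 + q) * exp v"
    using exp_ge_cubic[of v] by (intro mult_left_mono) auto
  then show ?thesis using 1 by linarith
qed

lemma exp_247_le: "exp (247/100 :: real) \<le> 14"
proof -
  have e: "exp 1 \<le> (2.71829::real)" using e_approx_32 by (auto simp: abs_if split: if_splits)
  have "(exp (247/100::real))\<^sup>2 = exp (494/100)" by (simp add: power2_eq_square exp_add[symmetric])
  also have "\<dots> \<le> exp (5 * 1)" by simp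
  also have "exp (5 * 1 :: real) = exp 1 ^ 5" using exp_of_nat_mult[of 5 "1::real"] by simp
  also have "\<dots> \<le> 2.71829 ^ 5" using e by (intro power_mono) auto
  also have "\<dots> \<le> (14::real)\<^sup>2" by (simp add: eval_nat_numeral)
  finally show ?thesis by (rule power2_le_imp_le) simp
qed

text \<open>The case \<open>841/100 \<le> s + z \<le> 272/25\<close>, where \<open>841/100\<close>
  is \<open>773/1000 * (272/25)\<close> rounded down. On this interval a linear lower bound of
  \<open>hB\<close> lies above a multiple of the chord of \<open>exp\<close>, so \<open>hB\<close>
  dominates \<open>736/100 * exp q\<close>; the exponentials then combine and \<open>q\<close>
  disappears.\<close>

lemma hB_exp_lower_left:
  fixes p q :: real
  assumes p: "0 \<le> p" and q0: "0 \<le> q" "q \<le> 247/100"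
  shows "2 * ((272/25 + p)\<^sup>2 - 97/10 * (272/25 + p) + 421/20) \<le> hB (841/100 + q) * exp (272/25 + p - (841/100 + q))"
proof -
  have "hB (841/100 + q) = hB (841/100) + (3 * (841/100)^2 - 127/5 * (841/100) + 809/20) * q + (3 * (841/100) - 127/10) * q\<^sup>2 + q ^ 3"
    unfolding hB_def by (simp add: field_simps eval_nat_numeral)
  moreover have "hB (841/100) \<ge> 736/100" unfolding hB_def by (simp add: eval_nat_numeral)
  moreover have "39 * q \<le> (3 * (841/100)^2 - 127/5 * (841/100) + 809/20) * q" using q0 by (intro mult_right_mono) (auto simp: power2_eq_square)
  moreover have "0 \<le> (3 * (841/100) - 127/10) * q\<^sup>2" "0 \<le> q ^ 3" using q0 by auto
  ultimately have 1: "736/100 + 39 * q \<le> hB (841/100 + q)" by linarith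
  have "exp q \<le> 1 + 529/100 * q"
  proof -
    have "convex_on {0..247/100} (exp :: real \<Rightarrow> real)"
      by (rule convex_on_subset[OF exp_convex]) auto
    then have "exp q \<le> (exp (247/100) - exp 0) / (247/100 - 0) * (q - 0) + exp 0"
      using q0 by (intro convex_onD_Icc') auto
    moreover have "(exp (247/100) - 1) / (247/100) * q \<le> 529/100 * q" using q0 exp_247_le by (intro mult_right_mono) auto
    ultimately show ?thesis by simp
  qed
  then have "736/100 * exp q \<le> 736/100 + 39 * q" using q0 by simp
  then have "736/100 * exp q \<le> hB (841/100 + q)" using 1 by linarith
  then have "736/100 * exp q * exp (272/25 + p - (841/100 + q)) \<le> hB (841/100 + q) * exp (272/25 + p - (841/100 + q))" by (intro mult_right_mono) auto
  also have "736/100 * exp q * exp (272/25 + p - (841/100 + q)) = 736/100 * (exp (247/100) * exp p)"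
    by (simp add: exp_add[symmetric] mult.assoc)
  finally have 2: "736/100 * (exp (247/100) * exp p) \<le> hB (841/100 + q) * exp (272/25 + p - (841/100 + q))" .
  have "1 + 247/100 + (247/100)\<^sup>2/2 + (247/100)^3/6 + (247/100)^4/24 \<le> exp (247/100::real)"
    by (rule exp_ge_quartic) simp
  then have "(105/10::real) \<le> exp (247/100)" by (simp add: eval_nat_numeral)
  moreover have "1 + p + p\<^sup>2/2 \<le> exp p" using exp_ge_cubic[of p] zero_le_power[OF p, of 3] by linarith
  ultimately have "105/10 * (1 + p + p\<^sup>2/2) \<le> exp (247/100) * exp p" using p by (intro mult_mono) auto
  then have "736/100 * (105/10 * (1 + p + p\<^sup>2/2)) \<le> 736/100 * (exp (247/100) * exp p)" by simp
  moreover have "2 * ((272/25 + p)\<^sup>2 - 97/10 * (272/25 + p) + 421/20) = 84721/1250 + 603/25 * p + 2 * p\<^sup>2"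
    by (simp add: field_simps power2_eq_square)
  moreover have "84721/1250 + 603/25 * p + 2 * p\<^sup>2 \<le> 736/100 * (105/10 * (1 + p + p\<^sup>2/2))"
    using p zero_le_power[OF p, of 2] by (simp add: field_simps)
  ultimately show ?thesis using 2 by linarith
qed

text \<open>The analogue for \<open>fB\<close> of the tangent inequality for \<open>p1\<close>, with
  slope \<open>- s * gB s * exp (- s)\<close> at \<open>w = 1\<close>. Up to \<open>z = 2\<close> it
  follows from convexity in \<open>z = s * (w - 1)\<close>, beyond that from a nonpositive left
  side. The range of \<open>w\<close> contains \<open>[1 / h, h]\<close> for
  \<open>h = 12935/10000\<close>.\<close>

lemma tangent_bound_fB_far:
  assumes s: "272/25 \<le> s" and w: "773/1000 \<le> w" "w \<le> 1294/1000"
  shows "fB s * exp (- s) - s * gB s * exp (- s) * ((w - 1) - (w - 1)\<^sup>2) \<le> fB (s * w) * exp (- (s * w))"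
proof -
  define p where "p = s - 272/25"
  have p: "0 \<le> p" and sp: "s = 272/25 + p" using s by (auto simp: p_def)
  define z where "z = s * (w - 1)"
  have zl: "- 227/1000 * s \<le> z" and zu: "z \<le> 294/1000 * s"
    using s w mult_left_mono[of "w - 1" "294/1000" s] mult_left_mono[of "-227/1000" "w - 1" s]
    by (auto simp: z_def algebra_simps)
  have wz: "s * w = s + z" "w - 1 = z / s" using s by (simp_all add: z_def right_diff_distrib diff_divide_distrib)
  have gpos: "0 < gB s"
  proof -
    have "gB s = 45047599/125000 + 412753/2500 * p + 1147/50 * p^2 + p^3"
      unfolding gB_def sp by (simp add: field_simps eval_nat_numeral)
    also have "\<dots> > 0" using p by (intro add_pos_nonneg) auto
    finally show ?thesis .
  qed
  define G where "G = 2 * (s\<^sup>2 - 97/10 * s + 421/20)"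
  have G: "2 * gB s / s \<le> G"
    using s unfolding G_def gB_def by (simp add: field_simps eval_nat_numeral)
  have main: "fB s - gB s * (z - z\<^sup>2 / s) \<le> fB (s + z) * exp (- z)" if z2: "z \<le> 2"
  proof -
    define b where "b = min 2 (294/1000 * s)"
    have "0 \<le> fB (s + z) * exp (- z) - fB s + gB s * (z - z\<^sup>2 / s)"
    proof (rule nonneg_of_second_deriv[where a="-227/1000 * s" and b=2 and c=0 and z=z
          and f="\<lambda>z. fB (s + z) * exp (- z) - fB s + gB s * (z - z\<^sup>2 / s)"
          and f'="\<lambda>z. - gB (s + z) * exp (- z) + gB s * (1 - 2 * z / s)"
          and f''="\<lambda>z. hB (s + z) * exp (- z) - 2 * gB s / s"])
      fix z :: real assume z: "z \<in> {- 227 / 1000 * s..2}"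
      have 1: "((\<lambda>z. gB s * (z - z\<^sup>2 / s)) has_real_derivative gB s * (1 - 2 * z / s)) (at z)"
        using s by (auto intro!: derivative_eq_intros simp: field_simps)
      show "((\<lambda>z. fB (s + z) * exp (- z) - fB s + gB s * (z - z\<^sup>2 / s)) has_real_derivative
             - gB (s + z) * exp (- z) + gB s * (1 - 2 * z / s)) (at z)"
        using DERIV_add[OF DERIV_diff[OF fB_deriv DERIV_const] 1] by simp
      have 2: "((\<lambda>z. gB s * (1 - 2 * z / s)) has_real_derivative - 2 * gB s / s) (at z)"
        using s by (auto intro!: derivative_eq_intros simp: field_simps)
      show "((\<lambda>z. - gB (s + z) * exp (- z) + gB s * (1 - 2 * z / s)) has_real_derivative
             hB (s + z) * exp (- z) - 2 * gB s / s) (at z)"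
        using DERIV_add[OF gB_deriv 2] by simp
      have "G \<le> hB (s + z) * exp (- z)"
      proof (cases "0 \<le> z")
        case True
        have e: "272/25 + p + 2 - (2 - z) = s + z" "- 2 + (2 - z) = - z" by (simp_all add: sp)
        show ?thesis using hB_exp_lower_right[OF p, of "2 - z"] True z unfolding e G_def sp by simp
      next
        case False
        show ?thesis
        proof (cases "272/25 \<le> s + z")
          case True
          then show ?thesis using hB_exp_lower_middle[of "s + z - 272/25" "- z"] False by (simp add: G_def)
        next
          case F2: False
          have "0 \<le> s + z - 841/100" "s + z - 841/100 \<le> 247/100" using z s F2 by auto
          note h = hB_exp_lower_left[OF p this]
          have e: "841/100 + (s + z - 841/100) = s + z" "272/25 + p - (s + z) = - z" by (simp_all add: sp)
          show ?thesis using h unfolding e G_def sp by (simp add: add.assoc)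
        qed
      qed
      then show "0 \<le> hB (s + z) * exp (- z) - 2 * gB s / s" using G by linarith
    qed (use s zl z2 in auto)
    then show ?thesis by simp
  qed
  have key: "fB s - gB s * (z - z\<^sup>2 / s) \<le> fB (s + z) * exp (- z)"
  proof (cases "z \<le> 2")
    case False
    have "0 \<le> (z - 2) * (294/1000 * s - z)" using False zu by (intro mult_nonneg_nonneg) auto
    then have "z\<^sup>2 / s \<le> (z * (2 + 294/1000 * s) - 588/1000 * s) / s" using s
      by (intro divide_right_mono) (auto simp: power2_eq_square field_simps)
    also have "\<dots> = z * (2 / s + 294/1000) - 588/1000" using s by (simp add: field_simps)
    finally have 1: "z - z\<^sup>2 / s \<ge> z * (706/1000 - 2 / s) + 588/1000" by (simp add: algebra_simps)
    have "2 / s \<le> 706/1000" using s by (simp add: field_simps)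
    then have "z * (706/1000 - 2 / s) \<ge> 2 * (706/1000 - 2 / s)" using False by (intro mult_right_mono) auto
    with 1 have 2: "z - z\<^sup>2 / s \<ge> 2 - 4 / s" by simp
    have "0 \<le> (92706557/781250) + (89355181/125000) * p + (596021/2500) * p^2 + (1341/50) * p^3 + (1) * p^4" using p by simp
    also have "\<dots> = gB s * (2 * s - 4) - s * fB s"
      unfolding gB_def fB_def sp by (simp add: field_simps eval_nat_numeral)
    finally have "0 \<le> (gB s * (2 * s - 4) - s * fB s) / s" using s by simp
    also have "\<dots> = gB s * (2 - 4 / s) - fB s" using s by (simp add: field_simps)
    finally have "fB s \<le> gB s * (2 - 4 / s)" by simp
    also have "\<dots> \<le> gB s * (z - z\<^sup>2 / s)" using 2 gpos by (intro mult_left_mono) auto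
    finally have "fB s - gB s * (z - z\<^sup>2 / s) \<le> 0" by simp
    also have "0 \<le> fB (s + z) * exp (- z)"
    proof -
      define r where "r = s + z - 841/100"
      have r: "0 \<le> r" "s + z = 841/100 + r" using s False by (auto simp: r_def)
      have "fB (s + z) = 184606551/1000000 + 1071403/10000 * r + 1853/100 * r^2 + r^3"
        unfolding fB_def r(2) by (simp add: field_simps eval_nat_numeral)
      then show ?thesis using r by simp
    qed
    finally show ?thesis .
  qed (rule main)
  then have "exp (- s) * (fB s - gB s * (z - z\<^sup>2 / s)) \<le> exp (- s) * (fB (s + z) * exp (- z))"
    by (intro mult_left_mono) auto
  also have "exp (- s) * (fB (s + z) * exp (- z)) = fB (s * w) * exp (- (s * w))"
  proof -
    have "exp (- (s + z)) = exp (- s) * exp (- z)" by (simp add: exp_add[symmetric])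
    then show ?thesis unfolding wz(1) by simp
  qed
  also have "exp (- s) * (fB s - gB s * (z - z\<^sup>2 / s)) = fB s * exp (- s) - s * gB s * exp (- s) * ((w - 1) - (w - 1)\<^sup>2)"
    unfolding wz using s by (simp add: power2_eq_square field_simps)
  finally show ?thesis .
qed

text \<open>On the first shell \<open>gB s\<close> is negative, and the second derivative of
  \<open>fB (s + z) * exp (- z)\<close> can be negative as well. Its lower bound goes through an
  intermediate constant: \<open>hB s' * exp (- s')\<close> is minimal close to
  \<open>s' = 9/2\<close>, where \<open>hB\<close> equals \<open>- 134/10\<close>, hence it stays
  above \<open>- (1345/100) * exp (- 9/2)\<close>.\<close>

lemma hB_first:
  fixes s s' :: real
  assumes s: "3627/1000 \<le> s" "s \<le> 381/100" and s': "28/10 \<le> s'" "s' \<le> 493/100"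
  shows "0 \<le> hB s' * exp (s - s') - 2 * gB s / (105/100 * s)"
proof -
  define d where "d = s' - 9/2"
  have d: "- (17/10) \<le> d" "d \<le> 43/100" "s' = 9/2 + d" using s' by (auto simp: d_def)
  have "0 \<le> 1345/100 * (1 + d + d\<^sup>2/2 + d^3/6) + hB s'"
  proof -
    have e: "1345/100 * (1 + d + d\<^sup>2/2 + d^3/6) + hB s' = 1/20 + 7/20 * d + 301/40 * d\<^sup>2 + 389/120 * d^3"
      unfolding hB_def d(3) by (simp add: field_simps eval_nat_numeral)
    have "d^3 = d * d\<^sup>2" by (simp add: eval_nat_numeral)
    moreover have "- (17/10) * d\<^sup>2 \<le> d * d\<^sup>2" using d by (intro mult_right_mono) auto
    ultimately have "1/20 + 7/20 * d + 2 * d\<^sup>2 \<le> 1/20 + 7/20 * d + 301/40 * d\<^sup>2 + 389/120 * d^3"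
      using zero_le_power2[of d] by linarith
    moreover have "0 \<le> 1/20 + 7/20 * d + 2 * d\<^sup>2"
    proof -
      have "0 \<le> 2 * (d + 7/80)\<^sup>2" by simp
      then show ?thesis by (simp add: power2_eq_square field_simps)
    qed
    ultimately show ?thesis using e by linarith
  qed
  also have "\<dots> \<le> 1345/100 * exp d + hB s'" using exp_ge_cubic[of d] by simp
  finally have "0 \<le> (1345/100 * exp d + hB s') * exp (s - s')" by simp
  also have "\<dots> = 1345/100 * exp (s - 9/2) + hB s' * exp (s - s')"
    by (simp add: distrib_right exp_add[symmetric] d_def mult.assoc)
  finally have 1: "- (1345/100) * exp (s - 9/2) \<le> hB s' * exp (s - s')" by simp
  define v where "v = s - 3627/1000"
  have v: "0 \<le> v" "v \<le> 183/1000" "s = 3627/1000 + v" using s by (auto simp: v_def)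
  define u where "u = 9/2 - s"
  have u: "0 \<le> u" using s by (simp add: u_def)
  have gneg: "gB s < 0"
  proof -
    have "s * s \<le> 381/100 * s" using s by (intro mult_right_mono) auto
    moreover have "s * (s * s) \<le> 381/100 * (s * s)" using s by (intro mult_right_mono) auto
    moreover have "gB s = s * (s * s) - 97/10 * (s * s) + 421/20 * s - 333/40" by (simp add: gB_def eval_nat_numeral)
    moreover have "3627/1000 * s \<le> s * s" using s by (intro mult_right_mono) auto
    ultimately show ?thesis using s by linarith
  qed
  have pw: "v^2 \<le> 183/1000 * v" "v^3 \<le> 183/1000 * v^2" "v^4 \<le> 183/1000 * v^3" "v^5 \<le> 183/1000 * v^4"
     "v^6 \<le> 183/1000 * v^5" "v^7 \<le> 183/1000 * v^6"
    using v mult_right_mono[of v "183/1000" v] mult_right_mono[of v "183/1000" "v^2"] mult_right_mono[of v "183/1000" "v^3"]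
      mult_right_mono[of v "183/1000" "v^4"] mult_right_mono[of v "183/1000" "v^5"] mult_right_mono[of v "183/1000" "v^6"]
    by (auto simp: eval_nat_numeral)
  have nn: "0 \<le> v^2" "0 \<le> v^3" "0 \<le> v^4" "0 \<le> v^5" "0 \<le> v^6" "0 \<le> v^7" using v by auto
  have "0 \<le> (21941985058821310365099/8000000000000000000000) + (-92788301247739840141/8000000000000000000) * v
      + (-101898434896509849/8000000000000000) * v^2 + (12477789805971/1600000000000) * v^3 + (-7420452281/4800000000) * v^4
      + (-2784103/8000000) * v^5 + (6311/24000) * v^6 + (-1/24) * v^7"
    using pw nn v(1,2) by linarith
  also have "\<dots> = - gB s * (1 + u + u\<^sup>2/2 + u^3/6 + u^4/24) - 1345/100 * (105/200) * s"
    unfolding gB_def u_def v(3) by (simp add: field_simps eval_nat_numeral)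
  finally have "1345/100 * (105/200) * s \<le> - gB s * (1 + u + u\<^sup>2/2 + u^3/6 + u^4/24)" by simp
  also have "\<dots> \<le> - gB s * exp u" using gneg exp_ge_quartic[OF u] by (intro mult_left_mono) auto
  finally have "1345/100 * (105/200) * s * exp (- u) \<le> - gB s * exp u * exp (- u)" by (intro mult_right_mono) auto
  also have "\<dots> = - gB s" by (simp add: mult.assoc exp_add[symmetric])
  finally have 2: "1345/100 * (105/200) * s * exp (- u) \<le> - gB s" .
  have u': "s - 9/2 = - u" by (simp add: u_def)
  have "1345/100 * exp (s - 9/2) \<le> - 2 * gB s / (105/100 * s)"
    using s 2 unfolding u' by (simp add: field_simps)
  then show ?thesis using 1 by simp
qed

text \<open>With \<open>gB s < 0\<close> the quadratic coefficient \<open>gB s / s\<close> would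
  make the orbit sum lose. The divisor \<open>105/100\<close> weakens the negative quadratic term
  and leaves a gain of first order in the excess of the weights.\<close>

lemma tangent_bound_fB_first_shell:
  fixes s w :: real
  assumes s: "3627/1000 \<le> s" "s \<le> 381/100" and w: "28/10 \<le> s * w" "s * w \<le> 493/100"
  shows "exp (- s) * (fB s - gB s * (s * (w - 1)) + gB s / (105/100 * s) * (s * (w - 1))\<^sup>2) \<le> fB (s * w) * exp (- (s * w))"
proof -
  define z where "z = s * (w - 1)"
  have wz: "s * w = s + z" by (simp add: z_def right_diff_distrib)
  let ?c = "gB s / (105/100 * s)"
  have "0 \<le> fB (s + z) * exp (- z) - fB s - (- gB s * z + ?c * z\<^sup>2)"
  proof (rule nonneg_of_second_deriv[where a="28/10 - s" and b="493/100 - s" and c=0 and z=z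
        and f="\<lambda>z. fB (s + z) * exp (- z) - fB s - (- gB s * z + ?c * z\<^sup>2)"
        and f'="\<lambda>z. - gB (s + z) * exp (- z) - (- gB s + 2 * ?c * z)"
        and f''="\<lambda>z. hB (s + z) * exp (- z) - 2 * ?c"])
    fix z :: real assume z: "z \<in> {28/10 - s..493/100 - s}"
    have 1: "((\<lambda>z. - gB s * z + ?c * z\<^sup>2) has_real_derivative (- gB s + 2 * ?c * z)) (at z)"
      using s by (auto intro!: derivative_eq_intros)
    show "((\<lambda>z. fB (s + z) * exp (- z) - fB s - (- gB s * z + ?c * z\<^sup>2)) has_real_derivative - gB (s + z) * exp (- z) - (- gB s + 2 * ?c * z)) (at z)"
      using DERIV_diff[OF DERIV_diff[OF fB_deriv DERIV_const] 1] by simp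
    have 2: "((\<lambda>z. - gB s + 2 * ?c * z) has_real_derivative 2 * ?c) (at z)"
      using s by (auto intro!: derivative_eq_intros)
    show "((\<lambda>z. - gB (s + z) * exp (- z) - (- gB s + 2 * ?c * z)) has_real_derivative hB (s + z) * exp (- z) - 2 * ?c) (at z)"
      using DERIV_diff[OF gB_deriv 2] by simp
    show "0 \<le> hB (s + z) * exp (- z) - 2 * ?c"
      using hB_first[OF s, of "s + z"] z by simp
  qed (use s w in \<open>auto simp: wz\<close>)
  then have "exp (- s) * (fB s + (- gB s * z + ?c * z\<^sup>2)) \<le> exp (- s) * (fB (s + z) * exp (- z))"
    by (intro mult_left_mono) auto
  also have "exp (- s) * (fB (s + z) * exp (- z)) = fB (s * w) * exp (- (s * w))"
  proof -
    have "exp (- (s + z)) = exp (- s) * exp (- z)" by (simp add: exp_add[symmetric])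
    then show ?thesis unfolding wz by simp
  qed
  finally have "exp (- s) * (fB s + (- gB s * z + ?c * z\<^sup>2)) \<le> fB (s * w) * exp (- (s * w))" .
  moreover have "fB s - gB s * z + ?c * z\<^sup>2 = fB s + (- gB s * z + ?c * z\<^sup>2)" by simp
  ultimately show ?thesis unfolding z_def[symmetric] by (simp only:)
qed

section \<open>The six shortest vectors on the line of real part one half\<close>

lemma first_shell_rational_pos:
  fixes h :: real
  assumes h: "1 \<le> h" "h \<le> 7/4"
  shows "0 < 3/4 * (19/5) * (1 + 1 / h\<^sup>2) - (19/5) / (h * (19/5 - 3/2 * h)) - 6 * h / (3 * h\<^sup>2 - 1)
    - (19/5) * (3 * h\<^sup>2 - 1) / (h * ((19/5) * (3 * h\<^sup>2 + 1) - 6 * h))"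
proof -
  define v where "v = h - 1"
  have v: "0 \<le> v" "v \<le> 3/4" "h = 1 + v" using h by (auto simp: v_def)
  define d1 where "d1 = 19/5 - 3/2 * h"
  define d2 where "d2 = 3 * h\<^sup>2 - 1"
  define d3 where "d3 = (19/5) * (3 * h\<^sup>2 + 1) - 6 * h"
  have h2: "h \<le> h\<^sup>2" "1 \<le> h\<^sup>2" using h mult_mono[of 1 h 1 h] mult_left_mono[of 1 h h] by (auto simp: power2_eq_square)
  have d: "0 < d1" "0 < d2" "0 < d3" "0 < h" using h h2 by (auto simp: d1_def d2_def d3_def)
  have pw: "v^2 \<le> 3/4 * v" "v^3 \<le> 3/4 * v^2" "v^4 \<le> 3/4 * v^3" "v^5 \<le> 3/4 * v^4"
     "v^6 \<le> 3/4 * v^5" "v^7 \<le> 3/4 * v^6"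
    using v mult_right_mono[of v "3/4" v] mult_right_mono[of v "3/4" "v^2"] mult_right_mono[of v "3/4" "v^3"]
      mult_right_mono[of v "3/4" "v^4"] mult_right_mono[of v "3/4" "v^5"] mult_right_mono[of v "3/4" "v^6"]
    by (auto simp: eval_nat_numeral)
  have nn: "0 \<le> v^2" "0 \<le> v^3" "0 \<le> v^4" "0 \<le> v^5" "0 \<le> v^6" "0 \<le> v^7" using v by auto
  have "0 < (1173/125) + (11109/125) * v + (33663/250) * v^2 + (37881/250) * v^3 + (-23337/500) * v^4 + (-188937/500) * v^5 + (-422199/1000) * v^6 + (-29241/200) * v^7"
    using pw nn v(1,2) by linarith
  also have "\<dots> = 3/4 * (19/5) * (1 + h\<^sup>2) * (d1 * d2 * d3) - (19/5) * h * (d2 * d3) - 6 * h^3 * (d1 * d3) - (19/5) * h * d2 * (d1 * d2)"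
    unfolding d1_def d2_def d3_def v(3) by (simp add: field_simps eval_nat_numeral)
  finally have "0 < (3/4 * (19/5) * (1 + h\<^sup>2) * (d1 * d2 * d3) - (19/5) * h * (d2 * d3) - 6 * h^3 * (d1 * d3) - (19/5) * h * d2 * (d1 * d2)) / (h\<^sup>2 * (d1 * d2 * d3))"
    using d by simp
  also have "\<dots> = 3/4 * (19/5) * (1 + 1 / h\<^sup>2) - (19/5) / (h * d1) - 6 * h / d2 - (19/5) * d2 / (h * d3)"
    using d by (simp add: field_simps eval_nat_numeral)
  finally show ?thesis by (simp add: d1_def d2_def d3_def)
qed

lemma cross_frac_le:
  fixes q c :: real
  shows "0 < q \<Longrightarrow> 0 < c \<Longrightarrow> s * c \<le> d * q \<Longrightarrow> s / q \<le> d / c"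
  by (simp add: field_simps)

text \<open>\<open>R\<close> is the logarithm of the ratio of the two sides; it vanishes at
  \<open>h = 1\<close> and has positive derivative. The inequality expresses that the orbit sum over
  the shortest vectors increases with \<open>h\<close>.\<close>

lemma first_shell_ratio:
  fixes s h :: real
  assumes s: "19/5 \<le> s" and h: "1 < h" "h \<le> 7/4"
  shows "(3 * h\<^sup>2 - 1) / 2 * ((s * (3/4 * h + 1 / (4 * h)) - 3/2) * exp (- (s * (3/4 * h + 1 / (4 * h)))))
    < (s / h - 3/2) * exp (- (s / h))"
proof -
  define R where "R h = 3/4 * s * (h - 1 / h) + ln (s / h - 3/2) - ln ((3 * h\<^sup>2 - 1) / 2) - ln (s * (3/4 * h + 1 / (4 * h)) - 3/2)" for h
  have pos: "0 < s / k - 3/2" "0 < 3 * k\<^sup>2 - 1" "0 < s * (3/4 * k + 1 / (4 * k)) - 3/2" "0 < k"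
    if k: "1 \<le> k" "k \<le> 7/4" for k
  proof -
    show "0 < k" using k by simp
    have "3/2 * k < s" using k s by linarith
    then show "0 < s / k - 3/2" using k by (simp add: field_simps)
    have k2: "1 \<le> k\<^sup>2" using k by (simp add: one_le_power)
    then show "0 < 3 * k\<^sup>2 - 1" by simp
    have "3/4 \<le> 3/4 * k + 1 / (4 * k)" using k by (simp add: add_increasing2)
    then have "s * (3/4) \<le> s * (3/4 * k + 1 / (4 * k))" using s by (intro mult_left_mono) auto
    then show "0 < s * (3/4 * k + 1 / (4 * k)) - 3/2" using s by linarith
  qed
  have "R 1 < R h"
  proof (rule DERIV_pos_imp_increasing[OF h(1)])
    fix k assume "1 \<le> k" "k \<le> h"
    then have k: "1 \<le> k" "k \<le> 7/4" using h by auto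
    note P = pos[OF k]
    let ?D = "3/4 * s * (1 + 1 / k\<^sup>2) - s / (k * (s - 3/2 * k)) - 6 * k / (3 * k\<^sup>2 - 1) - s * (3 * k\<^sup>2 - 1) / (k * (s * (3 * k\<^sup>2 + 1) - 6 * k))"
    have q1: "0 < s - 3/2 * k" using k s by linarith
    have q2: "0 < s * (3 * k\<^sup>2 + 1) - 6 * k"
    proof -
      have "s * (3/4 * k + 1 / (4 * k)) - 3/2 = (s * (3 * k\<^sup>2 + 1) - 6 * k) / (4 * k)"
        using P(4) by (simp add: field_simps power2_eq_square)
      then show ?thesis using P(3,4) by (simp add: zero_less_divide_iff)
    qed
    have c1: "0 < 19/5 - 3/2 * k" using k by linarith
    have c2: "0 < 19/5 * (3 * k\<^sup>2 + 1) - 6 * k"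
    proof -
      have "k \<le> k\<^sup>2" using k mult_left_mono[of 1 k k] by (simp add: power2_eq_square)
      then show ?thesis using k by simp
    qed
    have "(R has_real_derivative ?D) (at k)"
      unfolding R_def
    proof (rule DERIV_cong)
      have d0: "((\<lambda>h. 3/4 * s * (h - 1 / h)) has_real_derivative 3/4 * s * (1 + 1 / k\<^sup>2)) (at k)"
        using P(4) by (auto intro!: derivative_eq_intros simp: power2_eq_square)
      have d1: "((\<lambda>h. s / h - 3/2) has_real_derivative - s / k\<^sup>2) (at k)"
        using P(4) by (auto intro!: derivative_eq_intros simp: power2_eq_square)
      have d2: "((\<lambda>h. (3 * h\<^sup>2 - 1) / 2) has_real_derivative 6 * k / 2) (at k)"
        by (auto intro!: derivative_eq_intros)
      have d3: "((\<lambda>h. s * (3/4 * h + 1 / (4 * h)) - 3/2) has_real_derivative s * (3/4 - 1 / (4 * k\<^sup>2))) (at k)"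
        using P(4) by (auto intro!: derivative_eq_intros simp: power2_eq_square)
      have P2: "0 < (3 * k\<^sup>2 - 1) / 2" using P(2) by simp
      show "((\<lambda>h. 3/4 * s * (h - 1 / h) + ln (s / h - 3/2) - ln ((3 * h\<^sup>2 - 1) / 2) - ln (s * (3/4 * h + 1 / (4 * h)) - 3/2))
        has_real_derivative (3/4 * s * (1 + 1 / k\<^sup>2) + 1 / (s / k - 3/2) * (- s / k\<^sup>2) - 1 / ((3 * k\<^sup>2 - 1) / 2) * (6 * k / 2)
          - 1 / (s * (3/4 * k + 1 / (4 * k)) - 3/2) * (s * (3/4 - 1 / (4 * k\<^sup>2))))) (at k)"
        by (intro DERIV_add DERIV_diff d0 DERIV_chain2[OF DERIV_ln_divide[OF P(1)] d1]
            DERIV_chain2[OF DERIV_ln_divide[OF P2] d2] DERIV_chain2[OF DERIV_ln_divide[OF P(3)] d3])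
      have a: "s / k - 3/2 = (s - 3/2 * k) / k" using P(4) by (simp add: field_simps)
      have b: "s * (3/4 * k + 1 / (4 * k)) - 3/2 = (s * (3 * k\<^sup>2 + 1) - 6 * k) / (4 * k)"
        using P(4) by (simp add: field_simps power2_eq_square)
      have "1 / (s / k - 3/2) * (- s / k\<^sup>2) = - (s / (k * (s - 3/2 * k)))"
        unfolding a using P(4) q1 by (simp add: power2_eq_square)
      moreover have "1 / ((3 * k\<^sup>2 - 1) / 2) * (6 * k / 2) = 6 * k / (3 * k\<^sup>2 - 1)" by simp
      moreover have "1 / (s * (3/4 * k + 1 / (4 * k)) - 3/2) * (s * (3/4 - 1 / (4 * k\<^sup>2))) = s * (3 * k\<^sup>2 - 1) / (k * (s * (3 * k\<^sup>2 + 1) - 6 * k))"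
      proof -
        have "s * (3/4 - 1 / (4 * k\<^sup>2)) = s * (3 * k\<^sup>2 - 1) / (4 * k\<^sup>2)" using P(4) by (simp add: field_simps)
        then show ?thesis unfolding b using P(4) q2 by (simp add: power2_eq_square)
      qed
      ultimately show "3/4 * s * (1 + 1 / k\<^sup>2) + 1 / (s / k - 3/2) * (- s / k\<^sup>2) - 1 / ((3 * k\<^sup>2 - 1) / 2) * (6 * k / 2)
          - 1 / (s * (3/4 * k + 1 / (4 * k)) - 3/2) * (s * (3/4 - 1 / (4 * k\<^sup>2))) = ?D" by linarith
    qed
    moreover have "0 < ?D"
    proof -
      \<comment> \<open>Each term of \<open>?D\<close> that involves \<open>s\<close> is monotone in
        \<open>s\<close> in the favourable direction, so \<open>s = 19/5\<close> is the worst
        case.\<close>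
      have 1: "3/4 * (19/5) * (1 + 1 / k\<^sup>2) \<le> 3/4 * s * (1 + 1 / k\<^sup>2)"
        using s by (intro mult_right_mono) auto
      have 2: "s / (k * (s - 3/2 * k)) \<le> (19/5) / (k * (19/5 - 3/2 * k))"
      proof -
        have "s * (19/5 - 3/2 * k) \<le> (19/5) * (s - 3/2 * k)" using s P(4) by (simp add: algebra_simps)
        then have "s / (s - 3/2 * k) \<le> (19/5) / (19/5 - 3/2 * k)" by (rule cross_frac_le[OF q1 c1])
        then have "s / (s - 3/2 * k) / k \<le> (19/5) / (19/5 - 3/2 * k) / k" using P(4) by (intro divide_right_mono) auto
        moreover have "a / b / k = a / (k * b)" for a b :: real by (simp add: mult.commute)
        ultimately show ?thesis by metis
      qed
      have 3: "s * (3 * k\<^sup>2 - 1) / (k * (s * (3 * k\<^sup>2 + 1) - 6 * k)) \<le> (19/5) * (3 * k\<^sup>2 - 1) / (k * ((19/5) * (3 * k\<^sup>2 + 1) - 6 * k))"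
      proof -
        have "s * ((19/5) * (3 * k\<^sup>2 + 1) - 6 * k) \<le> (19/5) * (s * (3 * k\<^sup>2 + 1) - 6 * k)"
        proof -
          have "s * (19/5 * W - q) \<le> 19/5 * (s * W - q)" if "19/5 * q \<le> s * q" for W q :: real
            using that by (simp add: algebra_simps)
          moreover have "19/5 * (6 * k) \<le> s * (6 * k)" using s P(4) by (intro mult_right_mono) auto
          ultimately show ?thesis by blast
        qed
        then have "s / (s * (3 * k\<^sup>2 + 1) - 6 * k) \<le> (19/5) / ((19/5) * (3 * k\<^sup>2 + 1) - 6 * k)"
          by (rule cross_frac_le[OF q2 c2])
        then have "s / (s * (3 * k\<^sup>2 + 1) - 6 * k) * ((3 * k\<^sup>2 - 1) / k) \<le> (19/5) / ((19/5) * (3 * k\<^sup>2 + 1) - 6 * k) * ((3 * k\<^sup>2 - 1) / k)"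
          using P(2,4) by (intro mult_right_mono) auto
        moreover have "a / b * (c / k) = a * c / (k * b)" for a b c :: real by (simp add: mult.commute)
        ultimately show ?thesis by metis
      qed
      show ?thesis using first_shell_rational_pos[OF k] 1 2 3 by linarith
    qed
    ultimately show "\<exists>y. (R has_real_derivative y) (at k) \<and> 0 < y" by blast
  qed
  moreover have "R 1 = 0" by (simp add: R_def)
  ultimately have Rh: "0 < R h" by simp
  note P = pos[of h, OF less_imp_le[OF h(1)] h(2)]
  let ?S = "s * (3/4 * h + 1 / (4 * h))"
  have S: "?S - s / h = 3/4 * s * (h - 1 / h)" using P(4) by (simp add: field_simps)
  have "ln ((3 * h\<^sup>2 - 1) / 2) + ln (?S - 3/2) < (?S - s / h) + ln (s / h - 3/2)"
    using Rh unfolding R_def S by linarith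
  then have "exp (ln ((3 * h\<^sup>2 - 1) / 2) + ln (?S - 3/2)) < exp ((?S - s / h) + ln (s / h - 3/2))" by simp
  then have "(3 * h\<^sup>2 - 1) / 2 * (?S - 3/2) < exp (?S - s / h) * (s / h - 3/2)"
    using P by (simp add: exp_add)
  then have "(3 * h\<^sup>2 - 1) / 2 * (?S - 3/2) * exp (- ?S) < exp (?S - s / h) * (s / h - 3/2) * exp (- ?S)"
    by (intro mult_strict_right_mono) auto
  also have "exp (?S - s / h) * (s / h - 3/2) * exp (- ?S) = (s / h - 3/2) * (exp (?S - s / h) * exp (- ?S))"
    by (simp add: mult_ac)
  also have "exp (?S - s / h) * exp (- ?S) = exp (- (s / h))" by (simp add: exp_add[symmetric])
  finally show ?thesis by (simp add: mult.assoc)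
qed

text \<open>\<open>s / h\<close> and \<open>s * (3/4 * h + 1 / (4 * h))\<close> are the scaled norms
  of one vector and of two further vectors of an orbit of shortest vectors on the line; at
  \<open>h = 1\<close> both are \<open>s\<close> and the two sides agree.\<close>

lemma first_shell_p1_less:
  fixes s h :: real
  assumes s: "19/5 \<le> s" and h: "1 < h" "h \<le> 7/4"
  shows "3 * (p1 s * exp (- s)) < p1 (s / h) * exp (- (s / h)) + 2 * (p1 (s * (3/4 * h + 1 / (4 * h))) * exp (- (s * (3/4 * h + 1 / (4 * h)))))"
proof -
  define g where "g h = p1 (s / h) * exp (- (s / h)) + 2 * (p1 (s * (3/4 * h + 1 / (4 * h))) * exp (- (s * (3/4 * h + 1 / (4 * h)))))" for h
  have dM: "((\<lambda>x. p1 x * exp (- x)) has_real_derivative - ((x - 3/2) * exp (- x))) (at x)" for x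
    unfolding p1_def by (auto intro!: derivative_eq_intros simp: algebra_simps)
  have dg: "(g has_real_derivative (s / k\<^sup>2) * ((s / k - 3/2) * exp (- (s / k)))
      - 2 * (s * (3/4 - 1 / (4 * k\<^sup>2))) * ((s * (3/4 * k + 1 / (4 * k)) - 3/2) * exp (- (s * (3/4 * k + 1 / (4 * k)))))) (at k)"
    if k: "0 < k" for k
  proof -
    have d1: "((\<lambda>k. s / k) has_real_derivative - (s / k\<^sup>2)) (at k)"
      using k by (auto intro!: derivative_eq_intros simp: power2_eq_square)
    have d2: "((\<lambda>k. s * (3/4 * k + 1 / (4 * k))) has_real_derivative s * (3/4 - 1 / (4 * k\<^sup>2))) (at k)"
      using k by (auto intro!: derivative_eq_intros simp: power2_eq_square)
    from DERIV_add[OF DERIV_chain2[OF dM d1] DERIV_cmult[OF DERIV_chain2[OF dM d2], of 2]]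
    show ?thesis unfolding g_def by (simp add: algebra_simps)
  qed
  have "g 1 < g h"
  proof (rule DERIV_pos_imp_increasing_open[OF h(1)])
    fix k assume k: "1 < k" "k < h"
    then have k': "0 < k" "k \<le> 7/4" using h by auto
    let ?X = "(s * (3/4 * k + 1 / (4 * k)) - 3/2) * exp (- (s * (3/4 * k + 1 / (4 * k))))"
    have "0 < (s / k\<^sup>2) * ((s / k - 3/2) * exp (- (s / k)) - (3 * k\<^sup>2 - 1) / 2 * ?X)"
      using first_shell_ratio[OF s k(1) k'(2)] s k' by (intro mult_pos_pos) auto
    also have "\<dots> = (s / k\<^sup>2) * ((s / k - 3/2) * exp (- (s / k))) - 2 * (s * (3/4 - 1 / (4 * k\<^sup>2))) * ?X"
    proof -
      have "(s / k\<^sup>2) * ((3 * k\<^sup>2 - 1) / 2) = 2 * (s * (3/4 - 1 / (4 * k\<^sup>2)))"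
        using k' by (simp add: field_simps)
      then have "(s / k\<^sup>2) * ((3 * k\<^sup>2 - 1) / 2 * ?X) = 2 * (s * (3/4 - 1 / (4 * k\<^sup>2))) * ?X"
        by (simp only: mult.assoc[symmetric])
      then show ?thesis by (simp only: right_diff_distrib)
    qed
    finally show "\<exists>y. (g has_real_derivative y) (at k) \<and> 0 < y" using dg[OF k'(1)] by blast
  next
    show "continuous_on {1..h} g"
      by (rule DERIV_continuous_on[OF has_field_derivative_at_within[OF dg]]) auto
  qed
  moreover have "g 1 = 3 * (p1 s * exp (- s))" by (simp add: g_def)
  ultimately show ?thesis by (simp add: g_def)
qed

section \<open>Orbits of the rotation of order three\<close>

definition rho_im :: real where "rho_im = sqrt 3 / 2"

lemma rho_im: "0 < rho_im" "rho_im\<^sup>2 = 3/4" "866/1000 < rho_im" "rho_im < 8661/10000"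
proof -
  show "0 < rho_im" "rho_im\<^sup>2 = 3/4" by (auto simp: rho_im_def power_divide)
  have "sqrt 3 > 1732/1000" by (rule real_less_rsqrt) (simp add: power2_eq_square)
  then show "866/1000 < rho_im" by (simp add: rho_im_def)
  have "sqrt 3 < 17322/10000" by (rule real_less_lsqrt) (auto simp: power2_eq_square)
  then show "rho_im < 8661/10000" by (simp add: rho_im_def)
qed

text \<open>On the coordinates of \<open>m * rho + n\<close> this is multiplication by
  \<open>rho\<^sup>2\<close>, a rotation of order three. For other \<open>z\<close> the same integer
  matrix is used, no longer an isometry.\<close>

definition rot :: "int \<times> int \<Rightarrow> int \<times> int" where "rot v = (snd v, - fst v - snd v)"

lemma rot_rot_rot: "rot (rot (rot v)) = v" by (simp add: rot_def)

text \<open>The norm form of the Eisenstein integers \<open>m * rho + n\<close>.\<close>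

definition eis_norm :: "int \<times> int \<Rightarrow> int" where "eis_norm v = (fst v)\<^sup>2 + fst v * snd v + (snd v)\<^sup>2"

lemma qform_rho: "qform (1/2) rho_im v = pi / rho_im * of_int (eis_norm v)"
  using rho_im by (simp add: qform_def eis_norm_def power_mult_distrib power2_eq_square field_simps)

lemma eis_norm_pos: "v \<noteq> (0, 0) \<Longrightarrow> 1 \<le> eis_norm v"
proof -
  assume "v \<noteq> (0, 0)"
  moreover have "4 * eis_norm v = (2 * fst v + snd v)\<^sup>2 + 3 * (snd v)\<^sup>2"
    by (simp add: eis_norm_def power2_eq_square algebra_simps)
  ultimately have "0 < 4 * eis_norm v"
    by (cases v; cases "snd v = 0") (auto intro: add_nonneg_pos)
  then show ?thesis by simp
qed

text \<open>The norm never takes the value \<open>2\<close>: writing \<open>4 * eis_norm v\<close>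
  in two ways as a square plus three times a square bounds both coordinates by one if the norm is at
  most two.\<close>

lemma eis_norm_cases:
  assumes "v \<noteq> (0, 0)"
  shows "v \<in> {(1, 0), (- 1, 0), (0, 1), (0, - 1), (1, - 1), (- 1, 1)} \<or> 3 \<le> eis_norm v"
proof (rule ccontr)
  assume A: "\<not> ?thesis"
  obtain m n where v: "v = (m, n)" by (cases v)
  have N: "eis_norm v \<le> 2" using A by simp
  have e1: "4 * eis_norm v = (2 * m + n)\<^sup>2 + 3 * n\<^sup>2" "4 * eis_norm v = (2 * n + m)\<^sup>2 + 3 * m\<^sup>2"
    by (simp_all add: eis_norm_def v power2_eq_square algebra_simps)
  have "3 * n\<^sup>2 \<le> 8" using N e1(1) zero_le_power2[of "2 * m + n"] by linarith
  moreover have "3 * m\<^sup>2 \<le> 8" using N e1(2) zero_le_power2[of "2 * n + m"] by linarith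
  ultimately have "n\<^sup>2 < 4" "m\<^sup>2 < 4" by linarith+
  then have "\<bar>n\<bar>\<^sup>2 < 2\<^sup>2" "\<bar>m\<bar>\<^sup>2 < 2\<^sup>2" by auto
  then have "\<bar>n\<bar> < 2" "\<bar>m\<bar> < 2"
    using power2_less_imp_less[of "\<bar>n\<bar>" 2] power2_less_imp_less[of "\<bar>m\<bar>" 2] by auto
  then have "m \<in> {-1, 0, 1}" "n \<in> {-1, 0, 1}" by auto
  then show False using A assms v by (auto simp: eis_norm_def)
qed

lemma qform_rot_sum:
  assumes y: "0 < y"
  shows "qform x y v + qform x y (rot v) + qform x y (rot (rot v)) = 2 * pi * of_int (eis_norm v) * (x\<^sup>2 + y\<^sup>2 + 1 - x) / y"
  using y by (simp add: qform_def rot_def eis_norm_def power2_eq_square add_divide_distrib[symmetric] right_diff_distrib[symmetric])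
    (simp add: field_simps)

text \<open>Heron's formula for the triangle with sides \<open>v\<close>, \<open>rot v\<close>,
  \<open>rot (rot v)\<close>, whose squared lengths are \<open>A\<close>, \<open>B\<close>,
  \<open>C\<close>: its area is \<open>N * y / 2\<close>, since \<open>v\<close> and
  \<open>rot v\<close> have determinant \<open>- N\<close>.\<close>

lemma qform_rot_sq:
  assumes y: "0 < y"
  shows "(qform x y v)\<^sup>2 + (qform x y (rot v))\<^sup>2 + (qform x y (rot (rot v)))\<^sup>2
    = (qform x y v + qform x y (rot v) + qform x y (rot (rot v)))\<^sup>2 / 2 - 2 * (pi * of_int (eis_norm v))\<^sup>2"
proof -
  obtain m n where v: "v = (m, n)" by (cases v)
  let ?m = "real_of_int m" and ?n = "real_of_int n"
  define A where "A = (?m * x + ?n)\<^sup>2 + (?m * y)\<^sup>2"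
  define B where "B = (?n * x + (- ?m - ?n))\<^sup>2 + (?n * y)\<^sup>2"
  define C where "C = ((- ?m - ?n) * x + ?m)\<^sup>2 + ((- ?m - ?n) * y)\<^sup>2"
  define N where "N = ?m\<^sup>2 + ?m * ?n + ?n\<^sup>2"
  have l: "qform x y v = pi / y * A" "qform x y (rot v) = pi / y * B" "qform x y (rot (rot v)) = pi / y * C"
    by (simp_all add: qform_def rot_def v A_def B_def C_def)
  have N: "of_int (eis_norm v) = N" by (simp add: eis_norm_def v N_def)
  have "2 * (A\<^sup>2 + B\<^sup>2 + C\<^sup>2) = (A + B + C)\<^sup>2 - 4 * N\<^sup>2 * y\<^sup>2"
    unfolding A_def B_def C_def N_def by algebra
  then have "(pi / y)\<^sup>2 * (2 * (A\<^sup>2 + B\<^sup>2 + C\<^sup>2)) = (pi / y)\<^sup>2 * ((A + B + C)\<^sup>2 - 4 * N\<^sup>2 * y\<^sup>2)" by simp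
  then have "(pi / y)\<^sup>2 * A\<^sup>2 + (pi / y)\<^sup>2 * B\<^sup>2 + (pi / y)\<^sup>2 * C\<^sup>2
      = (pi / y)\<^sup>2 * (A + B + C)\<^sup>2 / 2 - (pi / y)\<^sup>2 * (4 * N\<^sup>2 * y\<^sup>2) / 2"
  proof -
    have "P * a + P * b + P * c = P * S / 2 - P * q / 2" if "P * (2 * (a + b + c)) = P * (S - q)" for P a b c S q :: real
      using that by (simp add: algebra_simps)
    then show ?thesis using \<open>(pi / y)\<^sup>2 * (2 * (A\<^sup>2 + B\<^sup>2 + C\<^sup>2)) = _\<close> by blast
  qed
  moreover have "(pi / y)\<^sup>2 * (4 * N\<^sup>2 * y\<^sup>2) / 2 = 2 * (pi * N)\<^sup>2"
    using y by (simp add: power_divide power_mult_distrib)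
  moreover have "pi / y * A + pi / y * B + pi / y * C = pi / y * (A + B + C)" by (simp add: distrib_left)
  ultimately show ?thesis unfolding l N by (simp only: power_mult_distrib)
qed

lemma has_sum_rot:
  fixes f :: "int \<times> int \<Rightarrow> real"
  assumes "(f has_sum S) UNIV"
  shows "((\<lambda>v. (f v + f (rot v) + f (rot (rot v))) / 3) has_sum S) UNIV"
proof -
  have b: "bij_betw rot UNIV UNIV"
    by (rule bij_betw_byWitness[of _ "\<lambda>v. rot (rot v)"]) (auto simp: rot_rot_rot)
  have 1: "((\<lambda>v. f (rot v)) has_sum S) UNIV"
    using assms has_sum_reindex_bij_betw[OF b, of f S] by simp
  have 2: "((\<lambda>v. f (rot (rot v))) has_sum S) UNIV"
    using 1 has_sum_reindex_bij_betw[OF b, of "\<lambda>v. f (rot v)" S] by simp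
  have "((\<lambda>v. (f v + f (rot v) + f (rot (rot v))) * (1 / 3)) has_sum ((S + S + S) * (1 / 3))) UNIV"
    by (intro has_sum_cmult_left has_sum_add assms 1 2)
  then show ?thesis by simp
qed

text \<open>\<open>rot\<close> permutes the lattice and fixes zero, so \<open>F\<close> may be
  replaced by its average over orbits; a single strict orbit makes the comparison strict.\<close>

lemma orbit_sum_less:
  fixes F G :: "int \<times> int \<Rightarrow> real"
  assumes F: "(F has_sum S) UNIV" and G: "(G has_sum T) UNIV"
    and zero: "F (0, 0) = G (0, 0)"
    and le: "\<And>v. v \<noteq> (0, 0) \<Longrightarrow> 3 * G v \<le> F v + F (rot v) + F (rot (rot v))"
    and less: "v0 \<noteq> (0, 0)" "3 * G v0 < F v0 + F (rot v0) + F (rot (rot v0))"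
  shows "T < S"
proof (rule has_sum_strict_mono[OF G has_sum_rot[OF F]])
  show "G v \<le> (F v + F (rot v) + F (rot (rot v))) / 3" for v
    using le[of v] zero by (cases "v = (0, 0)") (auto simp: rot_def)
  show "G v0 < (F v0 + F (rot v0) + F (rot (rot v0))) / 3" using less by simp
qed auto

text \<open>The weights are the norms on an orbit relative to the common norm at rho. Their mean
  \<open>k\<close> is \<open>cosh d\<close> for the hyperbolic distance \<open>d\<close> from
  \<open>x + \<i> * y\<close> to rho; the relation for the squares is Heron's formula after division
  by that norm.\<close>

lemma orbit_weights:
  fixes x y t :: real
  assumes y: "0 < y" and v: "v \<noteq> (0, 0)" and k: "k = (x\<^sup>2 + y\<^sup>2 + 1 - x) / (2 * rho_im * y)"
  defines "s \<equiv> exp t * qform (1/2) rho_im v"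
  defines "w1 \<equiv> qform x y v / qform (1/2) rho_im v" and "w2 \<equiv> qform x y (rot v) / qform (1/2) rho_im v"
    and "w3 \<equiv> qform x y (rot (rot v)) / qform (1/2) rho_im v"
  shows "exp t * qform x y v = s * w1" "exp t * qform x y (rot v) = s * w2" "exp t * qform x y (rot (rot v)) = s * w3"
    and "w1 + w2 + w3 = 3 * k" "w1\<^sup>2 + w2\<^sup>2 + w3\<^sup>2 = (w1 + w2 + w3)\<^sup>2 / 2 - 3/2"
    and "0 < w1" "0 < w2" "0 < w3"
proof -
  define L where "L = qform (1/2) rho_im v"
  have N: "1 \<le> eis_norm v" using eis_norm_pos[OF v] .
  then have L0: "0 < L" using rho_im by (simp add: L_def qform_rho)
  show "exp t * qform x y v = s * w1" "exp t * qform x y (rot v) = s * w2" "exp t * qform x y (rot (rot v)) = s * w3"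
    using L0 by (simp_all add: s_def w1_def w2_def w3_def L_def[symmetric])
  have LN: "L = pi * of_int (eis_norm v) / rho_im" by (simp add: L_def qform_rho)
  have "w1 + w2 + w3 = (qform x y v + qform x y (rot v) + qform x y (rot (rot v))) / L"
    by (simp add: w1_def w2_def w3_def L_def add_divide_distrib)
  also have "\<dots> = 2 * rho_im * (x\<^sup>2 + y\<^sup>2 + 1 - x) / y"
    unfolding qform_rot_sum[OF y] LN using N rho_im y by (simp add: field_simps)
  also have "\<dots> = 3 * k"
  proof -
    have "3 = 4 * rho_im\<^sup>2" using rho_im by simp
    then have "3 * k = 4 * rho_im\<^sup>2 * k" by simp
    also have "\<dots> = 2 * rho_im * (x\<^sup>2 + y\<^sup>2 + 1 - x) / y"
      unfolding k using rho_im(1) y by (simp add: power2_eq_square)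
    finally show ?thesis ..
  qed
  finally show "w1 + w2 + w3 = 3 * k" .
  have "w1\<^sup>2 + w2\<^sup>2 + w3\<^sup>2 = ((qform x y v)\<^sup>2 + (qform x y (rot v))\<^sup>2 + (qform x y (rot (rot v)))\<^sup>2) / L\<^sup>2"
    by (simp add: w1_def w2_def w3_def L_def add_divide_distrib power_divide)
  also have "\<dots> = ((w1 + w2 + w3) * L)\<^sup>2 / 2 / L\<^sup>2 - 2 * (pi * of_int (eis_norm v))\<^sup>2 / L\<^sup>2"
    unfolding qform_rot_sq[OF y] using L0
    by (simp add: w1_def w2_def w3_def L_def[symmetric] distrib_right diff_divide_distrib)
  also have "\<dots> = (w1 + w2 + w3)\<^sup>2 / 2 - 2 * rho_im\<^sup>2"
    using L0 N rho_im by (simp add: power_mult_distrib) (simp add: LN power_divide power_mult_distrib)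
  finally show "w1\<^sup>2 + w2\<^sup>2 + w3\<^sup>2 = (w1 + w2 + w3)\<^sup>2 / 2 - 3/2" using rho_im by simp
  have pos: "0 < qform x y u" if "u \<noteq> (0, 0)" for u
  proof -
    have "0 < (of_int (fst u) * x + of_int (snd u))\<^sup>2 + (of_int (fst u) * y)\<^sup>2"
      using that y by (cases u; cases "fst u = 0") (auto intro: add_nonneg_pos)
    then show ?thesis using y by (simp add: qform_def)
  qed
  have "rot v \<noteq> (0, 0)" "rot (rot v) \<noteq> (0, 0)" using v by (auto simp: rot_def prod_eq_iff)
  then show "0 < w1" "0 < w2" "0 < w3"
    using pos[OF v] pos[of "rot v"] pos[of "rot (rot v)"] L0 by (simp_all add: w1_def w2_def w3_def L_def[symmetric])
qed

text \<open>Eliminating \<open>w2\<close> and \<open>w3\<close> by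
  \<open>(w2 + w3)\<^sup>2 \<le> 2 * (w2\<^sup>2 + w3\<^sup>2)\<close> leaves
  \<open>w1\<^sup>2 - 2 * k * w1 + 1 \<le> 0\<close>. With \<open>k = cosh d\<close> the roots are
  \<open>exp d\<close> and \<open>exp (- d)\<close>, and \<open>H\<close> is an upper bound for
  \<open>exp d\<close>.\<close>

lemma weight_bounds:
  fixes w1 w2 w3 k H :: real
  assumes sum: "w1 + w2 + w3 = 3 * k" and sq: "w1\<^sup>2 + w2\<^sup>2 + w3\<^sup>2 = (w1 + w2 + w3)\<^sup>2 / 2 - 3/2"
    and w: "0 < w1" and H: "1 \<le> H" "2 * k \<le> H + 1 / H"
  shows "1 / H \<le> w1" "w1 \<le> H"
proof -
  have w23: "w2 + w3 = 3 * k - w1" using sum by simp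
  have "0 \<le> (w2 - w3)\<^sup>2" by simp
  then have "(w2 + w3)\<^sup>2 \<le> 2 * (w2\<^sup>2 + w3\<^sup>2)" by (simp add: power2_eq_square algebra_simps)
  then have "(3 * k - w1)\<^sup>2 \<le> 2 * ((3 * k)\<^sup>2 / 2 - 3/2 - w1\<^sup>2)" using sq unfolding w23 sum by simp
  then have "w1\<^sup>2 + 1 \<le> 2 * k * w1" by (simp add: power2_eq_square algebra_simps)
  moreover have "2 * k * w1 \<le> (H + 1 / H) * w1" using H w by (intro mult_right_mono) auto
  moreover have "(w1 - H) * (w1 - r) = w1\<^sup>2 + H * r - (H + r) * w1" for r :: real
    by (simp add: power2_eq_square algebra_simps)
  note this[of "1 / H"]
  moreover have "H * (1 / H) = 1" using H by simp
  ultimately have h: "(w1 - H) * (w1 - 1 / H) \<le> 0" by linarith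
  have "1 / H \<le> 1" using H by simp
  then have "1 / H \<le> H" using H by linarith
  then show "1 / H \<le> w1" "w1 \<le> H" using h by (auto simp: mult_le_0_iff)
qed

text \<open>The corrections sum to \<open>- (w1 + w2 + w3 - 3)\<^sup>2 / 2\<close>, which is
  negative unless the weights have mean one.\<close>

lemma orbit_sum_gt:
  fixes \<phi> :: "real \<Rightarrow> real"
  assumes sq: "w1\<^sup>2 + w2\<^sup>2 + w3\<^sup>2 = (w1 + w2 + w3)\<^sup>2 / 2 - 3/2" and A: "0 < A" and ne: "w1 + w2 + w3 \<noteq> 3"
    and b: "\<And>w. w \<in> {w1, w2, w3} \<Longrightarrow> a - A * ((w - 1) - (w - 1)\<^sup>2) \<le> \<phi> w"
  shows "3 * a < \<phi> w1 + \<phi> w2 + \<phi> w3"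
proof -
  have "((w1 - 1) - (w1 - 1)\<^sup>2) + ((w2 - 1) - (w2 - 1)\<^sup>2) + ((w3 - 1) - (w3 - 1)\<^sup>2)
     = 3 * (w1 + w2 + w3) - (w1\<^sup>2 + w2\<^sup>2 + w3\<^sup>2) - 6"
    by (simp add: power2_eq_square algebra_simps)
  also have "\<dots> = - ((w1 + w2 + w3 - 3)\<^sup>2 / 2)"
    unfolding sq by (simp add: power2_eq_square field_simps)
  also have "\<dots> < 0" using ne by simp
  finally have "A * (((w1 - 1) - (w1 - 1)\<^sup>2) + ((w2 - 1) - (w2 - 1)\<^sup>2) + ((w3 - 1) - (w3 - 1)\<^sup>2)) < 0"
    using A by (rule mult_pos_neg[rotated])
  then show ?thesis using b[of w1] b[of w2] b[of w3] by (simp add: algebra_simps)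
qed

abbreviation expw :: "(real \<Rightarrow> real) \<Rightarrow> real \<Rightarrow> real" where "expw p s \<equiv> p s * exp (- s)"

text \<open>The bound on the mean puts all weights into \<open>[1000/1769, 1769/1000]\<close>,
  inside the range of the tangent inequality for \<open>p1\<close>. The condition for strictness
  says that the mean is not one, so that the point differs from rho.\<close>

lemma expw_p1_orbit:
  fixes x y t :: real
  assumes y: "0 < y" and v: "v \<noteq> (0, 0)" and s: "689/100 \<le> exp t * qform (1/2) rho_im v"
    and k: "2 * ((x\<^sup>2 + y\<^sup>2 + 1 - x) / (2 * rho_im * y)) \<le> 1769/1000 + 1000/1769"
  shows "3 * expw p1 (exp t * qform (1/2) rho_im v) \<le> expw p1 (exp t * qform x y v) + expw p1 (exp t * qform x y (rot v)) + expw p1 (exp t * qform x y (rot (rot v)))"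
    and "x\<^sup>2 + y\<^sup>2 + 1 - x \<noteq> 2 * rho_im * y \<Longrightarrow>
     3 * expw p1 (exp t * qform (1/2) rho_im v) < expw p1 (exp t * qform x y v) + expw p1 (exp t * qform x y (rot v)) + expw p1 (exp t * qform x y (rot (rot v)))"
proof -
  define s where "s = exp t * qform (1/2) rho_im v"
  define w1 where "w1 = qform x y v / qform (1/2) rho_im v"
  define w2 where "w2 = qform x y (rot v) / qform (1/2) rho_im v"
  define w3 where "w3 = qform x y (rot (rot v)) / qform (1/2) rho_im v"
  define k where "k = (x\<^sup>2 + y\<^sup>2 + 1 - x) / (2 * rho_im * y)"
  note o = orbit_weights(1-3)[OF y v k_def, of t, folded s_def w1_def w2_def w3_def]
    orbit_weights(4-8)[OF y v k_def, folded w1_def w2_def w3_def]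
  have kb: "2 * k \<le> 1769/1000 + 1 / (1769/1000)" using assms(4) by (simp add: k_def)
  have b1: "1000/1769 \<le> w1" "w1 \<le> 1769/1000" using weight_bounds[OF o(4,5,6) _ kb] by auto
  have b2: "1000/1769 \<le> w2" "w2 \<le> 1769/1000"
    using weight_bounds[of w2 w1 w3 k, OF _ _ o(7) _ kb] o(4,5) by (auto simp: algebra_simps)
  have b3: "1000/1769 \<le> w3" "w3 \<le> 1769/1000"
    using weight_bounds[of w3 w2 w1 k, OF _ _ o(8) _ kb] o(4,5) by (auto simp: algebra_simps)
  have s6: "689/100 \<le> s" using s by (simp add: s_def)
  have bd: "p1 s * exp (- s) - s * (s - 3/2) * exp (- s) * ((w - 1) - (w - 1)\<^sup>2) \<le> p1 (s * w) * exp (- (s * w))"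
    if "w \<in> {w1, w2, w3}" for w
    using tangent_bound_p1[of s "w - 1"] that b1 b2 b3 s6 by (auto simp: p1_def)
  have A: "0 < s * (s - 3/2) * exp (- s)" using s6 by simp
  show "3 * expw p1 (exp t * qform (1/2) rho_im v) \<le> expw p1 (exp t * qform x y v) + expw p1 (exp t * qform x y (rot v)) + expw p1 (exp t * qform x y (rot (rot v)))"
    unfolding o(1-3) s_def[symmetric]
    by (rule orbit_sum_ge[OF o(5) less_imp_le[OF A] bd, simplified])
  assume "x\<^sup>2 + y\<^sup>2 + 1 - x \<noteq> 2 * rho_im * y"
  then have "w1 + w2 + w3 \<noteq> 3" unfolding o(4) k_def using rho_im y by (simp add: field_simps)
  then show "3 * expw p1 (exp t * qform (1/2) rho_im v) < expw p1 (exp t * qform x y v) + expw p1 (exp t * qform x y (rot v)) + expw p1 (exp t * qform x y (rot (rot v)))"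
    unfolding o(1-3) s_def[symmetric]
    by (rule orbit_sum_gt[OF o(5) A _ bd, simplified])
qed

lemma pi_div_rho_im: "3627/1000 < pi / rho_im" "pi / rho_im < 36277/10000"
proof -
  have 1: "3627/1000 * rho_im < pi" "pi < 36277/10000 * rho_im"
  proof -
    have "3627/1000 * rho_im < 3627/1000 * (8661/10000)" using rho_im by simp
    also have "\<dots> < pi" using pi_approx by simp
    finally show "3627/1000 * rho_im < pi" .
    have "sqrt 3 > 173205/100000" by (rule real_less_rsqrt) (simp add: power2_eq_square)
    then have "36277/10000 * (173205/200000) < 36277/10000 * rho_im" by (simp add: rho_im_def)
    then show "pi < 36277/10000 * rho_im" using pi_approx by simp
  qed
  show "3627/1000 < pi / rho_im" "pi / rho_im < 36277/10000"
    using 1 rho_im(1) by (simp_all add: pos_less_divide_eq pos_divide_less_eq)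
qed

lemma latsum_orbit_less:
  fixes p :: "real \<Rightarrow> real"
  assumes y: "0 < y" and p: "\<And>s. p s = c0 + c1 * s + c2 * s\<^sup>2 + c3 * s^3"
    and le: "\<And>v. v \<noteq> (0, 0) \<Longrightarrow> 3 * expw p (exp t * qform (1/2) rho_im v) \<le> expw p (exp t * qform x y v)
        + expw p (exp t * qform x y (rot v)) + expw p (exp t * qform x y (rot (rot v)))"
    and less: "v0 \<noteq> (0, 0)" "3 * expw p (exp t * qform (1/2) rho_im v0) < expw p (exp t * qform x y v0) + expw p (exp t * qform x y (rot v0)) + expw p (exp t * qform x y (rot (rot v0)))"
  shows "latsum (1/2) rho_im p t < latsum x y p t"
  by (rule orbit_sum_less[OF latsum_cubic_eq(1)[OF y p] latsum_cubic_eq(1)[OF rho_im(1) p] _ le less])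
     (auto simp: qform_def)

theorem latsum_p1_less_orbit:
  fixes x y t :: real
  assumes y: "0 < y" and k: "2 * ((x\<^sup>2 + y\<^sup>2 + 1 - x) / (2 * rho_im * y)) \<le> 1769/1000 + 1000/1769"
    and t: "689/100 \<le> exp t * (pi / rho_im)" and ne: "x\<^sup>2 + y\<^sup>2 + 1 - x \<noteq> 2 * rho_im * y"
  shows "latsum (1/2) rho_im p1 t < latsum x y p1 t"
proof (rule latsum_orbit_less[OF y p1_cubic])
  have s: "689/100 \<le> exp t * qform (1/2) rho_im v" if "v \<noteq> (0, 0)" for v
  proof -
    have "(1::real) \<le> of_int (eis_norm v)" using eis_norm_pos[OF that] by simp
    then have "exp t * (pi / rho_im) * 1 \<le> exp t * (pi / rho_im) * of_int (eis_norm v)" using rho_im(1) by (intro mult_left_mono) auto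
    then have "689/100 \<le> exp t * (pi / rho_im) * of_int (eis_norm v)" using t by linarith
    also have "\<dots> = exp t * qform (1/2) rho_im v" by (simp add: qform_rho)
    finally show ?thesis .
  qed
  show "3 * expw p1 (exp t * qform (1/2) rho_im v) \<le> expw p1 (exp t * qform x y v) + expw p1 (exp t * qform x y (rot v)) + expw p1 (exp t * qform x y (rot (rot v)))"
    if "v \<noteq> (0, 0)" for v by (rule expw_p1_orbit(1)[OF y that s[OF that] k])
  show "(0::int, 1::int) \<noteq> (0, 0)" by simp
  then show "3 * expw p1 (exp t * qform (1/2) rho_im (0, 1)) < expw p1 (exp t * qform x y (0, 1)) + expw p1 (exp t * qform x y (rot (0, 1))) + expw p1 (exp t * qform x y (rot (rot (0, 1))))"
    using expw_p1_orbit(2)[OF y _ s k ne] by blast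
qed

section \<open>The line of real part one half\<close>

text \<open>At real part one half an orbit in the first shell consists of one vector
  \<open>(0, n)\<close> and two mirror images of each other, which have the same norm.\<close>

lemma line_first_shell:
  fixes y t :: real
  assumes y: "0 < y" and v: "v \<in> {(1, 0), (- 1, 0), (0, 1), (0, - 1), (1, - 1), (- 1, 1)}"
  defines "s \<equiv> exp t * (pi / rho_im)" and "h \<equiv> y / rho_im"
  shows "f (exp t * qform (1/2) y v) + f (exp t * qform (1/2) y (rot v)) + f (exp t * qform (1/2) y (rot (rot v)))
     = f (s / h) + 2 * (f (s * (3/4 * h + 1 / (4 * h))) :: real)"
    and "exp t * qform (1/2) rho_im v = s"
proof -
  have "eis_norm v = 1" using v by (auto simp: eis_norm_def)
  then show "exp t * qform (1/2) rho_im v = s" by (simp add: s_def qform_rho)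
  have sh: "s / h = exp t * (pi / y)" using rho_im(1) y by (simp add: s_def h_def)
  have "s * (3/4 * h + 1 / (4 * h)) = exp t * (pi * (3/4 * (1 / rho_im\<^sup>2) * y + 1 / (4 * y)))"
    using rho_im(1) y by (simp add: s_def h_def power2_eq_square field_simps)
  also have "3/4 * (1 / rho_im\<^sup>2) = 1" using rho_im(1,2) by (simp add: field_simps)
  finally have S: "s * (3/4 * h + 1 / (4 * h)) = exp t * (pi * (1 / 4 + y\<^sup>2) / y)"
    using y by (simp add: power2_eq_square field_simps)
  have l: "qform (1/2) y (0, n) = pi / y" if "n \<in> {1, -1}" for n using that by (auto simp: qform_def)
  have l2: "qform (1/2) y (m, n) = pi * (1 / 4 + y\<^sup>2) / y" if "m \<in> {1, -1}" "n = 0 \<or> n = - m" for m n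
    using that by (auto simp: qform_def power2_eq_square)
  show "f (exp t * qform (1/2) y v) + f (exp t * qform (1/2) y (rot v)) + f (exp t * qform (1/2) y (rot (rot v)))
     = f (s / h) + 2 * f (s * (3/4 * h + 1 / (4 * h)))"
    using v unfolding sh S by (auto simp: rot_def l l2)
qed

lemma far_shell:
  assumes "v \<noteq> (0, 0)" "v \<notin> {(1, 0), (- 1, 0), (0, 1), (0, - 1), (1, - 1), (- 1, 1)}"
  shows "3 * (exp t * (pi / rho_im)) \<le> exp t * qform (1/2) rho_im v"
proof -
  have "3 \<le> eis_norm v" using eis_norm_cases[OF assms(1)] assms(2) by blast
  then have "(3::real) \<le> of_int (eis_norm v)" by simp
  then have "exp t * (pi / rho_im) * 3 \<le> exp t * (pi / rho_im) * of_int (eis_norm v)" using rho_im(1) by (intro mult_left_mono) auto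
  also have "\<dots> = exp t * qform (1/2) rho_im v" by (simp add: qform_rho)
  finally show ?thesis by (simp only: mult.commute[of 3])
qed

text \<open>Along the vertical line the hyperbolic distance to rho is the modulus of
  \<open>ln (y / rho_im)\<close>.\<close>

lemma line_orbit_mean:
  assumes y: "0 < y"
  shows "2 * (((1/2)\<^sup>2 + y\<^sup>2 + 1 - 1/2) / (2 * rho_im * y)) = y / rho_im + 1 / (y / rho_im)"
proof -
  have "(1/2)\<^sup>2 + y\<^sup>2 + 1 - 1/2 = rho_im\<^sup>2 + y\<^sup>2" using rho_im(2) by (simp add: power_divide)
  then show ?thesis using y rho_im(1) by (simp add: power2_eq_square field_simps)
qed

lemma add_inverse_mono:
  fixes h H :: real
  assumes "1 \<le> h" "h \<le> H"
  shows "h + 1 / h \<le> H + 1 / H"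
proof -
  have "1 * 1 \<le> H * h" using assms by (intro mult_mono) auto
  then have "(H - h) / (H * h) \<le> (H - h) / 1" using assms by (intro divide_left_mono) auto
  moreover have "(H - h) / (H * h) = 1 / h - 1 / H" using assms by (simp add: field_simps)
  ultimately show ?thesis by simp
qed

text \<open>Only the first shell needs its own estimate: every other vector has at least three times
  the shortest norm at rho, and \<open>3 * (19/5)\<close> is beyond the threshold
  \<open>689/100\<close> of the tangent inequality.\<close>

theorem latsum_p1_less_line:
  fixes y t :: real
  assumes h: "rho_im < y" "y \<le> 3/2" and t: "19/5 \<le> exp t * (pi / rho_im)"
  shows "latsum (1/2) rho_im p1 t < latsum (1/2) y p1 t"
proof -
  have y: "0 < y" using h rho_im(1) by linarith
  have h1: "1 < y / rho_im" using h rho_im(1) by simp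
  have h2: "y / rho_im \<le> 7/4" using h rho_im by (simp add: pos_divide_le_eq)
  have k: "2 * (((1/2)\<^sup>2 + y\<^sup>2 + 1 - 1/2) / (2 * rho_im * y)) \<le> 1769/1000 + 1000/1769"
    proof -
    have "y / rho_im \<le> 1769/1000" using h2 by linarith
    with h1 have "y / rho_im + 1 / (y / rho_im) \<le> 1769/1000 + 1 / (1769/1000)" by (intro add_inverse_mono) auto
    also have "1 / (1769/1000) = (1000/1769 :: real)" by simp
    finally show ?thesis unfolding line_orbit_mean[OF y] .
  qed
  let ?F = "{(1, 0), (- 1, 0), (0, 1), (0, - 1), (1, - 1), (- 1, 1)} :: (int \<times> int) set"
  have first: "3 * expw p1 (exp t * qform (1/2) rho_im v) < expw p1 (exp t * qform (1/2) y v) + expw p1 (exp t * qform (1/2) y (rot v)) + expw p1 (exp t * qform (1/2) y (rot (rot v)))"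
    if "v \<in> ?F" for v
    using first_shell_p1_less[OF t h1 h2] line_first_shell(1)[OF y that, of "expw p1" t] line_first_shell(2)[OF y that, of t] by simp
  show ?thesis
  proof (rule latsum_orbit_less[OF y p1_cubic _ _ first])
    fix v :: "int \<times> int" assume v: "v \<noteq> (0, 0)"
    show "3 * expw p1 (exp t * qform (1/2) rho_im v) \<le> expw p1 (exp t * qform (1/2) y v) + expw p1 (exp t * qform (1/2) y (rot v)) + expw p1 (exp t * qform (1/2) y (rot (rot v)))"
    proof (cases "v \<in> ?F")
      case True then show ?thesis using first by (intro less_imp_le)
    next
      case False
      have "689/100 \<le> exp t * qform (1/2) rho_im v" using far_shell[OF v False, of t] t by linarith
      then show ?thesis using expw_p1_orbit(1)[OF y v _ k] by blast
    qed
  qed auto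
qed

text \<open>The bounds on \<open>y\<close> and \<open>exp t\<close> serve the first shell, where
  \<open>gB\<close> is negative and the excess \<open>X\<close> of the three weights over
  \<open>3\<close> has to stay below \<open>1/10\<close>. All other orbits are covered by the
  tangent inequality for \<open>fB\<close>.\<close>

theorem latsum_fB_less_line:
  fixes y t :: real
  assumes h: "rho_im < y" "y \<le> 112/100" and t: "0 \<le> t" "exp t \<le> 105/100"
  shows "latsum (1/2) rho_im fB t < latsum (1/2) y fB t"
proof -
  have y: "0 < y" using h rho_im(1) by linarith
  define s where "s = exp t * (pi / rho_im)"
  define hh where "hh = y / rho_im"
  have h1: "1 < hh" using h rho_im(1) by (simp add: hh_def)
  have h2: "hh \<le> 12935/10000"
  proof -
    have "y \<le> 12935/10000 * (866/1000)" using h by simp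
    also have "\<dots> \<le> 12935/10000 * rho_im" using rho_im by simp
    finally show ?thesis using rho_im(1) by (simp add: hh_def pos_divide_le_eq)
  qed
  have s1: "3627/1000 \<le> s"
  proof -
    have "1 * (pi / rho_im) \<le> exp t * (pi / rho_im)" using t rho_im(1) by (intro mult_right_mono) auto
    then show ?thesis using pi_div_rho_im(1) unfolding s_def by linarith
  qed
  have s2: "s \<le> 381/100"
  proof -
    have "s \<le> 105/100 * (36277/10000)" unfolding s_def using t pi_div_rho_im rho_im(1) by (intro mult_mono) auto
    then show ?thesis by simp
  qed
  let ?F = "{(1, 0), (- 1, 0), (0, 1), (0, - 1), (1, - 1), (- 1, 1)} :: (int \<times> int) set"
  have first: "3 * expw fB (exp t * qform (1/2) rho_im v) < expw fB (exp t * qform (1/2) y v) + expw fB (exp t * qform (1/2) y (rot v)) + expw fB (exp t * qform (1/2) y (rot (rot v)))"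
    if "v \<in> ?F" for v
  proof -
    define a where "a = 1 / hh"
    define b where "b = 3/4 * hh + 1 / (4 * hh)"
    have ab: "b = 3/4 * hh + 1/4 * a" "hh * a = 1" using h1 by (auto simp: a_def b_def)
    have a1: "10000/12935 \<le> a" "a < 1" using h1 h2 by (auto simp: a_def field_simps)
    have b1: "1 \<le> b" "b \<le> 117/100"
    proof -
      have "0 \<le> (hh - 1) * (3 - a)" using h1 a1 by (intro mult_nonneg_nonneg) auto
      then show "1 \<le> b" using ab by (simp add: algebra_simps)
      have "hh + 1 / hh \<le> 12935/10000 + 1 / (12935/10000)" using h1 h2 by (intro add_inverse_mono) auto
      then have "hh + a \<le> 12935/10000 + 10000/12935" by (simp add: a_def)
      then show "b \<le> 117/100" using ab h2 by linarith
    qed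
    have wa: "28/10 \<le> s * a" "s * a \<le> 493/100"
    proof -
      have "3627/1000 * (10000/12935) \<le> s * a" using s1 a1 by (intro mult_mono) auto
      then show "28/10 \<le> s * a" by simp
      have "s * a \<le> s * 1" using a1 s1 by (intro mult_left_mono) auto
      then show "s * a \<le> 493/100" using s2 by simp
    qed
    have wb: "28/10 \<le> s * b" "s * b \<le> 493/100"
    proof -
      have "s * 1 \<le> s * b" using b1 s1 by (intro mult_left_mono) auto
      then show "28/10 \<le> s * b" using s1 by linarith
      have "s * b \<le> 381/100 * (117/100)" using b1 s1 s2 by (intro mult_mono) auto
      then show "s * b \<le> 493/100" by simp
    qed
    define X where "X = (a - 1) + 2 * (b - 1)"
    have Xh: "X = 3/2 * (hh + a - 2)" by (simp add: X_def ab)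
    have X0: "0 < X"
    proof -
      have "0 < (hh - 1)\<^sup>2 * a" using h1 a1 by (intro mult_pos_pos) auto
      also have "\<dots> = hh * (hh * a) - 2 * (hh * a) + a" by (simp add: power2_eq_square algebra_simps)
      finally show ?thesis unfolding Xh ab(2) by simp
    qed
    have X1: "X < 1/10"
    proof -
      have "hh + 1 / hh \<le> 12935/10000 + 1 / (12935/10000)" using h1 h2 by (intro add_inverse_mono) auto
      then show ?thesis unfolding Xh a_def by simp
    qed
    \<comment> \<open>The relation for the squares on an orbit, in terms of the excess; it reduces
      to \<open>hh * a = 1\<close>.\<close>
    have X2: "(a - 1)\<^sup>2 + 2 * (b - 1)\<^sup>2 = X + X\<^sup>2 / 2"
    proof -
      have "(a - 1)\<^sup>2 + 2 * (b - 1)\<^sup>2 - X - X\<^sup>2 / 2 = - (3/2) * (hh * a - 1)"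
        unfolding X_def ab(1) by (simp add: power2_eq_square field_simps)
      then show ?thesis using ab(2) by simp
    qed
    have gneg: "gB s < 0"
    proof -
      have "s * s \<le> 381/100 * s" using s1 s2 by (intro mult_right_mono) auto
      moreover have "s * (s * s) \<le> 381/100 * (s * s)" using s1 s2 by (intro mult_right_mono) auto
      moreover have "gB s = s * (s * s) - 97/10 * (s * s) + 421/20 * s - 333/40" by (simp add: gB_def eval_nat_numeral)
      moreover have "3627/1000 * s \<le> s * s" using s1 by (intro mult_right_mono) auto
      ultimately show ?thesis using s1 s2 by linarith
    qed
    \<comment> \<open>With the divisor \<open>105/100\<close> the linear and quadratic terms in
      \<open>X\<close> combine to a positive multiple of \<open>X * (1/10 - X)\<close>.\<close>
    have "0 < - gB s * s * (X * (1/10 - X)) / (21/10)" using gneg s1 X0 X1 by (intro divide_pos_pos mult_pos_pos) auto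
    also have "\<dots> = - gB s * s * X + gB s / (105/100 * s) * s\<^sup>2 * (X + X\<^sup>2 / 2)"
      using s1 by (simp add: power2_eq_square field_simps)
    also have "\<dots> = - gB s * (s * (a - 1)) + gB s / (105/100 * s) * (s * (a - 1))\<^sup>2
       + 2 * (- gB s * (s * (b - 1)) + gB s / (105/100 * s) * (s * (b - 1))\<^sup>2)"
    proof -
      have "- g * s * (A + 2 * B) + q * s\<^sup>2 * (A\<^sup>2 + 2 * B\<^sup>2) = - g * (s * A) + q * (s * A)\<^sup>2 + 2 * (- g * (s * B) + q * (s * B)\<^sup>2)"
        for g q A B :: real by (simp add: power_mult_distrib algebra_simps)
      then show ?thesis unfolding X2[symmetric] unfolding X_def .
    qed
    finally have "exp (- s) * (3 * fB s) < exp (- s) * ((fB s - gB s * (s * (a - 1)) + gB s / (105/100 * s) * (s * (a - 1))\<^sup>2)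
       + 2 * (fB s - gB s * (s * (b - 1)) + gB s / (105/100 * s) * (s * (b - 1))\<^sup>2))"
      by (intro mult_strict_left_mono) auto
    also have "\<dots> = exp (- s) * (fB s - gB s * (s * (a - 1)) + gB s / (105/100 * s) * (s * (a - 1))\<^sup>2)
       + 2 * (exp (- s) * (fB s - gB s * (s * (b - 1)) + gB s / (105/100 * s) * (s * (b - 1))\<^sup>2))"
      by (simp only: distrib_left mult.left_commute)
    also have "\<dots> \<le> fB (s * a) * exp (- (s * a)) + 2 * (fB (s * b) * exp (- (s * b)))"
      using tangent_bound_fB_first_shell[OF s1 s2 wa] tangent_bound_fB_first_shell[OF s1 s2 wb] by linarith
    finally have "3 * (fB s * exp (- s)) < fB (s * a) * exp (- (s * a)) + 2 * (fB (s * b) * exp (- (s * b)))"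
      by (simp add: mult.commute mult.left_commute)
    then show ?thesis
      using line_first_shell(1)[OF y that, of "expw fB" t] line_first_shell(2)[OF y that, of t]
      unfolding s_def[symmetric] hh_def[symmetric] by (simp add: a_def b_def)
  qed
  have pc: "fB s = - (27/40) + 153/20 * s + (- 67/10) * s\<^sup>2 + 1 * s^3" for s by (simp add: fB_def)
  show ?thesis
  proof (rule latsum_orbit_less[OF y pc _ _ first])
    fix v :: "int \<times> int" assume v: "v \<noteq> (0, 0)"
    show "3 * expw fB (exp t * qform (1/2) rho_im v) \<le> expw fB (exp t * qform (1/2) y v) + expw fB (exp t * qform (1/2) y (rot v)) + expw fB (exp t * qform (1/2) y (rot (rot v)))"
    proof (cases "v \<in> ?F")
      case True then show ?thesis using first by (intro less_imp_le)
    next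
      case False
      define \<sigma> where "\<sigma> = exp t * qform (1/2) rho_im v"
      have \<sigma>: "272/25 \<le> \<sigma>" using far_shell[OF v False, of t] s1 by (simp add: \<sigma>_def s_def)
      define k where "k = ((1/2)\<^sup>2 + y\<^sup>2 + 1 - 1/2) / (2 * rho_im * y)"
      note o = orbit_weights(1-3)[OF y v k_def, of t, folded \<sigma>_def] orbit_weights(4-8)[OF y v k_def]
      let ?w1 = "qform (1/2) y v / qform (1/2) rho_im v" and ?w2 = "qform (1/2) y (rot v) / qform (1/2) rho_im v" and ?w3 = "qform (1/2) y (rot (rot v)) / qform (1/2) rho_im v"
      have kb: "2 * k \<le> hh + 1 / hh" using line_orbit_mean[OF y] by (simp add: k_def hh_def)
      have b1: "1 / hh \<le> ?w1" "?w1 \<le> hh" using weight_bounds[OF o(4,5,6) _ kb] h1 by auto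
      have b2: "1 / hh \<le> ?w2" "?w2 \<le> hh"
        using weight_bounds[of ?w2 ?w1 ?w3 k, OF _ _ o(7) _ kb] o(4,5) h1 by (auto simp: algebra_simps)
      have b3: "1 / hh \<le> ?w3" "?w3 \<le> hh"
        using weight_bounds[of ?w3 ?w2 ?w1 k, OF _ _ o(8) _ kb] o(4,5) h1 by (auto simp: algebra_simps)
      have hi: "773/1000 \<le> 1 / hh" using h1 h2 by (simp add: field_simps)
      have A: "0 \<le> \<sigma> * gB \<sigma> * exp (- \<sigma>)"
      proof -
        define p where "p = \<sigma> - 272/25"
        have p: "0 \<le> p" "\<sigma> = 272/25 + p" using \<sigma> by (auto simp: p_def)
        have "gB \<sigma> = 45047599/125000 + 412753/2500 * p + 1147/50 * p^2 + p^3"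
          unfolding gB_def p(2) by (simp add: field_simps eval_nat_numeral)
        then have "0 \<le> gB \<sigma>" using p by simp
        then show ?thesis using \<sigma> by simp
      qed
      have bd: "fB \<sigma> * exp (- \<sigma>) - \<sigma> * gB \<sigma> * exp (- \<sigma>) * ((w - 1) - (w - 1)\<^sup>2) \<le> fB (\<sigma> * w) * exp (- (\<sigma> * w))"
        if "w \<in> {?w1, ?w2, ?w3}" for w
      proof (rule tangent_bound_fB_far[OF \<sigma>])
        have "1 / hh \<le> w" "w \<le> hh" using that b1 b2 b3 by blast+
        then show "773/1000 \<le> w" "w \<le> 1294/1000" using hi h2 by linarith+
      qed
      show ?thesis
        unfolding o(1-3) \<sigma>_def[symmetric] by (rule orbit_sum_ge[where \<phi> = "\<lambda>w. expw fB (\<sigma> * w)" and a = "expw fB \<sigma>", OF o(5) A bd])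
    qed
  qed auto
qed

section \<open>Parity in \<open>t\<close> and the comparison near \<open>t = 0\<close>\<close>

lemma even_deriv_odd:
  fixes f f' :: "real \<Rightarrow> real"
  assumes "\<And>t. f (- t) = f t" and "\<And>t. (f has_real_derivative f' t) (at t)"
  shows "f' (- t) = - f' t"
proof -
  have "((\<lambda>t. f (- t)) has_real_derivative f' (- t) * - 1) (at t)"
    by (rule DERIV_chain2[OF assms(2)]) (auto intro!: derivative_eq_intros)
  then show ?thesis using DERIV_unique[OF _ assms(2)[of t]] assms(1) by (simp add: minus_equation_iff)
qed

lemma odd_deriv_even:
  fixes f f' :: "real \<Rightarrow> real"
  assumes "\<And>t. f (- t) = - f t" and "\<And>t. (f has_real_derivative f' t) (at t)"
  shows "f' (- t) = f' t"
proof -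
  have "((\<lambda>t. f (- t)) has_real_derivative f' (- t) * - 1) (at t)"
    by (rule DERIV_chain2[OF assms(2)]) (auto intro!: derivative_eq_intros)
  moreover have "((\<lambda>t. f (- t)) has_real_derivative - f' t) (at t)"
    using DERIV_minus[OF assms(2)[of t]] assms(1) by simp
  ultimately show ?thesis using DERIV_unique by fastforce
qed

text \<open>Up to sign and the factor \<open>exp (t / 2)\<close> these sums are the first and the
  third derivative of the even function \<open>ntheta\<close>.\<close>

lemma latsum_zero:
  assumes y: "0 < y"
  shows "latsum x y p1 0 = 0" "latsum x y p3 0 = 0"
proof -
  have o1: "- exp (- t / 2) * latsum x y p1 (- t) = - (- exp (t / 2) * latsum x y p1 t)" for t
    by (rule even_deriv_odd[of "ntheta x y", OF ntheta_even[OF y] ntheta_deriv(1)[OF y]])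
  from o1[of 0] show "latsum x y p1 0 = 0" by simp
  have "- exp (- t / 2) * latsum x y p2 (- t) = - exp (t / 2) * latsum x y p2 t" for t
  proof (rule odd_deriv_even[of "\<lambda>t. exp (t / 2) * latsum x y p1 t", OF _ ntheta_deriv(2)[OF y]])
    show "exp (- \<tau> / 2) * latsum x y p1 (- \<tau>) = - (exp (\<tau> / 2) * latsum x y p1 \<tau>)" for \<tau>
      using o1[of \<tau>] by linarith
  qed
  then have e2: "exp (- t / 2) * latsum x y p2 (- t) = exp (t / 2) * latsum x y p2 t" for t by simp
  have "- exp (- 0 / 2) * latsum x y p3 (- 0) = - (- exp (0 / 2) * latsum x y p3 0)"
    by (rule even_deriv_odd[of "\<lambda>t. exp (t / 2) * latsum x y p2 t" _ 0, OF _ ntheta_deriv(3)[OF y]]) (rule e2)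
  then show "latsum x y p3 0 = 0" by simp
qed

lemma latsum_fB:
  assumes "0 < y"
  shows "latsum x y fB t = latsum x y p3 t - 11/5 * latsum x y p2 t"
proof -
  have pc: "fB s = - (27/40) + 153/20 * s + (- 67/10) * s\<^sup>2 + 1 * s^3" for s by (simp add: fB_def)
  show ?thesis
    unfolding latsum_cubic_eq(2)[OF assms pc] latsum_cubic_eq(2)[OF assms p3_cubic] latsum_cubic_eq(2)[OF assms p2_cubic]
    by (simp add: algebra_simps)
qed

text \<open>The difference \<open>E\<close> of the derivatives of \<open>ntheta\<close> at the two points solves \<open>E'' + (11/5) E' < 0\<close> with
  \<open>E 0 = 0\<close> and \<open>E'' 0 = 0\<close>, all odd-order derivatives of \<open>ntheta\<close> being odd functions.\<close>

theorem latsum_p1_less_line_near_0: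
  fixes y t :: real
  assumes h: "rho_im < y" "y \<le> 112/100" and t: "0 < t" "exp t \<le> 105/100"
  shows "latsum (1/2) rho_im p1 t < latsum (1/2) y p1 t"
proof -
  have y: "0 < y" using h rho_im(1) by linarith
  define \<Delta> where "\<Delta> p \<tau> = latsum (1/2) y p \<tau> - latsum (1/2) rho_im p \<tau>" for p \<tau>
  have B: "0 < \<Delta> p3 \<tau> - 11/5 * \<Delta> p2 \<tau>" if "0 \<le> \<tau>" "\<tau> \<le> t" for \<tau>
  proof -
    have "exp \<tau> \<le> exp t" using that by simp
    then have "latsum (1/2) rho_im fB \<tau> < latsum (1/2) y fB \<tau>" using t that h by (intro latsum_fB_less_line) linarith+
    then show ?thesis unfolding latsum_fB[OF y] latsum_fB[OF rho_im(1)] \<Delta>_def by (simp add: algebra_simps)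
  qed
  \<comment> \<open>The integrating factor \<open>exp (11/5 * \<tau>)\<close> turns the differential
    inequality into monotonicity of \<open>n\<close>.\<close>
  define n where "n \<tau> = exp (11/5 * \<tau>) * (exp (\<tau>/2) * \<Delta> p2 \<tau>)" for \<tau>
  have d3: "((\<lambda>\<tau>. exp (\<tau>/2) * \<Delta> p2 \<tau>) has_real_derivative - exp (\<tau>/2) * \<Delta> p3 \<tau>) (at \<tau>)" for \<tau>
    using DERIV_diff[OF ntheta_deriv(3)[OF y, of "1/2" \<tau>] ntheta_deriv(3)[OF rho_im(1), of "1/2" \<tau>]]
    by (simp add: \<Delta>_def algebra_simps)
  have d2: "((\<lambda>\<tau>. exp (\<tau>/2) * \<Delta> p1 \<tau>) has_real_derivative - exp (\<tau>/2) * \<Delta> p2 \<tau>) (at \<tau>)" for \<tau>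
    using DERIV_diff[OF ntheta_deriv(2)[OF y, of "1/2" \<tau>] ntheta_deriv(2)[OF rho_im(1), of "1/2" \<tau>]]
    by (simp add: \<Delta>_def algebra_simps)
  have dn: "(n has_real_derivative exp (11/5 * \<tau>) * exp (\<tau>/2) * (11/5 * \<Delta> p2 \<tau> - \<Delta> p3 \<tau>)) (at \<tau>)" for \<tau>
    unfolding n_def by (rule DERIV_cong[OF DERIV_mult[OF _ d3]]) (auto intro!: derivative_eq_intros simp: algebra_simps)
  \<comment> \<open>At \<open>\<tau> = 0\<close> the \<open>p3\<close> part of \<open>B\<close>
    vanishes, which leaves the sign of the \<open>p2\<close> part.\<close>
  have n0: "\<Delta> p2 0 < 0" using B[of 0] t by (simp add: \<Delta>_def latsum_zero[OF y] latsum_zero[OF rho_im(1)])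
  have p2neg: "\<Delta> p2 \<tau> < 0" if "0 \<le> \<tau>" "\<tau> \<le> t" for \<tau>
  proof -
    have "n \<tau> \<le> n 0"
    proof (rule DERIV_nonpos_imp_nonincreasing[OF that(1)])
      fix z assume "0 \<le> z" "z \<le> \<tau>"
      then have "0 < \<Delta> p3 z - 11/5 * \<Delta> p2 z" using B that by simp
      then have "exp (11/5 * z) * exp (z/2) * (11/5 * \<Delta> p2 z - \<Delta> p3 z) \<le> 0"
        by (intro mult_nonneg_nonpos) auto
      then show "\<exists>d. (n has_real_derivative d) (at z) \<and> d \<le> 0" using dn by blast
    qed
    also have "n 0 < 0" using n0 by (simp add: n_def)
    finally show ?thesis by (simp add: n_def mult_less_0_iff)
  qed
  have "exp (0/2) * \<Delta> p1 0 < exp (t/2) * \<Delta> p1 t"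
  proof (rule DERIV_pos_imp_increasing[OF t(1)])
    fix z assume "0 \<le> z" "z \<le> t"
    then have "0 < - exp (z/2) * \<Delta> p2 z" using p2neg by (simp add: mult_pos_neg)
    then show "\<exists>d. ((\<lambda>\<tau>. exp (\<tau>/2) * \<Delta> p1 \<tau>) has_real_derivative d) (at z) \<and> 0 < d" using d2 by blast
  qed
  then show ?thesis by (simp add: \<Delta>_def latsum_zero[OF y] latsum_zero[OF rho_im(1)] zero_less_mult_iff)
qed

theorem latsum_p1_less_line_low:
  fixes y t :: real
  assumes h: "rho_im < y" "y \<le> 112/100" and t: "0 < t"
  shows "latsum (1/2) rho_im p1 t < latsum (1/2) y p1 t"
proof (cases "exp t \<le> 105/100")
  case True then show ?thesis using latsum_p1_less_line_near_0 h t by blast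
next
  case False
  have "105/100 * (3627/1000) \<le> exp t * (pi / rho_im)" using False pi_div_rho_im by (intro mult_mono) auto
  then have "19/5 \<le> exp t * (pi / rho_im)" by linarith
  then show ?thesis using h by (intro latsum_p1_less_line) auto
qed

section \<open>Comparison with the line\<close>

text \<open>Symmetrised under the exchange of the indices, so that each single term of the expansion
  is even in \<open>t\<close> and its derivative vanishes at \<open>t = 0\<close>.\<close>

definition sym_weight :: "real \<Rightarrow> int \<times> int \<Rightarrow> real \<Rightarrow> real" where
  "sym_weight y v t = fourier_weight y t v + fourier_weight y t (prod.swap v)"

definition sym_slope :: "real \<Rightarrow> int \<times> int \<Rightarrow> real \<Rightarrow> real" where
  "sym_slope y v t = pi * y * (((of_int (fst v))\<^sup>2 * exp t - (of_int (snd v))\<^sup>2 * exp (- t)) * fourier_weight y t v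
     + ((of_int (snd v))\<^sup>2 * exp t - (of_int (fst v))\<^sup>2 * exp (- t)) * fourier_weight y t (prod.swap v))"

lemma ntheta_sym_fourier:
  assumes y: "0 < y"
  shows "((\<lambda>v. cos (2 * pi * of_int (fst v) * of_int (snd v) * x) * sym_weight y v t) has_sum 2 * ntheta x y t / sqrt y) UNIV"
proof -
  let ?C = "\<lambda>v. cos (2 * pi * of_int (fst v) * of_int (snd v) * x) * fourier_weight y t v"
  have "?C summable_on UNIV"
    by (rule abs_summable_summable, rule summable_on_comparison_test[OF fourier_weight_summable[OF y, of t]])
      (auto simp: abs_mult fourier_weight_def mult_left_le_one_le)
  then have 1: "(?C has_sum ntheta x y t / sqrt y) UNIV"
    using ntheta_fourier[OF y] y by simp
  have "bij_betw (prod.swap :: int \<times> int \<Rightarrow> _) UNIV UNIV" by (rule bij_swap)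
  from has_sum_reindex_bij_betw[OF this, of ?C] 1
  have 2: "((\<lambda>v. ?C (prod.swap v)) has_sum ntheta x y t / sqrt y) UNIV" by simp
  have "((\<lambda>v. ?C v + ?C (prod.swap v)) has_sum ntheta x y t / sqrt y + ntheta x y t / sqrt y) UNIV"
    by (rule has_sum_add[OF 1 2])
  moreover have "?C v + ?C (prod.swap v) = cos (2 * pi * of_int (fst v) * of_int (snd v) * x) * sym_weight y v t" for v
    by (simp add: sym_weight_def algebra_simps)
  ultimately show ?thesis by simp
qed

lemma sym_weight_deriv: "(sym_weight y v has_real_derivative - sym_slope y v t) (at t)"
  unfolding sym_weight_def fourier_weight_def sym_slope_def
  by (auto intro!: derivative_eq_intros simp: algebra_simps)

lemma exp_diff_le:
  fixes a b M :: real
  assumes "exp a \<le> M" "exp b \<le> M"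
  shows "\<bar>exp a - exp b\<bar> \<le> \<bar>a - b\<bar> * M"
proof -
  have *: "exp a - exp b \<le> (a - b) * M" if "b \<le> a" "exp a \<le> M" for a b
  proof -
    have "1 + (b - a) \<le> exp (b - a)" by (rule exp_ge_add_one_self)
    then have "exp a * (1 + (b - a)) \<le> exp a * exp (b - a)" by (intro mult_left_mono) auto
    then have "exp a - exp b \<le> (a - b) * exp a" by (simp add: exp_diff algebra_simps)
    also have "\<dots> \<le> (a - b) * M" using that by (intro mult_left_mono) auto
    finally show ?thesis .
  qed
  show ?thesis
  proof (cases "b \<le> a")
    case True
    then have "exp b \<le> exp a" by simp
    then show ?thesis using *[OF True assms(1)] True by simp
  next
    case False
    then have "exp a \<le> exp b" by simp
    then show ?thesis using *[OF _ assms(2), of a] False by simp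
  qed
qed

text \<open>Splitting into parts symmetric and antisymmetric under the swap exhibits the factor
  \<open>exp t - exp (- t)\<close>: the first part carries it explicitly, the second through the
  difference of two exponentials. All slopes thus become comparable down to
  \<open>t = 0\<close>.\<close>

lemma sym_slope_bound_gen:
  fixes y t M :: real and m k :: int
  assumes y: "0 < y" and t: "0 \<le> t"
  defines "A \<equiv> (real_of_int m)\<^sup>2" and "B \<equiv> (real_of_int k)\<^sup>2"
  assumes M: "fourier_weight y t (m, k) \<le> M" "fourier_weight y t (k, m) \<le> M"
  shows "\<bar>sym_slope y (m, k) t\<bar> \<le> pi * y / 2 * (exp t - exp (- t)) *
    ((2 * (A + B) + pi * y * (exp t + exp (- t)) * (A - B)\<^sup>2) * M)"
proof -
  let ?P = "exp t" and ?Q = "exp (- t)"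
  have PQ: "?Q \<le> ?P" using t by simp
  define a where "a = - pi * y * (A * ?P + B * ?Q)"
  define b where "b = - pi * y * (B * ?P + A * ?Q)"
  have aM: "exp a \<le> M" and bM: "exp b \<le> M" using M by (simp_all add: a_def b_def A_def B_def fourier_weight_def)
  have "a - b = - pi * y * ((A - B) * (?P - ?Q))" by (simp add: a_def b_def algebra_simps)
  then have "\<bar>a - b\<bar> = pi * y * (\<bar>A - B\<bar> * (?P - ?Q))" using y PQ by (simp add: abs_mult)
  then have ab: "\<bar>exp a - exp b\<bar> \<le> pi * y * (\<bar>A - B\<bar> * (?P - ?Q)) * M" using exp_diff_le[OF aM bM] by simp
  have "2 * sym_slope y (m, k) t = pi * y * ((A + B) * (?P - ?Q) * (exp a + exp b) + (A - B) * (?P + ?Q) * (exp a - exp b))"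
    by (simp add: sym_slope_def fourier_weight_def A_def B_def a_def b_def algebra_simps)
  then have "sym_slope y (m, k) t = pi * y / 2 * ((A + B) * (?P - ?Q) * (exp a + exp b) + (A - B) * (?P + ?Q) * (exp a - exp b))"
    by simp
  then have "\<bar>sym_slope y (m, k) t\<bar> = pi * y / 2 * \<bar>(A + B) * (?P - ?Q) * (exp a + exp b) + (A - B) * (?P + ?Q) * (exp a - exp b)\<bar>"
    using y by (simp only: abs_mult) simp
  also have "\<dots> \<le> pi * y / 2 * ((A + B) * (?P - ?Q) * (M + M) + \<bar>A - B\<bar> * (?P + ?Q) * (pi * y * (\<bar>A - B\<bar> * (?P - ?Q)) * M))"
  proof (intro mult_left_mono order_trans[OF abs_triangle_ineq] add_mono)
    have "0 \<le> A + B" by (simp add: A_def B_def)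
    then show "\<bar>(A + B) * (?P - ?Q) * (exp a + exp b)\<bar> \<le> (A + B) * (?P - ?Q) * (M + M)"
      using PQ aM bM by (simp add: abs_mult) (intro mult_left_mono, auto)
    show "\<bar>(A - B) * (?P + ?Q) * (exp a - exp b)\<bar> \<le> \<bar>A - B\<bar> * (?P + ?Q) * (pi * y * (\<bar>A - B\<bar> * (?P - ?Q)) * M)"
      using ab by (simp add: abs_mult mult.assoc) (intro mult_left_mono, auto simp: add_nonneg_nonneg)
  qed (use y in auto)
  also have "\<dots> = pi * y / 2 * (?P - ?Q) * ((2 * (A + B) + pi * y * (?P + ?Q) * \<bar>A - B\<bar>\<^sup>2) * M)"
  proof -
    have "z * ((A + B) * D * (M + M) + a * P * (q * (a * D) * M)) = z * D * ((2 * (A + B) + q * P * a\<^sup>2) * M)"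
      for z q a D P :: real by (simp add: power2_eq_square algebra_simps)
    then show ?thesis .
  qed
  finally show ?thesis by simp
qed

text \<open>Pulls out the weight of the frequency \<open>(1, 1)\<close>, against which all others
  are measured; the rest decays in \<open>A + B - 2\<close>.\<close>

lemma sym_slope_bound:
  fixes y t :: real and m k :: int
  assumes y: "0 < y" and t: "0 \<le> t" and mk: "m \<noteq> 0" "k \<noteq> 0"
  defines "A \<equiv> (real_of_int m)\<^sup>2" and "B \<equiv> (real_of_int k)\<^sup>2"
  shows "\<bar>sym_slope y (m, k) t\<bar> \<le> pi * y / 2 * (exp t - exp (- t)) *
    ((2 * (A + B) + pi * y * (exp t + exp (- t)) * (A - B)\<^sup>2) *
      (exp (- (pi * y * exp (- t)) * (A + B - 2)) * exp (- pi * y * (exp t + exp (- t)))))"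
proof -
  have A1: "1 \<le> A" "1 \<le> B" using mk int_abs_le_square[of m] int_abs_le_square[of k] unfolding A_def B_def by linarith+
  have PQ: "exp (- t) \<le> exp t" using t by simp
  have bd: "exp (- pi * y * (A * exp t + B * exp (- t))) \<le> exp (- (pi * y * exp (- t)) * (A + B - 2)) * exp (- pi * y * (exp t + exp (- t)))"
    if "1 \<le> A" for A B :: real
  proof -
    have "0 \<le> pi * y * ((A - 1) * (exp t - exp (- t)))" using y that PQ by simp
    then show ?thesis unfolding exp_add[symmetric] exp_le_cancel_iff by (simp add: algebra_simps)
  qed
  show ?thesis
    unfolding A_def B_def
    by (rule sym_slope_bound_gen[OF y t]; use bd[of A B] bd[of B A] A1 in \<open>simp add: fourier_weight_def A_def B_def add.commute\<close>)
qed

text \<open>Here \<open>\<kappa>\<close> stands for \<open>pi * y * exp (- t)\<close>, which is at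
  least \<open>143/100\<close> for \<open>y \<ge> rho_im\<close> and
  \<open>exp t \<le> 19/10\<close>; \<open>461/100\<close> is \<open>(19/10)\<^sup>2 + 1\<close>,
  and \<open>A * B\<close> is the loss \<open>(m * k)\<^sup>2\<close> from the cosines. Pairs with
  \<open>m + k = 4\<close> are evaluated, the others bounded by powers of \<open>N\<close>.\<close>

lemma slope_weight_bound:
  fixes m k :: nat and \<kappa> :: real
  assumes \<kappa>: "143/100 \<le> \<kappa>" and mk: "1 \<le> m" "1 \<le> k" "4 \<le> m + k"
  defines "A \<equiv> (real m)\<^sup>2" and "B \<equiv> (real k)\<^sup>2"
  shows "A * B * (2 * (A + B) + 461/100 * \<kappa> * (A - B)\<^sup>2) * exp (- \<kappa> * (A + B - 2)) \<le> 4 * (1/3) ^ (m + k)"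
proof -
  have A1: "1 \<le> A" "1 \<le> B" using mk by (simp_all add: A_def B_def)
  define N where "N = A + B"
  have Nn: "(real m + real k)\<^sup>2 \<le> 2 * N"
    using zero_le_power2[of "real m - real k"] by (simp add: N_def A_def B_def power2_eq_square algebra_simps)
  have "4 * 4 \<le> (real m + real k)\<^sup>2" unfolding power2_eq_square using mk by (intro mult_mono) linarith+
  then have N8: "8 \<le> N" using Nn by simp
  define E where "E = exp (- (143/100) * (N - 2))"
  have e1: "exp (- \<kappa> * (N - 2)) \<le> E" unfolding E_def exp_le_cancel_iff using \<kappa> N8 by (intro mult_right_mono) auto
  have e2: "\<kappa> * exp (- \<kappa> * (N - 2)) \<le> 143/100 * E"
  proof -
    have "\<kappa> \<le> 143/100 * (1 + (\<kappa> - 143/100) * (N - 2))"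
    proof -
      have "(\<kappa> - 143/100) * 6 \<le> (\<kappa> - 143/100) * (N - 2)" using \<kappa> N8 by (intro mult_left_mono) auto
      then show ?thesis using \<kappa> by argo
    qed
    also have "\<dots> \<le> 143/100 * exp ((\<kappa> - 143/100) * (N - 2))"
      by (intro mult_left_mono exp_ge_add_one_self) auto
    finally have "\<kappa> * exp (- \<kappa> * (N - 2)) \<le> 143/100 * exp ((\<kappa> - 143/100) * (N - 2)) * exp (- \<kappa> * (N - 2))"
      by (intro mult_right_mono) auto
    also have "\<dots> = 143/100 * E" by (simp add: E_def mult.assoc exp_add[symmetric] algebra_simps)
    finally show ?thesis .
  qed
  have "A * B * (2 * N + 461/100 * \<kappa> * (A - B)\<^sup>2) * exp (- \<kappa> * (N - 2))
     = A * B * (2 * N * exp (- \<kappa> * (N - 2)) + 461/100 * (A - B)\<^sup>2 * (\<kappa> * exp (- \<kappa> * (N - 2))))"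
    by (simp add: algebra_simps)
  also have "\<dots> \<le> A * B * (2 * N * E + 461/100 * (A - B)\<^sup>2 * (143/100 * E))"
    using A1 N8 e1 e2 by (intro mult_left_mono add_mono) auto
  also have "\<dots> = A * B * (2 * N + 461/100 * (143/100) * (A - B)\<^sup>2) * E" by (simp add: algebra_simps)
  also have "\<dots> \<le> 4 * (1/3) ^ (m + k)"
  proof (cases "m + k = 4")
    case True
    then consider "m = 1 \<and> k = 3 \<or> m = 3 \<and> k = 1" | "m = 2 \<and> k = 2" using mk by linarith
    then show ?thesis
    proof cases
      case 1
      then have v: "A * B = 9" "N = 10" "(A - B)\<^sup>2 = 64" by (auto simp: A_def B_def N_def)
      have "(80550 :: real) \<le> (1331075/1000000) ^ 40" by (simp add: power_divide)
      also have "\<dots> \<le> exp (real 40 * (143/500))" by (rule exp_ge_power) (simp_all add: power_divide)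
      finally have "80550 * E \<le> exp (real 40 * (143/500)) * E" by (intro mult_right_mono) (auto simp: E_def)
      also have "\<dots> = 1" by (simp add: E_def v exp_add[symmetric])
      finally show ?thesis unfolding True v by (simp add: power_divide)
    next
      case 2
      then have v: "A * B = 16" "N = 8" "(A - B)\<^sup>2 = 0" by (auto simp: A_def B_def N_def)
      have "(5184 :: real) \<le> (1535590/1000000) ^ 20" by (simp add: power_divide)
      also have "\<dots> \<le> exp (real 20 * (429/1000))" by (rule exp_ge_power) (simp_all add: power_divide)
      finally have "5184 * E \<le> exp (real 20 * (429/1000)) * E" by (intro mult_right_mono) (auto simp: E_def)
      also have "\<dots> = 1" by (simp add: E_def v exp_add[symmetric])
      finally show ?thesis unfolding True v by (simp add: power_divide)
    qed
  next
    case False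
    then have mk5: "5 \<le> real m + real k" using mk by linarith
    have "5 * (real m + real k) \<le> (real m + real k)\<^sup>2" unfolding power2_eq_square using mk5 by (intro mult_right_mono) auto
    then have Nmk: "5/2 * (real m + real k) \<le> N" using Nn by simp
    \<comment> \<open>A sum of two squares of integers that is at least \<open>25/2\<close> is at
      least \<open>13\<close>.\<close>
    have "13 \<le> m\<^sup>2 + k\<^sup>2"
    proof -
      have "N = real (m\<^sup>2 + k\<^sup>2)" by (simp add: N_def A_def B_def)
      then have "real 25 \<le> real (2 * (m\<^sup>2 + k\<^sup>2))" using Nmk mk5 by simp
      then have "25 \<le> 2 * (m\<^sup>2 + k\<^sup>2)" unfolding of_nat_le_iff .
      moreover have "25 \<le> 2 * X \<Longrightarrow> 13 \<le> X" for X :: nat by linarith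
      ultimately show ?thesis by blast
    qed
    then have N13: "13 \<le> N" unfolding N_def A_def B_def by (simp flip: of_nat_power of_nat_add)
    have ab: "4 * (A * B) + (A - B)\<^sup>2 = N\<^sup>2" by (simp add: N_def power2_eq_square algebra_simps)
    have AB: "A * B \<le> N\<^sup>2 / 4" using ab zero_le_power2[of "A - B"] by linarith
    have AB2: "A * B * (A - B)\<^sup>2 \<le> (N\<^sup>2)\<^sup>2 / 16"
    proof -
      have "0 \<le> (4 * (A * B) - (A - B)\<^sup>2)\<^sup>2" by simp
      also have "\<dots> = (4 * (A * B) + (A - B)\<^sup>2)\<^sup>2 - 16 * (A * B * (A - B)\<^sup>2)"
        by (simp add: power2_eq_square algebra_simps)
      finally show ?thesis unfolding ab by simp
    qed
    have "A * B * (2 * N + 461/100 * (143/100) * (A - B)\<^sup>2) = 2 * N * (A * B) + 461/100 * (143/100) * (A * B * (A - B)\<^sup>2)"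
      by (simp add: algebra_simps)
    also have "\<dots> \<le> 2 * N * (N\<^sup>2 / 4) + 461/100 * (143/100) * ((N\<^sup>2)\<^sup>2 / 16)"
      using AB AB2 N13 by (intro add_mono mult_left_mono) auto
    also have "\<dots> = N^3 / 2 + 461/1600 * (143/100) * N^4" by (simp add: power2_eq_square eval_nat_numeral)
    also have "\<dots> \<le> N^4 / 26 + 461/1600 * (143/100) * N^4"
    proof -
      have "13 * N^3 \<le> N * N^3" using N13 by (intro mult_right_mono) auto
      then show ?thesis by (simp add: eval_nat_numeral)
    qed
    also have "\<dots> \<le> 1/2 * N^4" using N13 by simp
    \<comment> \<open>The quartic growth uses up \<open>99/100\<close> of the decay rate
      \<open>143/100\<close>. The remaining \<open>44/100\<close> is \<open>11/10 * (2/5)\<close>,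
      and \<open>2/5 * N\<close> is at least \<open>m + k\<close>.\<close>
    also have "N^4 \<le> 28561 * exp (99/100 * (N - 13))"
    proof -
      have "N / 13 \<le> exp ((N - 13) / 13)" using exp_ge_add_one_self[of "(N - 13) / 13"] by (simp add: field_simps)
      then have "(N / 13) ^ 4 \<le> exp ((N - 13) / 13) ^ 4" using N13 by (intro power_mono) auto
      also have "\<dots> = exp (4 * ((N - 13) / 13))" by (simp add: exp_of_nat_mult[symmetric])
      also have "\<dots> \<le> exp (99/100 * (N - 13))" using N13 by simp
      finally show ?thesis by (simp add: power_divide)
    qed
    finally have "A * B * (2 * N + 461/100 * (143/100) * (A - B)\<^sup>2) * E \<le> 1/2 * (28561 * exp (99/100 * (N - 13))) * E"
      by (intro mult_right_mono) (auto simp: E_def)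
    also have "\<dots> = 28561/2 * exp (- 1001/100) * exp (- 11/10 * (2/5 * N))"
    proof -
      have "exp (99/100 * (N - 13)) * E = exp (- 1001/100) * exp (- 11/10 * (2/5 * N))"
        unfolding E_def exp_add[symmetric] by (rule arg_cong[where f = exp]) (simp add: field_simps)
      then show ?thesis by simp
    qed
    also have "\<dots> \<le> 4 * exp (- 11/10 * (real m + real k))"
    proof (rule mult_mono)
      have "(28561/8 :: real) \<le> (5/2) ^ 10" by (simp add: power_divide)
      also have "\<dots> \<le> exp (real 10 * 1)" by (rule exp_ge_power) simp_all
      also have "\<dots> \<le> exp (1001/100)" by simp
      finally have "28561/8 * exp (- 1001/100) \<le> exp (1001/100 :: real) * exp (- 1001/100)" by (intro mult_right_mono) auto
      also have "\<dots> = 1" by (simp add: exp_add[symmetric])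
      finally show "28561/2 * exp (- 1001/100) \<le> (4::real)" by simp
      show "exp (- 11/10 * (2/5 * N)) \<le> exp (- 11/10 * (real m + real k))" using Nmk by simp
    qed auto
    also have "\<dots> \<le> 4 * (1/3) ^ (m + k)"
    proof -
      note three_le_exp
      then have "exp (- (11/10)) \<le> (1/3 :: real)" by (simp add: exp_minus field_simps)
      then have "exp (- (11/10)) ^ (m + k) \<le> (1/3 :: real) ^ (m + k)" by (intro power_mono) auto
      then show ?thesis by (simp add: exp_of_nat_mult[symmetric] algebra_simps)
    qed
    finally show ?thesis .
  qed
  finally show ?thesis by (simp add: N_def)
qed

lemma abs_sin_mult_le: "\<bar>sin (real n * \<phi>)\<bar> \<le> real n * \<bar>sin \<phi>\<bar>"
proof (induction n)
  case (Suc n)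
  have "\<bar>sin (real (Suc n) * \<phi>)\<bar> = \<bar>sin (real n * \<phi>) * cos \<phi> + cos (real n * \<phi>) * sin \<phi>\<bar>"
    by (simp add: distrib_right sin_add algebra_simps)
  also have "\<dots> \<le> \<bar>sin (real n * \<phi>)\<bar> * \<bar>cos \<phi>\<bar> + \<bar>cos (real n * \<phi>)\<bar> * \<bar>sin \<phi>\<bar>"
    by (metis abs_mult abs_triangle_ineq)
  also have "\<dots> \<le> \<bar>sin (real n * \<phi>)\<bar> * 1 + 1 * \<bar>sin \<phi>\<bar>"
    by (intro add_mono mult_left_mono mult_right_mono) auto
  finally show ?case using Suc by (simp add: algebra_simps)
qed auto

text \<open>With \<open>\<phi> = pi * (x - 1/2)\<close> the difference is
  \<open>2 * (sin (j * \<phi>))\<^sup>2\<close> up to sign, and \<open>\<bar>sin (j * \<phi>)\<bar>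
  \<le> \<bar>j\<bar> * \<bar>sin \<phi>\<bar>\<close>. Every frequency is thus controlled by the
  first one, with the loss \<open>j\<^sup>2\<close>.\<close>

lemma cos_diff_bound:
  fixes j :: int
  shows "\<bar>cos (2 * pi * of_int j * x) - cos (2 * pi * of_int j * (1/2))\<bar> \<le> (of_int j)\<^sup>2 * (1 + cos (2 * pi * x))"
proof -
  define \<phi> where "\<phi> = pi * (x - 1/2)"
  have "cos (2 * pi * of_int j * x) = cos (2 * pi * of_int j * (1/2)) * cos (2 * (of_int j * \<phi>))"
  proof -
    have "2 * pi * of_int j * x = 2 * pi * of_int j * (1/2) + 2 * (of_int j * \<phi>)" by (simp add: \<phi>_def algebra_simps)
    moreover have "sin (2 * pi * of_int j * (1/2)) = 0" using sin_int_times_real[of j] by (simp add: mult.commute)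
    ultimately show ?thesis by (simp add: cos_add)
  qed
  then have "cos (2 * pi * of_int j * x) - cos (2 * pi * of_int j * (1/2)) = - cos (2 * pi * of_int j * (1/2)) * (2 * (sin (of_int j * \<phi>))\<^sup>2)"
  proof -
    have "c * (1 - 2 * s) - c = - c * (2 * s)" for c s :: real by (simp add: algebra_simps)
    then show ?thesis using \<open>cos (2 * pi * of_int j * x) = _\<close> unfolding cos_double_sin by (simp only:)
  qed
  then have "\<bar>cos (2 * pi * of_int j * x) - cos (2 * pi * of_int j * (1/2))\<bar> = \<bar>cos (2 * pi * of_int j * (1/2))\<bar> * (2 * (sin (of_int j * \<phi>))\<^sup>2)"
    by (simp add: abs_mult)
  also have "\<dots> \<le> 1 * (2 * (sin (of_int j * \<phi>))\<^sup>2)" by (intro mult_right_mono) auto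
  also have "(sin (of_int j * \<phi>))\<^sup>2 = \<bar>sin (real (nat \<bar>j\<bar>) * \<phi>)\<bar>\<^sup>2" by (cases "0 \<le> j") auto
  also have "\<dots> \<le> (real (nat \<bar>j\<bar>) * \<bar>sin \<phi>\<bar>)\<^sup>2" by (intro power_mono abs_sin_mult_le) auto
  also have "1 * (2 * \<dots>) = (of_int j)\<^sup>2 * (2 * (sin \<phi>)\<^sup>2)" by (simp add: power_mult_distrib)
  also have "2 * (sin \<phi>)\<^sup>2 = 1 - cos (2 * \<phi>)" by (simp add: cos_double_sin)
  also have "cos (2 * \<phi>) = - cos (2 * pi * x)"
  proof -
    have "2 * \<phi> = 2 * pi * x - pi" by (simp add: \<phi>_def algebra_simps)
    then show ?thesis by (simp add: cos_diff)
  qed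
  finally show ?thesis by simp
qed

text \<open>The frequencies \<open>{1, 2}\<close> enter with the favourable sign: their weight grows with \<open>t\<close>,
  while \<open>cos (4 * pi * x)\<close> is maximal at \<open>x = 1/2\<close>.\<close>

lemma sym_slope_12_nonpos:
  fixes y t :: real
  assumes y: "rho_im \<le> y" and t: "0 \<le> t" "exp t \<le> 19/10" and mk: "{m\<^sup>2, k\<^sup>2} = {1, 4 :: int}"
  shows "sym_slope y (m, k) t \<le> 0"
proof -
  define \<alpha> where "\<alpha> = exp t"
  define \<beta> where "\<beta> = 1 / \<alpha>"
  have \<alpha>: "1 \<le> \<alpha>" "\<alpha> \<le> 19/10" "0 < \<beta>" "\<beta> \<le> 1" "\<alpha> * \<beta> = 1" "exp (- t) = \<beta>"
    using t by (auto simp: \<alpha>_def \<beta>_def exp_minus field_simps)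
  have y0: "0 < y" using y rho_im(1) by linarith
  define S where "S = exp (- pi * y * (\<alpha> + 4 * \<beta>))"
  define R where "R = exp (- pi * y * (4 * \<alpha> + \<beta>))"
  \<comment> \<open>The quotient of \<open>S\<close> by \<open>R\<close> is
    \<open>exp (3 * pi * y * (\<alpha> - \<beta>))\<close>, and \<open>3 * pi * rho_im\<close> is
    above \<open>8\<close>.\<close>
  define w where "w = 8 * (\<alpha> - \<beta>)"
  have ab: "0 \<le> \<alpha> - \<beta>" using \<alpha> by simp
  have SR: "R * (1 + w + w\<^sup>2 / 2) \<le> S"
  proof -
    have w0: "0 \<le> w" using ab by (simp add: w_def)
    have "(1 + w + w\<^sup>2 / 2) \<le> exp w" using exp_ge_cubic[of w] w0 zero_le_power[OF w0, of 3] by linarith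
    also have "exp w \<le> exp (3 * (pi * y) * (\<alpha> - \<beta>))"
    proof -
      have "3141/1000 * (866/1000) \<le> pi * y" using pi_approx y rho_im by (intro mult_mono) auto
      then show ?thesis unfolding w_def exp_le_cancel_iff using ab by (intro mult_right_mono) auto
    qed
    finally have "R * (1 + w + w\<^sup>2 / 2) \<le> R * exp (3 * (pi * y) * (\<alpha> - \<beta>))" by (intro mult_left_mono) (auto simp: R_def)
    also have "\<dots> = S" unfolding R_def S_def exp_add[symmetric] by (simp add: algebra_simps)
    finally show ?thesis .
  qed
  \<comment> \<open>Since \<open>4 * \<alpha> - \<beta> = (4 * \<beta> - \<alpha>) + 5 * (\<alpha> -
    \<beta>)\<close>, a factor \<open>\<alpha> - \<beta>\<close> cancels and \<open>key\<close>
    remains.\<close>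
  have "4 * \<alpha> - \<beta> \<le> (4 * \<beta> - \<alpha>) * (1 + w + w\<^sup>2 / 2)"
  proof -
    have key: "5 \<le> (4 * \<beta> - \<alpha>) * (8 * (1 + 4 * (\<alpha> - \<beta>)))"
    proof (cases "\<alpha> \<le> 8/5")
      case True
      have "5/8 * \<alpha> \<le> 1" using True by simp
      then have "5/8 * \<alpha> * \<beta> \<le> 1 * \<beta>" using \<alpha> by (intro mult_right_mono) auto
      then have "5/8 \<le> \<beta>" using \<alpha> by (simp add: mult.assoc)
      then have "5/8 + 4 * \<beta> - \<beta> * 4 + 9/40 \<le> 4 * \<beta> - \<alpha>" using True by linarith
      then have "(5/8) * (8 * 1) \<le> (4 * \<beta> - \<alpha>) * (8 * (1 + 4 * (\<alpha> - \<beta>)))"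
        using ab by (intro mult_mono) auto
      then show ?thesis by simp
    next
      case False
      have "8/5 * \<beta> \<le> \<alpha> * \<beta>" using False \<alpha> by (intro mult_right_mono) auto
      then have b1: "\<beta> \<le> 5/8" using \<alpha> by simp
      have "\<alpha> * \<beta> \<le> 19/10 * \<beta>" using \<alpha> by (intro mult_right_mono) auto
      then have b2: "10/19 \<le> \<beta>" using \<alpha> by simp
      have "(4 * (10/19) - 19/10) * (8 * (1 + 4 * (8/5 - 5/8))) \<le> (4 * \<beta> - \<alpha>) * (8 * (1 + 4 * (\<alpha> - \<beta>)))"
        using b1 b2 False \<alpha> by (intro mult_mono) auto
      then show ?thesis by simp
    qed
    have "5 * (\<alpha> - \<beta>) \<le> (4 * \<beta> - \<alpha>) * (8 * (1 + 4 * (\<alpha> - \<beta>))) * (\<alpha> - \<beta>)"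
      using key ab by (intro mult_right_mono) auto
    moreover have "8 * D + (8 * D)\<^sup>2 / 2 = 8 * (1 + 4 * D) * D" for D :: real
      by (simp add: power2_eq_square algebra_simps)
    then have "w + w\<^sup>2 / 2 = 8 * (1 + 4 * (\<alpha> - \<beta>)) * (\<alpha> - \<beta>)" unfolding w_def .
    ultimately have "5 * (\<alpha> - \<beta>) \<le> (4 * \<beta> - \<alpha>) * (w + w\<^sup>2 / 2)" by (simp only: mult.assoc)
    moreover have "(4 * \<beta> - \<alpha>) * (1 + w + w\<^sup>2 / 2) = (4 * \<beta> - \<alpha>) + (4 * \<beta> - \<alpha>) * (w + w\<^sup>2 / 2)"
      by (simp only: add.assoc distrib_left mult_1_right)
    moreover have "4 * \<alpha> - \<beta> = (4 * \<beta> - \<alpha>) + 5 * (\<alpha> - \<beta>)" by simp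
    ultimately show ?thesis by (simp only: add_left_mono)
  qed
  then have "R * (4 * \<alpha> - \<beta>) \<le> R * ((4 * \<beta> - \<alpha>) * (1 + w + w\<^sup>2 / 2))" by (intro mult_left_mono) (auto simp: R_def)
  also have "\<dots> = (4 * \<beta> - \<alpha>) * (R * (1 + w + w\<^sup>2 / 2))" by simp
  also have "\<dots> \<le> (4 * \<beta> - \<alpha>) * S"
  proof -
    have "\<alpha> * \<beta> \<le> 19/10 * \<beta>" using \<alpha> by (intro mult_right_mono) auto
    then have "0 \<le> 4 * \<beta> - \<alpha>" using \<alpha> by simp
    then show ?thesis using SR by (intro mult_left_mono)
  qed
  finally have fin: "(\<alpha> - 4 * \<beta>) * S + (4 * \<alpha> - \<beta>) * R \<le> 0" by (simp add: algebra_simps)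
  have "sym_slope y (m, k) t = pi * y * ((\<alpha> - 4 * \<beta>) * S + (4 * \<alpha> - \<beta>) * R)"
  proof -
    have "m\<^sup>2 = 1 \<and> k\<^sup>2 = 4 \<or> m\<^sup>2 = 4 \<and> k\<^sup>2 = 1" using mk by (auto simp: doubleton_eq_iff)
    then have "(real_of_int m)\<^sup>2 = 1 \<and> (real_of_int k)\<^sup>2 = 4 \<or> (real_of_int m)\<^sup>2 = 4 \<and> (real_of_int k)\<^sup>2 = 1"
      by (metis of_int_power of_int_1 of_int_numeral)
    then show ?thesis by (auto simp: sym_slope_def fourier_weight_def S_def R_def \<alpha>(6) \<alpha>_def[symmetric] algebra_simps minus_diff_commute)
  qed
  then show ?thesis using fin y0 by (simp add: mult_nonneg_nonpos)
qed

text \<open>The total \<open>4\<close> is the number of frequencies with both entries of modulus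
  one, so their contribution can be redistributed with these weights without changing the
  sum.\<close>

lemma weight_sum: "((\<lambda>v. (1/3::real) ^ (nat \<bar>fst v\<bar> + nat \<bar>snd v\<bar>)) has_sum 4) (UNIV :: (int \<times> int) set)"
proof -
  have g: "((\<lambda>k::int. (1/3::real) ^ nat \<bar>k\<bar>) has_sum 2) UNIV"
    using has_sum_geometric_int[of "1/3"] by simp
  from has_sum_product_real[OF g g]
  show ?thesis by (simp add: power_add case_prod_unfold)
qed

lemma sym_slope_11:
  assumes "m\<^sup>2 = 1" "k\<^sup>2 = (1::int)"
  shows "sym_slope y (m, k) t = 2 * pi * y * (exp t - exp (- t)) * exp (- pi * y * (exp t + exp (- t)))"
    and "sym_weight y (m, k) t = 2 * exp (- pi * y * (exp t + exp (- t)))"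
proof -
  have "(real_of_int m)\<^sup>2 = 1" "(real_of_int k)\<^sup>2 = 1" using assms by (metis of_int_power of_int_1)+
  then show "sym_slope y (m, k) t = 2 * pi * y * (exp t - exp (- t)) * exp (- pi * y * (exp t + exp (- t)))"
    "sym_weight y (m, k) t = 2 * exp (- pi * y * (exp t + exp (- t)))"
    by (simp_all add: sym_slope_def sym_weight_def fourier_weight_def algebra_simps)
qed

lemma sym_slope_weight:
  fixes y t :: real and m k :: int
  assumes y: "rho_im \<le> y" and t: "0 \<le> t" "exp t \<le> 19/10" and mk: "m \<noteq> 0" "k \<noteq> 0" "4 \<le> \<bar>m\<bar> + \<bar>k\<bar>"
  shows "(of_int (m * k))\<^sup>2 * \<bar>sym_slope y (m, k) t\<bar> \<le> (1/3) ^ (nat \<bar>m\<bar> + nat \<bar>k\<bar>) * sym_slope y (1, 1) t"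
proof -
  have y0: "0 < y" using y rho_im(1) by linarith
  define A where "A = (real_of_int m)\<^sup>2"
  define B where "B = (real_of_int k)\<^sup>2"
  define \<kappa> where "\<kappa> = pi * y * exp (- t)"
  have \<kappa>: "143/100 \<le> \<kappa>"
  proof -
    have "3141/1000 * (866/1000) \<le> pi * y" using pi_approx y rho_im by (intro mult_mono) auto
    moreover have "10/19 \<le> exp (- t)" using t by (simp add: exp_minus field_simps)
    ultimately have "3141/1000 * (866/1000) * (10/19) \<le> \<kappa>" unfolding \<kappa>_def using y0 by (intro mult_mono[of "3141/1000 * (866/1000)" "pi * y"]) auto
    then show ?thesis by simp
  qed
  have k2: "pi * y * (exp t + exp (- t)) \<le> 461/100 * \<kappa>"
  proof -
    have "exp t * exp t \<le> 19/10 * (19/10)" using t by (intro mult_mono) auto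
    then have "\<kappa> * (exp t * exp t + 1) \<le> \<kappa> * (461/100)" using \<kappa> by (intro mult_left_mono) auto
    moreover have "\<kappa> * (exp t * exp t + 1) = pi * y * (exp (- t) * exp t * exp t + exp (- t))" by (simp add: \<kappa>_def algebra_simps)
    ultimately show ?thesis by (simp add: exp_add[symmetric])
  qed
  define D where "D = pi * y / 2 * (exp t - exp (- t))"
  define G where "G = exp (- pi * y * (exp t + exp (- t)))"
  have D0: "0 \<le> D" "0 \<le> G" using y0 t by (simp_all add: D_def G_def)
  have "(of_int (m * k))\<^sup>2 * \<bar>sym_slope y (m, k) t\<bar> \<le> A * B * (D * ((2 * (A + B) + pi * y * (exp t + exp (- t)) * (A - B)\<^sup>2) * exp (- \<kappa> * (A + B - 2)) * G))"
    unfolding of_int_mult power_mult_distrib A_def[symmetric] B_def[symmetric]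
    using sym_slope_bound[OF y0 t(1) mk(1,2)] unfolding A_def[symmetric] B_def[symmetric] \<kappa>_def D_def G_def mult.assoc[of _ "exp _" "exp _"]
    by (intro mult_left_mono) (auto simp: A_def B_def)
  also have "\<dots> \<le> A * B * (D * ((2 * (A + B) + 461/100 * \<kappa> * (A - B)\<^sup>2) * exp (- \<kappa> * (A + B - 2)) * G))"
    using D0 k2 by (intro mult_left_mono mult_right_mono add_left_mono) (auto simp: A_def B_def)
  also have "\<dots> = D * G * (A * B * (2 * (A + B) + 461/100 * \<kappa> * (A - B)\<^sup>2) * exp (- \<kappa> * (A + B - 2)))"
    by (simp only: mult_ac)
  also have "\<dots> \<le> D * G * (4 * (1/3) ^ (nat \<bar>m\<bar> + nat \<bar>k\<bar>))"
  proof (intro mult_left_mono)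
    have "A = (real (nat \<bar>m\<bar>))\<^sup>2" "B = (real (nat \<bar>k\<bar>))\<^sup>2" by (simp_all add: A_def B_def)
    moreover have "1 \<le> nat \<bar>m\<bar>" "1 \<le> nat \<bar>k\<bar>" "4 \<le> nat \<bar>m\<bar> + nat \<bar>k\<bar>" using mk by linarith+
    ultimately show "A * B * (2 * (A + B) + 461/100 * \<kappa> * (A - B)\<^sup>2) * exp (- \<kappa> * (A + B - 2)) \<le> 4 * (1/3) ^ (nat \<bar>m\<bar> + nat \<bar>k\<bar>)"
      using slope_weight_bound[OF \<kappa>] by metis
  qed (use D0 in auto)
  also have "\<dots> = (1/3) ^ (nat \<bar>m\<bar> + nat \<bar>k\<bar>) * sym_slope y (1, 1) t"
    by (simp add: sym_slope_11 D_def G_def)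
  finally show ?thesis .
qed

text \<open>The four frequencies with entries of modulus one contribute the known factor
  \<open>1 + cos (2 * pi * x)\<close> times a decreasing weight. Their total slope, spread over all
  frequencies, pays for every term of unknown sign, so that each single term becomes
  nonincreasing.\<close>

theorem ntheta_minus_line_antimono:
  fixes x y t1 t2 :: real
  assumes y: "rho_im \<le> y" and t: "0 \<le> t1" "t1 \<le> t2" "exp t2 \<le> 19/10"
  shows "ntheta x y t2 - ntheta (1/2) y t2 \<le> ntheta x y t1 - ntheta (1/2) y t1"
proof -
  have y0: "0 < y" using y rho_im(1) by linarith
  define d where "d v = cos (2 * pi * of_int (fst v) * of_int (snd v) * x) - cos (2 * pi * of_int (fst v) * of_int (snd v) * (1/2))" for v :: "int \<times> int"
  define c where "c = 1 + cos (2 * pi * x)"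
  define w where "w v = (1/3::real) ^ (nat \<bar>fst v\<bar> + nat \<bar>snd v\<bar>)" for v :: "int \<times> int"
  define F where "F = ({1, -1} \<times> {1, -1} :: (int \<times> int) set)"
  define i where "i v = (if v \<in> F then 1 else 0 :: real)" for v
  \<comment> \<open>\<open>w - i\<close> sums to zero, so the added terms leave the total
    unchanged.\<close>
  define T where "T v t = d v * sym_weight y v t + (w v - i v) * c * sym_weight y (1, 1) t" for v t
  have c0: "0 \<le> c" using cos_ge_minus_one[of "2 * pi * x"] unfolding c_def by linarith
  have db: "\<bar>d (m, k)\<bar> \<le> (of_int (m * k))\<^sup>2 * c" for m k
    using cos_diff_bound[of "m * k" x] by (simp add: d_def c_def mult.assoc)
  have isum: "(i has_sum 4) UNIV"
    using has_sum_if_finite[of F 1] by (simp add: i_def[abs_def] F_def card_cartesian_product)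
  have S: "((\<lambda>v. T v t) has_sum 2 / sqrt y * (ntheta x y t - ntheta (1/2) y t)) UNIV" for t
  proof -
    have "((\<lambda>v. d v * sym_weight y v t) has_sum 2 * ntheta x y t / sqrt y - 2 * ntheta (1/2) y t / sqrt y) UNIV"
      using has_sum_diff_real[OF ntheta_sym_fourier[OF y0, of x t] ntheta_sym_fourier[OF y0, of "1/2" t]] by (simp add: d_def left_diff_distrib)
    from has_sum_add[OF this has_sum_cmult_left[OF has_sum_diff_real[OF weight_sum isum], of "c * sym_weight y (1, 1) t"]]
    show ?thesis by (simp add: T_def w_def right_diff_distrib mult.assoc)
  qed
  have dT: "(T v has_real_derivative - (d v * sym_slope y v t + (w v - i v) * c * sym_slope y (1, 1) t)) (at t)" for v t
    unfolding T_def by (rule derivative_eq_intros sym_weight_deriv refl | simp)+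
  have nonneg: "0 \<le> d v * sym_slope y v t + (w v - i v) * c * sym_slope y (1, 1) t" if "t1 \<le> t" "t \<le> t2" for v t
  proof -
    obtain m k where v: "v = (m, k)" by (cases v)
    have t0: "0 \<le> t" "exp t \<le> 19/10"
    proof -
      have "exp t \<le> exp t2" using that by simp
      then show "0 \<le> t" "exp t \<le> 19/10" using t that by linarith+
    qed
    have G: "0 \<le> sym_slope y (1, 1) t" using t0 y0 by (simp add: sym_slope_11)
    have w0: "0 \<le> w v" by (simp add: w_def)
    have wcG: "0 \<le> w v * c * sym_slope y (1, 1) t" using w0 c0 G by simp
    consider "v \<in> F" | "m = 0 \<or> k = 0" | "{m\<^sup>2, k\<^sup>2} = {1, 4}" | "v \<notin> F" "m \<noteq> 0" "k \<noteq> 0" "4 \<le> \<bar>m\<bar> + \<bar>k\<bar>"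
    proof -
      have "v \<in> F \<or> m = 0 \<or> k = 0 \<or> {m\<^sup>2, k\<^sup>2} = {1, 4} \<or> 4 \<le> \<bar>m\<bar> + \<bar>k\<bar>"
      proof (rule ccontr)
        assume n: "\<not> ?thesis"
        then have "\<bar>m\<bar> \<le> 2" "\<bar>k\<bar> \<le> 2" "m \<noteq> 0" "k \<noteq> 0" by linarith+
        then have "m \<in> {-2, -1, 1, 2}" "k \<in> {-2, -1, 1, 2}" by auto
        then show False using n by (auto simp: F_def v insert_commute)
      qed
      then show ?thesis using that by blast
    qed
    then show ?thesis
    proof cases
      case 1
      then have "m\<^sup>2 = 1" "k\<^sup>2 = 1" by (auto simp: F_def v)
      then have "sym_slope y v t = sym_slope y (1, 1) t" by (simp add: v sym_slope_11)
      moreover have "d v = c"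
        using 1 by (auto simp: F_def v d_def c_def)
      moreover have "i v = 1" using 1 by (simp add: i_def)
      ultimately show ?thesis using wcG by (simp add: algebra_simps)
    next
      case 2
      then have "d v = 0" "i v = 0" by (auto simp: d_def v i_def F_def)
      then show ?thesis using wcG by simp
    next
      case 3
      then have "m\<^sup>2 = 1 \<and> k\<^sup>2 = 4 \<or> m\<^sup>2 = 4 \<and> k\<^sup>2 = 1" by (auto simp: doubleton_eq_iff)
      moreover have "n = 2 \<or> n = - 2" if "n\<^sup>2 = 4" for n :: int using that power2_eq_iff[of n 2] by simp
      ultimately have "m \<in> {1, -1} \<and> k \<in> {2, -2} \<or> m \<in> {2, -2} \<and> k \<in> {1, -1}"
        by (auto simp: power2_eq_1_iff)
      then have "i v = 0" "m * k = 2 \<or> m * k = - 2" by (auto simp: i_def F_def v)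
      moreover have "d v \<le> 0"
      proof -
        have "d v = cos (2 * pi * of_int (m * k) * x) - cos (2 * pi * of_int (m * k) * (1/2))"
          by (simp add: d_def v mult.assoc)
        moreover have "cos (2 * pi * of_int (m * k) * (1/2)) = 1" using \<open>m * k = 2 \<or> _\<close>
          by (elim disjE) (simp_all only:, simp_all)
        ultimately show ?thesis by simp
      qed
      moreover have "sym_slope y v t \<le> 0" unfolding v by (rule sym_slope_12_nonpos[OF y t0 3])
      ultimately show ?thesis using wcG by (simp add: mult_nonpos_nonpos)
    next
      case 4
      have "\<bar>d v * sym_slope y v t\<bar> \<le> (of_int (m * k))\<^sup>2 * c * \<bar>sym_slope y v t\<bar>"
        unfolding abs_mult v by (intro mult_right_mono db) auto
      also have "\<dots> = c * ((of_int (m * k))\<^sup>2 * \<bar>sym_slope y v t\<bar>)" by simp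
      also have "\<dots> \<le> c * (w v * sym_slope y (1, 1) t)"
        using sym_slope_weight[OF y t0 4(2-4)] c0 by (intro mult_left_mono) (auto simp: v w_def)
      finally have "- (d v * sym_slope y v t) \<le> w v * c * sym_slope y (1, 1) t" by (simp add: mult_ac)
      then show ?thesis using 4 by (simp add: i_def)
    qed
  qed
  have "T v t2 \<le> T v t1" for v
  proof (rule DERIV_nonpos_imp_nonincreasing[OF t(2)])
    fix s assume "t1 \<le> s" "s \<le> t2"
    then show "\<exists>D. (T v has_real_derivative D) (at s) \<and> D \<le> 0" using dT nonneg[of s v] by fastforce
  qed
  then have "2 / sqrt y * (ntheta x y t2 - ntheta (1/2) y t2) \<le> 2 / sqrt y * (ntheta x y t1 - ntheta (1/2) y t1)"
    by (intro has_sum_mono[OF S S])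
  moreover have "0 < 2 / sqrt y" using y0 by simp
  ultimately show ?thesis by (simp only: mult_le_cancel_left_pos)
qed

section \<open>High points and small parameters\<close>

text \<open>The second \<open>t\<close>-derivative of \<open>exp (- x)\<close> along
  \<open>x = C * exp t\<close> and along \<open>x = C * exp (- t)\<close>, the exponents of the
  frequencies on the axes.\<close>

definition axis_rate :: "real \<Rightarrow> real" where "axis_rate x = (x\<^sup>2 - x) * exp (- x)"

lemma axis_rate_antimono:
  assumes "14/5 \<le> x" "x \<le> z"
  shows "axis_rate z \<le> axis_rate x"
proof (rule DERIV_nonpos_imp_nonincreasing[OF assms(2)])
  fix s assume "x \<le> s" "s \<le> z"
  \<comment> \<open>The larger root of \<open>s\<^sup>2 - 3 * s + 1\<close> lies below
    \<open>14/5\<close>.\<close>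
  then have "0 \<le> (s - 14/5) * (s - 1/5)" using assms by (intro mult_nonneg_nonneg) auto
  also have "\<dots> = s\<^sup>2 - 3 * s + 14/25" by (simp add: power2_eq_square field_simps)
  finally have "0 \<le> s\<^sup>2 - 3 * s + 1" by linarith
  moreover have "(axis_rate has_real_derivative - (s\<^sup>2 - 3 * s + 1) * exp (- s)) (at s)"
    unfolding axis_rate_def by (auto intro!: derivative_eq_intros simp: algebra_simps)
  moreover have "- (s\<^sup>2 - 3 * s + 1) * exp (- s) \<le> 0"
    using \<open>0 \<le> s\<^sup>2 - 3 * s + 1\<close> by (intro mult_nonpos_nonneg) auto
  ultimately show "\<exists>d. (axis_rate has_real_derivative d) (at s) \<and> d \<le> 0" by blast
qed

lemma axis_rate_pos: "1 < x \<Longrightarrow> 0 < axis_rate x"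
  by (simp add: axis_rate_def power2_eq_square)

text \<open>With \<open>u = y / Y\<close> each growing factor is bounded by an exponential in
  \<open>u - 1\<close>; the total rate \<open>3/2 + r - x\<close> is negative for
  \<open>x \<ge> 33/10\<close>. It reduces the numerical conditions to the lowest admissible
  \<open>y\<close>.\<close>

lemma sqrt_axis_rate_antimono:
  assumes Y: "0 < Y" "Y \<le> y" and c: "33/10 \<le> c * Y"
  shows "sqrt y * axis_rate (c * y) \<le> sqrt Y * axis_rate (c * Y)"
proof -
  define x where "x = c * Y"
  define u where "u = y / Y"
  define r where "r = x / (x - 1)"
  have x: "33/10 \<le> x" using c by (simp add: x_def)
  have u: "1 \<le> u" using Y by (simp add: u_def)
  have y: "y = u * Y" "c * y = u * x" using Y by (simp_all add: u_def x_def)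
  have r: "0 \<le> r" "r \<le> 33/23" using x by (simp_all add: r_def field_simps)
  have 1: "sqrt u \<le> exp ((u - 1) / 2)"
  proof -
    have "sqrt (u * 1) \<le> (u + 1) / 2" using u by (intro arith_geo_mean_sqrt) auto
    then show ?thesis using exp_ge_add_one_self[of "(u - 1) / 2"] by (simp add: field_simps)
  qed
  have 2: "u \<le> exp (u - 1)" using exp_ge_add_one_self[of "u - 1"] by simp
  have 3: "1 + (u - 1) * r \<le> exp ((u - 1) * r)" by (rule exp_ge_add_one_self)
  have "sqrt u * axis_rate (u * x) = (x\<^sup>2 - x) * (sqrt u * (u * (1 + (u - 1) * r))) * exp (- (u * x))"
  proof -
    have "(x - 1) * r = x" using x by (simp add: r_def)
    then have "(x\<^sup>2 - x) * (u * (1 + (u - 1) * r)) = (u * x)\<^sup>2 - u * x"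
    proof -
      assume h: "(x - 1) * r = x"
      have "(x\<^sup>2 - x) * (u * (1 + (u - 1) * r)) = x * u * ((x - 1) + (u - 1) * ((x - 1) * r))"
        by (simp add: power2_eq_square algebra_simps)
      then show ?thesis unfolding h by (simp add: power2_eq_square algebra_simps)
    qed
    then have "sqrt u * axis_rate (u * x) = sqrt u * ((x\<^sup>2 - x) * (u * (1 + (u - 1) * r)) * exp (- (u * x)))"
      by (simp add: axis_rate_def)
    then show ?thesis by (simp only: mult_ac)
  qed
  also have "\<dots> \<le> (x\<^sup>2 - x) * (exp ((u - 1) / 2) * (exp (u - 1) * exp ((u - 1) * r))) * exp (- (u * x))"
    using u r x 1 2 3 by (intro mult_right_mono mult_left_mono mult_mono) (auto simp: power2_eq_square)
  also have "\<dots> = (x\<^sup>2 - x) * exp (- x + (u - 1) * (3/2 + r - x))"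
    by (simp add: exp_add[symmetric] algebra_simps) (simp add: field_simps)
  also have "\<dots> \<le> (x\<^sup>2 - x) * exp (- x)"
  proof -
    have "(u - 1) * (3/2 + r - x) \<le> 0" using u r x by (intro mult_nonneg_nonpos) auto
    then show ?thesis using x by (intro mult_left_mono) (auto simp: power2_eq_square)
  qed
  finally have "sqrt u * axis_rate (u * x) \<le> axis_rate x" by (simp add: axis_rate_def)
  then have "sqrt Y * (sqrt u * axis_rate (u * x)) \<le> sqrt Y * axis_rate x" using Y by (intro mult_left_mono) auto
  moreover have "sqrt y = sqrt Y * sqrt u" unfolding y(1) by (simp add: real_sqrt_mult)
  ultimately show ?thesis unfolding y(2) x_def[symmetric] by (simp only: mult.assoc)
qed

text \<open>The polynomial growth costs at most \<open>exp ((N - 4) / 2)\<close>, and relative to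
  \<open>exp (- K)\<close> a decay of \<open>exp (- K * (N - 1))\<close> is available;
  \<open>n + 2 \<le> N\<close> converts it into powers of \<open>1/3\<close>.\<close>

lemma slope_tail_bound:
  fixes K N :: real and n :: nat
  assumes K: "67/20 \<le> K" and N: "4 \<le> N" and n: "2 \<le> n" "real n + 2 \<le> N"
  shows "K * (N + 61/50 * K * N\<^sup>2) * exp (- K * N) \<le> axis_rate K * (12/1000 * (1/3) ^ n)"
proof -
  have "N * 4 \<le> N * N" using N by (intro mult_left_mono) auto
  then have "N + 61/50 * K * N\<^sup>2 \<le> (1/4 + 61/50 * K) * N\<^sup>2" by (simp add: power2_eq_square algebra_simps)
  also have "\<dots> \<le> (K - 1) * (1847/1000) * N\<^sup>2" using K by (intro mult_right_mono) auto
  also have "N\<^sup>2 \<le> 16 * exp ((N - 4) / 2)"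
  proof -
    have "N / 4 \<le> exp ((N - 4) / 4)" using exp_ge_add_one_self[of "(N - 4) / 4"] by (simp add: field_simps)
    then have "(N / 4)\<^sup>2 \<le> (exp ((N - 4) / 4))\<^sup>2" using N by (intro power_mono) auto
    also have "\<dots> = exp ((N - 4) / 2)" by (simp add: exp_double[symmetric])
    finally show ?thesis by (simp add: power_divide)
  qed
  finally have 1: "N + 61/50 * K * N\<^sup>2 \<le> (K - 1) * (1847/1000) * (16 * exp ((N - 4) / 2))"
    using K by simp
  have "K * (N + 61/50 * K * N\<^sup>2) * exp (- K * N) \<le> K * ((K - 1) * (1847/1000) * (16 * exp ((N - 4) / 2))) * exp (- K * N)"
    using K by (intro mult_right_mono mult_left_mono 1) auto
  also have "\<dots> = axis_rate K * (1847/1000 * 16 * exp ((N - 4) / 2 - K * (N - 1)))"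
  proof -
    have "exp ((N - 4) / 2) * exp (- K * N) = exp (- K) * exp ((N - 4) / 2 - K * (N - 1))"
      by (simp add: exp_add[symmetric] algebra_simps)
    then have e: "(K\<^sup>2 - K) * (1847/1000 * 16 * (exp ((N - 4) / 2) * exp (- K * N))) = axis_rate K * (1847/1000 * 16 * exp ((N - 4) / 2 - K * (N - 1)))"
      by (simp only: axis_rate_def mult_ac)
    have "K * ((K - 1) * c * (16 * E1)) * E2 = (K\<^sup>2 - K) * (c * 16 * (E1 * E2))" for c E1 E2 :: real
      by (simp add: power2_eq_square algebra_simps)
    then show ?thesis unfolding e[symmetric] .
  qed
  also have "\<dots> \<le> axis_rate K * (12/1000 * (1/3) ^ n)"
  proof (rule mult_left_mono)
    have "67/20 * (N - 1) \<le> K * (N - 1)" using K N by (intro mult_right_mono) auto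
    then have "(N - 4) / 2 - K * (N - 1) \<le> - (201/20) + - (11/10) * (real n - 2)" using n N by argo
    then have "1847/1000 * 16 * exp ((N - 4) / 2 - K * (N - 1)) \<le> 1847/1000 * 16 * (exp (- (201/20)) * exp (- (11/10) * (real n - 2)))"
      unfolding exp_add[symmetric] by simp
    also have "\<dots> \<le> 12/1000 * (1/9) * exp (- (11/10) * (real n - 2))"
    proof -
      have "(22165 :: real) \<le> (1285622/1000000) ^ 40" by (simp add: power_divide)
      also have "\<dots> \<le> exp (real 40 * (201/800))" by (rule exp_ge_power) (simp_all add: power_divide)
      finally have "22165 * exp (- (201/20)) \<le> exp (201/20) * exp (- (201/20) :: real)" by (intro mult_right_mono) auto
      then have "1847/1000 * 16 * exp (- (201/20)) \<le> (12/1000 * (1/9) :: real)" by (simp add: exp_add[symmetric])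
      then show ?thesis unfolding mult.assoc[symmetric] by (intro mult_right_mono) (auto simp: mult.assoc)
    qed
    also have "exp (- (11/10) * (real n - 2)) \<le> (1/3) ^ (n - 2)"
    proof -
      have "exp (- (11/10)) \<le> (1/3 :: real)" using three_le_exp by (simp add: exp_minus field_simps)
      then have "exp (- (11/10)) ^ (n - 2) \<le> (1/3 :: real) ^ (n - 2)" by (intro power_mono) auto
      then show ?thesis using n by (simp add: exp_of_nat_mult[symmetric] of_nat_diff algebra_simps)
    qed
    finally have "1847/1000 * 16 * exp ((N - 4) / 2 - K * (N - 1)) \<le> 12/1000 * ((1/9) * (1/3) ^ (n - 2))" by simp
    also have "(1/9) * (1/3) ^ (n - 2) = (1/3 :: real) ^ n"
    proof -
      obtain j where "n = 2 + j" using n le_Suc_ex by blast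
      then show ?thesis by (simp add: power2_eq_square)
    qed
    finally show "1847/1000 * 16 * exp ((N - 4) / 2 - K * (N - 1)) \<le> 12/1000 * (1/3) ^ n" .
  qed (use axis_rate_pos[of K] K in auto)
  finally show ?thesis .
qed

text \<open>The exact contribution of the four shortest frequencies on the axes, plus an even
  function that pays for all others. The constant \<open>168/1000\<close> is
  \<open>4 * (12/1000) + 4 * (3/100)\<close>: the general weights, and an extra share for the four
  frequencies with entries of modulus one.\<close>

definition axis_majorant :: "real \<Rightarrow> real \<Rightarrow> real \<Rightarrow> real" where
  "axis_majorant y a t = 2 * sqrt y * (exp (- pi * y * exp t) + exp (- pi * y * exp (- t)))
     + sqrt y / 2 * (a * axis_rate (pi * y / a) * (168/1000)) * (exp t + exp (- t))"

text \<open>On the axes the cosine is one, so those terms are exact for every \<open>x\<close>.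
  Every other slope is at most its share \<open>c v * (exp t - exp (- t))\<close>, and after
  subtraction each single term is nonincreasing.\<close>

lemma ntheta_minus_majorant_antimono:
  fixes x y a t1 t2 :: real
  assumes y: "0 < y" and a: "1 \<le> a" "a \<le> 6/5" and K: "67/20 \<le> pi * y / a"
    and t: "0 \<le> t1" "t1 \<le> t2" "exp t2 \<le> a"
  shows "ntheta x y t2 - axis_majorant y a t2 \<le> ntheta x y t1 - axis_majorant y a t1"
proof -
  define K where "K = pi * y / a"
  have K1: "67/20 \<le> K" using K by (simp add: K_def)
  have g0: "0 < axis_rate K" using K1 by (intro axis_rate_pos) simp
  have piy: "pi * y = a * K" using a by (simp add: K_def)
  define C where "C v = cos (2 * pi * of_int (fst v) * of_int (snd v) * x)" for v :: "int \<times> int"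
  define w where "w v = (1/3::real) ^ (nat \<bar>fst v\<bar> + nat \<bar>snd v\<bar>)" for v :: "int \<times> int"
  define F where "F = ({1, -1} \<times> {1, -1} :: (int \<times> int) set)"
  define F1 where "F1 = ({(1, 0), (-1, 0), (0, 1), (0, -1)} :: (int \<times> int) set)"
  define i where "i v = (if v \<in> F then 1 else 0 :: real)" for v
  define i1 where "i1 v = (if v \<in> F1 then 1 else 0 :: real)" for v
  define c where "c v = a * axis_rate K * (12/1000 * w v + 3/100 * i v)" for v
  define T where "T v t = C v * sym_weight y v t - i1 v * sym_weight y (1, 0) t - c v * (exp t + exp (- t))" for v t
  have isum: "(i has_sum 4) UNIV" using has_sum_if_finite[of F 1] by (simp add: i_def[abs_def] F_def card_cartesian_product)
  have i1sum: "(i1 has_sum 4) UNIV" using has_sum_if_finite[of F1 1] by (simp add: i1_def[abs_def] F1_def)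
  have csum: "(c has_sum a * axis_rate K * (168/1000)) UNIV"
    using has_sum_cmult_right[OF has_sum_add[OF has_sum_cmult_right[OF weight_sum, of "12/1000"] has_sum_cmult_right[OF isum, of "3/100"]], of "a * axis_rate K"]
    by (simp add: c_def[abs_def] w_def)
  have S: "((\<lambda>v. T v t) has_sum 2 / sqrt y * (ntheta x y t - axis_majorant y a t)) UNIV" for t
  proof -
    have s10: "sym_weight y (1, 0) t = exp (- pi * y * exp t) + exp (- pi * y * exp (- t))" by (simp add: sym_weight_def fourier_weight_def)
    have "((\<lambda>v. T v t) has_sum (2 * ntheta x y t / sqrt y - 4 * sym_weight y (1, 0) t - a * axis_rate K * (168/1000) * (exp t + exp (- t)))) UNIV"
      unfolding T_def C_def
      by (intro has_sum_diff_real ntheta_sym_fourier[OF y] has_sum_cmult_left isum i1sum csum)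
    moreover have "2 * ntheta x y t / sqrt y - 4 * sym_weight y (1, 0) t - a * axis_rate K * (168/1000) * (exp t + exp (- t)) = 2 / sqrt y * (ntheta x y t - axis_majorant y a t)"
      unfolding s10 axis_majorant_def K_def[symmetric] using y by (simp add: right_diff_distrib distrib_left)
    ultimately show ?thesis by simp
  qed
  have dT: "(T v has_real_derivative - (C v * sym_slope y v t - i1 v * sym_slope y (1, 0) t + c v * (exp t - exp (- t)))) (at t)" for v t
    unfolding T_def by (rule derivative_eq_intros sym_weight_deriv refl | simp)+
  have nonneg: "0 \<le> C v * sym_slope y v t - i1 v * sym_slope y (1, 0) t + c v * (exp t - exp (- t))" if tt: "t1 \<le> t" "t \<le> t2" for v t
  proof -
    obtain m k where v: "v = (m, k)" by (cases v)
    have "exp t \<le> exp t2" using tt by simp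
    then have t0: "0 \<le> t" "exp t \<le> a" using t tt by linarith+
    define D where "D = exp t - exp (- t)"
    have D0: "0 \<le> D" using t0 by (simp add: D_def)
    have \<kappa>: "K \<le> pi * y * exp (- t)"
      using t0 y a by (simp add: K_def exp_minus field_simps)
    have c0: "0 \<le> c v" using g0 a by (simp add: c_def w_def i_def)
    have cD: "0 \<le> c v * D" using c0 D0 by simp
    have C1: "\<bar>C v\<bar> \<le> 1" by (simp add: C_def)
    have fwb: "fourier_weight y t (p, q) \<le> exp (- K * ((of_int p)\<^sup>2 + (of_int q)\<^sup>2))" for p q
    proof -
      have "K * ((of_int p)\<^sup>2 + (of_int q)\<^sup>2) \<le> pi * y * exp (- t) * ((of_int p)\<^sup>2 + (of_int q)\<^sup>2)"
        by (intro mult_right_mono \<kappa>) auto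
      also have "\<dots> \<le> pi * y * ((of_int p)\<^sup>2 * exp t + (of_int q)\<^sup>2 * exp (- t))"
      proof -
        have "(of_int p)\<^sup>2 * exp (- t) \<le> (of_int p)\<^sup>2 * exp t" using t0 by (intro mult_left_mono) auto
        then have "pi * y * ((of_int p)\<^sup>2 * exp (- t) + (of_int q)\<^sup>2 * exp (- t)) \<le> pi * y * ((of_int p)\<^sup>2 * exp t + (of_int q)\<^sup>2 * exp (- t))"
          using y by (intro mult_left_mono) auto
        then show ?thesis by (simp add: algebra_simps)
      qed
      finally show ?thesis by (simp add: fourier_weight_def)
    qed
    define A where "A = (real_of_int m)\<^sup>2"
    define B where "B = (real_of_int k)\<^sup>2"
    have gb: "\<bar>sym_slope y (m, k) t\<bar> \<le> pi * y / 2 * D * ((2 * (A + B) + pi * y * (exp t + exp (- t)) * (A - B)\<^sup>2) * exp (- K * (A + B)))"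
      unfolding A_def B_def D_def
      by (rule sym_slope_bound_gen[OF y t0(1)]) (use fwb[of m k] fwb[of k m] in \<open>auto simp: add.commute\<close>)
    have fin: ?thesis if "\<bar>sym_slope y (m, k) t\<bar> \<le> c v * D" "i1 v = 0"
    proof -
      have "\<bar>C v * sym_slope y (m, k) t\<bar> \<le> 1 * \<bar>sym_slope y (m, k) t\<bar>" unfolding abs_mult by (intro mult_right_mono C1) auto
      then show ?thesis using that by (simp add: v D_def[symmetric])
    qed
    consider "v \<in> F" | "v = (0, 0)" | "v \<in> F1" | "v \<notin> F" "v \<notin> F1" "2 \<le> \<bar>m\<bar> \<or> 2 \<le> \<bar>k\<bar>"
    proof -
      have "v \<in> F \<or> v = (0, 0) \<or> v \<in> F1 \<or> 2 \<le> \<bar>m\<bar> \<or> 2 \<le> \<bar>k\<bar>"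
      proof (rule ccontr)
        assume n: "\<not> ?thesis"
        then have "\<bar>m\<bar> \<le> 1" "\<bar>k\<bar> \<le> 1" by linarith+
        then have "m \<in> {-1, 0, 1}" "k \<in> {-1, 0, 1}" by auto
        then show False using n by (auto simp: F_def F1_def v)
      qed
      then show ?thesis using that by blast
    qed
    then show ?thesis
    proof cases
      case 1
      then have AB: "A = 1" "B = 1" "i v = 1" "i1 v = 0" by (auto simp: F_def F1_def v A_def B_def i_def i1_def)
      have "2 * exp (- K) \<le> (K - 1) * (3/100)"
      proof -
        have "(141844/5000 :: real) \<le> (1182344/1000000) ^ 20" by (simp add: power_divide)
        also have "\<dots> \<le> exp (real 20 * (67/400))" by (rule exp_ge_power) (simp_all add: power_divide)
        also have "\<dots> \<le> exp K" using K1 by simp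
        finally have "141844/5000 * exp (- K) \<le> exp K * exp (- K)" by (intro mult_right_mono) auto
        then have "141844/5000 * exp (- K) \<le> 1" by (simp add: exp_add[symmetric])
        then show ?thesis using K1 by argo
      qed
      then have "K * (exp (- K) * (2 * exp (- K))) \<le> K * (exp (- K) * ((K - 1) * (3/100)))" using K1 by (intro mult_left_mono) auto
      then have e: "2 * K * exp (- K * 2) \<le> axis_rate K * (3/100)"
        by (simp add: axis_rate_def power2_eq_square exp_add[symmetric] algebra_simps)
      have "\<bar>sym_slope y (m, k) t\<bar> \<le> a * D * (2 * K * exp (- K * 2))" using gb unfolding AB piy by (simp add: mult_ac)
      also have "\<dots> \<le> a * D * (axis_rate K * (3/100))" using e a D0 by (intro mult_left_mono) auto
      also have "\<dots> \<le> c v * D"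
      proof -
        have "a * axis_rate K * (3/100) \<le> c v" unfolding c_def AB(3) using a g0 by (intro mult_left_mono) (auto simp: w_def)
        then have "a * axis_rate K * (3/100) * D \<le> c v * D" using D0 by (intro mult_right_mono)
        then show ?thesis by (simp add: mult_ac)
      qed
      finally show ?thesis using fin AB by blast
    next
      case 2
      then have "sym_slope y v t = 0" "i1 v = 0" by (auto simp: sym_slope_def i1_def F1_def)
      then show ?thesis using cD by (simp add: D_def)
    next
      case 3
      then have "C v = 1" "i1 v = 1" by (auto simp: C_def F1_def i1_def)
      moreover have "sym_slope y v t = sym_slope y (1, 0) t" using 3 by (auto simp: sym_slope_def fourier_weight_def F1_def)
      ultimately show ?thesis using cD by (simp add: D_def)
    next
      case 4
      define n where "n = nat \<bar>m\<bar> + nat \<bar>k\<bar>"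
      have n2: "2 \<le> n" using 4(3) unfolding n_def by linarith
      \<comment> \<open>One coordinate has modulus at least two, where the square exceeds the
        modulus by two.\<close>
      have "int n + 2 \<le> m\<^sup>2 + k\<^sup>2"
      proof -
        have q: "\<bar>j\<bar> \<le> j\<^sup>2" for j :: int
          using int_abs_le_square[of j] by (metis of_int_abs of_int_le_iff of_int_power)
        have q2: "\<bar>j\<bar> + 2 \<le> j\<^sup>2" if "2 \<le> \<bar>j\<bar>" for j :: int
        proof -
          have "2 * \<bar>j\<bar> \<le> \<bar>j\<bar> * \<bar>j\<bar>" using that by (intro mult_right_mono) auto
          then show ?thesis using that by (simp add: power2_eq_square)
        qed
        show ?thesis using q[of m] q[of k] q2[of m] q2[of k] 4(3) unfolding n_def by linarith
      qed
      then have "real_of_int (int n + 2) \<le> real_of_int (m\<^sup>2 + k\<^sup>2)" by (simp only: of_int_le_iff)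
      then have nN: "real n + 2 \<le> A + B" by (simp add: A_def B_def)
      then have N4: "4 \<le> A + B" using n2 by linarith
      have ch: "a * (exp t + exp (- t)) \<le> 61/25"
      proof -
        have "exp t + 1 / exp t \<le> a + 1 / a" using t0 by (intro add_inverse_mono) auto
        then have "a * (exp t + exp (- t)) \<le> a * (a + 1 / a)" using a by (intro mult_left_mono) (auto simp: exp_minus field_simps)
        also have "\<dots> = a * a + 1" using a by (simp add: distrib_left)
        also have "a * a \<le> 6/5 * (6/5)" using a by (intro mult_mono) auto
        finally show ?thesis by simp
      qed
      have "pi * y * (exp t + exp (- t)) * (A - B)\<^sup>2 \<le> K * (61/25) * (A + B)\<^sup>2"
      proof (rule mult_mono)
        have "K * (a * (exp t + exp (- t))) \<le> K * (61/25)" using ch K1 by (intro mult_left_mono) auto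
        then show "pi * y * (exp t + exp (- t)) \<le> K * (61/25)" unfolding piy by (simp add: mult_ac)
        have "0 \<le> A * B" by (simp add: A_def B_def)
        then show "(A - B)\<^sup>2 \<le> (A + B)\<^sup>2" by (simp add: power2_eq_square algebra_simps)
      qed (use K1 in auto)
      then have "(2 * (A + B) + pi * y * (exp t + exp (- t)) * (A - B)\<^sup>2) * exp (- K * (A + B))
         \<le> (2 * (A + B) + K * (61/25) * (A + B)\<^sup>2) * exp (- K * (A + B))" by (intro mult_right_mono) auto
      then have "pi * y / 2 * D * ((2 * (A + B) + pi * y * (exp t + exp (- t)) * (A - B)\<^sup>2) * exp (- K * (A + B)))
         \<le> pi * y / 2 * D * ((2 * (A + B) + K * (61/25) * (A + B)\<^sup>2) * exp (- K * (A + B)))"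
        using D0 y by (intro mult_left_mono) auto
      also have "\<dots> = a * D * (K * ((A + B) + 61/50 * K * (A + B)\<^sup>2) * exp (- K * (A + B)))"
        unfolding piy by (simp add: field_simps)
      also have "\<dots> \<le> a * D * (axis_rate K * (12/1000 * (1/3) ^ n))"
        using slope_tail_bound[OF K1 N4 n2 nN] a D0 by (intro mult_left_mono) auto
      also have "\<dots> = c v * D" using 4 by (simp add: c_def i_def w_def v n_def)
      finally have "\<bar>sym_slope y (m, k) t\<bar> \<le> c v * D" using gb by linarith
      then show ?thesis using fin 4 by (simp add: i1_def)
    qed
  qed
  have "T v t2 \<le> T v t1" for v
  proof (rule DERIV_nonpos_imp_nonincreasing[OF t(2)])
    fix s assume "t1 \<le> s" "s \<le> t2"
    then show "\<exists>D. (T v has_real_derivative D) (at s) \<and> D \<le> 0" using dT nonneg[of s v] by fastforce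
  qed
  then have "2 / sqrt y * (ntheta x y t2 - axis_majorant y a t2) \<le> 2 / sqrt y * (ntheta x y t1 - axis_majorant y a t1)"
    by (intro has_sum_mono[OF S S])
  moreover have "0 < 2 / sqrt y" using y by simp
  ultimately show ?thesis by (simp only: mult_le_cancel_left_pos)
qed

lemma axis_majorant_deriv:
  "(axis_majorant y a has_real_derivative
     2 * sqrt y * (pi * y * exp (- t) * exp (- pi * y * exp (- t)) - pi * y * exp t * exp (- pi * y * exp t))
      + sqrt y / 2 * (a * axis_rate (pi * y / a) * (168/1000)) * (exp t - exp (- t))) (at t)"
proof -
  have "((\<lambda>t. A * (exp (- c * exp t) + exp (- c * exp (- t))) + B * (exp t + exp (- t))) has_real_derivative
      A * (c * exp (- t) * exp (- c * exp (- t)) - c * exp t * exp (- c * exp t)) + B * (exp t - exp (- t))) (at t)" for A B c :: real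
    by (auto intro!: derivative_eq_intros simp: algebra_simps)
  from this[of "2 * sqrt y" "pi * y" "sqrt y / 2 * (a * axis_rate (pi * y / a) * (168/1000))"]
  show ?thesis unfolding axis_majorant_def by simp
qed

text \<open>The derivative vanishes at \<open>t = 0\<close>, and its own derivative is controlled by
  \<open>axis_rate\<close> at the smallest arguments \<open>pi * y / a\<close> and
  \<open>pi * y\<close>; hence a bound linear in \<open>t\<close>.\<close>

lemma axis_majorant_deriv_bound:
  assumes y: "0 < y" and a: "1 \<le> a" "14/5 \<le> pi * y / a" and t: "0 \<le> t" "exp t \<le> a"
  shows "2 * sqrt y * (pi * y * exp (- t) * exp (- pi * y * exp (- t)) - pi * y * exp t * exp (- pi * y * exp t))
      + sqrt y / 2 * (a * axis_rate (pi * y / a) * (168/1000)) * (exp t - exp (- t))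
    \<le> t * (sqrt y * axis_rate (pi * y / a) * (2 + (a\<^sup>2 + 1) / 2 * (168/1000)) + 2 * (sqrt y * axis_rate (pi * y)))"
proof -
  define K where "K = pi * y / a"
  define f where "f s = pi * y * exp (- s) * exp (- pi * y * exp (- s)) - pi * y * exp s * exp (- pi * y * exp s) - s * (axis_rate K + axis_rate (pi * y))" for s
  define h where "h s = exp s - exp (- s) - s * (a + 1 / a)" for s :: real
  have st: "exp s \<le> a" if "s \<le> t" for s using that t(2) by (meson exp_le_cancel_iff order_trans)
  have "f t \<le> f 0"
  proof (rule DERIV_nonpos_imp_nonincreasing[OF t(1)])
    fix s assume s: "0 \<le> s" "s \<le> t"
    have d: "(f has_real_derivative axis_rate (pi * y * exp (- s)) + axis_rate (pi * y * exp s) - (axis_rate K + axis_rate (pi * y))) (at s)"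
      unfolding f_def axis_rate_def by (auto intro!: derivative_eq_intros simp: power2_eq_square algebra_simps)
    have "K \<le> pi * y * exp (- s)" using st[OF s(2)] y a by (simp add: K_def exp_minus field_simps)
    then have "axis_rate (pi * y * exp (- s)) \<le> axis_rate K" using a by (intro axis_rate_antimono) (auto simp: K_def)
    moreover have "axis_rate (pi * y * exp s) \<le> axis_rate (pi * y)"
    proof (rule axis_rate_antimono)
      have "pi * y / a \<le> pi * y / 1" using a y by (intro divide_left_mono) auto
      then show "14/5 \<le> pi * y" using a(2) by linarith
      show "pi * y \<le> pi * y * exp s" using s y by simp
    qed
    ultimately show "\<exists>D. (f has_real_derivative D) (at s) \<and> D \<le> 0" using d by (intro exI conjI) auto
  qed
  then have f: "pi * y * exp (- t) * exp (- pi * y * exp (- t)) - pi * y * exp t * exp (- pi * y * exp t) \<le> t * (axis_rate K + axis_rate (pi * y))"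
    by (simp add: f_def)
  have "h t \<le> h 0"
  proof (rule DERIV_nonpos_imp_nonincreasing[OF t(1)])
    fix s assume s: "0 \<le> s" "s \<le> t"
    have d: "(h has_real_derivative exp s + exp (- s) - (a + 1 / a)) (at s)"
      unfolding h_def by (auto intro!: derivative_eq_intros)
    have "exp s + 1 / exp s \<le> a + 1 / a" using s st by (intro add_inverse_mono) auto
    then show "\<exists>D. (h has_real_derivative D) (at s) \<and> D \<le> 0" using d by (intro exI conjI) (auto simp: exp_minus field_simps)
  qed
  then have h: "exp t - exp (- t) \<le> t * (a + 1 / a)" by (simp add: h_def)
  have "1 < K" using a unfolding K_def by linarith
  then have g0: "0 \<le> axis_rate K" by (intro less_imp_le axis_rate_pos)
  have "2 * sqrt y * (pi * y * exp (- t) * exp (- pi * y * exp (- t)) - pi * y * exp t * exp (- pi * y * exp t))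
      + sqrt y / 2 * (a * axis_rate K * (168/1000)) * (exp t - exp (- t))
    \<le> 2 * sqrt y * (t * (axis_rate K + axis_rate (pi * y))) + sqrt y / 2 * (a * axis_rate K * (168/1000)) * (t * (a + 1 / a))"
    using y a g0 by (intro add_mono mult_left_mono f h) auto
  also have "\<dots> = t * (sqrt y * axis_rate K * (2 + (a * (a + 1 / a)) / 2 * (168/1000)) + 2 * (sqrt y * axis_rate (pi * y)))"
    by (simp add: algebra_simps)
  also have "a * (a + 1 / a) = a\<^sup>2 + 1" using a by (simp add: distrib_left power2_eq_square)
  finally show ?thesis unfolding K_def .
qed

text \<open>Minus the \<open>t\<close>-derivative of \<open>expw p1\<close> along
  \<open>s = C * exp t\<close>; also the slope constant of the tangent inequality.\<close>

definition shell_rate :: "real \<Rightarrow> real" where "shell_rate s = s * (s - 3/2) * exp (- s)"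

lemma expw_p1_deriv: "(expw p1 has_real_derivative - ((s - 3/2) * exp (- s))) (at s)"
  unfolding p1_def by (auto intro!: derivative_eq_intros simp: algebra_simps)

lemma expw_p1_antimono:
  assumes "3/2 \<le> s" "s \<le> s'"
  shows "expw p1 s' \<le> expw p1 s"
proof (rule DERIV_nonpos_imp_nonincreasing[OF assms(2)])
  fix z assume "s \<le> z" "z \<le> s'"
  then show "\<exists>D. (expw p1 has_real_derivative D) (at z) \<and> D \<le> 0"
    using expw_p1_deriv[of z] assms by (intro exI conjI) auto
qed

text \<open>\<open>latsum\<close> vanishes at \<open>t = 0\<close>, so its negative is a sum of
  decrements from \<open>0\<close> to \<open>t\<close>. Beyond \<open>s = 3/2\<close> the function
  \<open>expw p1\<close> decreases, no decrement is negative, and the six of the first shell are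
  kept.\<close>

lemma rho_latsum_shell:
  assumes t: "0 \<le> t"
  shows "6 * (expw p1 (pi / rho_im) - expw p1 (exp t * (pi / rho_im))) \<le> - latsum (1/2) rho_im p1 t"
proof -
  define F where "F = ({(1, 0), (- 1, 0), (0, 1), (0, - 1), (1, - 1), (- 1, 1)} :: (int \<times> int) set)"
  define D where "D = expw p1 (pi / rho_im) - expw p1 (exp t * (pi / rho_im))"
  have h: "((\<lambda>v. expw p1 (exp 0 * qform (1/2) rho_im v) - expw p1 (exp t * qform (1/2) rho_im v)) has_sum
     latsum (1/2) rho_im p1 0 - latsum (1/2) rho_im p1 t) UNIV"
    by (intro has_sum_diff_real latsum_cubic_eq(1)[OF rho_im(1) p1_cubic])
  have s: "((\<lambda>v. if v \<in> F then D else 0) has_sum 6 * D) UNIV"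
    using has_sum_if_finite[of F D] by (simp add: F_def)
  have "6 * D \<le> latsum (1/2) rho_im p1 0 - latsum (1/2) rho_im p1 t"
  proof (rule has_sum_mono[OF s h])
    fix v
    show "(if v \<in> F then D else 0) \<le> expw p1 (exp 0 * qform (1/2) rho_im v) - expw p1 (exp t * qform (1/2) rho_im v)"
    proof (cases "v \<in> F")
      case True
      then have "eis_norm v = 1" by (auto simp: F_def eis_norm_def)
      then have "qform (1/2) rho_im v = pi / rho_im" by (simp add: qform_rho)
      then show ?thesis using True by (simp add: D_def)
    next
      case False
      show ?thesis
      proof (cases "v = (0, 0)")
        case True then show ?thesis using False by (simp add: qform_def)
      next
        case v: False
        have "(1::real) \<le> of_int (eis_norm v)" using eis_norm_pos[OF v] by simp
        then have "pi / rho_im * 1 \<le> pi / rho_im * of_int (eis_norm v)" using rho_im(1) by (intro mult_left_mono) auto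
        then have "3/2 \<le> pi / rho_im * of_int (eis_norm v)" using pi_div_rho_im by linarith
        then have l: "3/2 \<le> qform (1/2) rho_im v" by (simp add: qform_rho)
        then have "1 * qform (1/2) rho_im v \<le> exp t * qform (1/2) rho_im v" using t by (intro mult_right_mono) auto
        then have "expw p1 (exp t * qform (1/2) rho_im v) \<le> expw p1 (qform (1/2) rho_im v)" using l by (intro expw_p1_antimono) auto
        then show ?thesis using False by simp
      qed
    qed
  qed
  then show ?thesis by (simp add: D_def latsum_zero[OF rho_im(1)])
qed

lemma rho_latsum_nonpos:
  assumes "0 \<le> t"
  shows "latsum (1/2) rho_im p1 t \<le> 0"
proof -
  have "1 * (pi / rho_im) \<le> exp t * (pi / rho_im)" using assms rho_im(1) by (intro mult_right_mono) auto
  then have "expw p1 (exp t * (pi / rho_im)) \<le> expw p1 (pi / rho_im)" using pi_div_rho_im by (intro expw_p1_antimono) linarith+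
  then show ?thesis using rho_latsum_shell[OF assms] by simp
qed

text \<open>A lower bound linear in \<open>t\<close>, to be set against the linear upper bound for
  the majorant. Both \<open>shell_rate (s0 * exp t)\<close> and its product with
  \<open>exp (t / 2)\<close> decrease in \<open>t\<close>, so the worst value is at
  \<open>exp t = a\<close>.\<close>

lemma rho_growth:
  assumes t: "0 \<le> t" "exp t \<le> a"
  shows "6 * t * (sqrt a * shell_rate (a * (pi / rho_im))) \<le> - (exp (t/2) * latsum (1/2) rho_im p1 t)"
proof -
  define s0 where "s0 = pi / rho_im"
  have s0: "3627/1000 < s0" using pi_div_rho_im by (simp add: s0_def)
  have s0e: "s0 \<le> s0 * exp z" if "0 \<le> z" for z using that s0 by simp
  have hd: "(shell_rate has_real_derivative (- s\<^sup>2 + 7/2 * s - 3/2) * exp (- s)) (at s)" for s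
    unfolding shell_rate_def by (auto intro!: derivative_eq_intros simp: power2_eq_square field_simps)
  have hdt: "((\<lambda>z. shell_rate (s0 * exp z)) has_real_derivative (- (s0 * exp z)\<^sup>2 + 7/2 * (s0 * exp z) - 3/2) * exp (- (s0 * exp z)) * (s0 * exp z)) (at z)" for z
    by (rule DERIV_chain2[OF hd]) (auto intro!: derivative_eq_intros)
  \<comment> \<open>The larger root of this polynomial is \<open>2 + sqrt 7 / 2\<close>, below
    \<open>s0\<close>.\<close>
  have q: "- s\<^sup>2 + 4 * s - 9/4 \<le> 0" if "s0 \<le> s" for s
  proof -
    have "0 \<le> (s - 33/10) * (s - 7/10)" using that s0 by (intro mult_nonneg_nonneg) auto
    also have "\<dots> = s\<^sup>2 - 4 * s + 231/100" by (simp add: power2_eq_square field_simps)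
    finally have "0 \<le> s\<^sup>2 - 4 * s + 231/100" .
    moreover have "0 \<le> (s - 36/10) * (s - 4/10)" using that s0 by (intro mult_nonneg_nonneg) auto
    then have "0 \<le> s\<^sup>2 - 4 * s + 144/100" by (simp add: power2_eq_square field_simps)
    ultimately show ?thesis by linarith
  qed
  have hmono: "shell_rate (s0 * exp t) \<le> shell_rate (s0 * exp z)" if z: "0 \<le> z" "z \<le> t" for z
  proof (rule DERIV_nonpos_imp_nonincreasing[OF z(2)])
    fix w assume w: "z \<le> w" "w \<le> t"
    define s where "s = s0 * exp w"
    have s: "s0 \<le> s" using s0e[of w] w z by (simp add: s_def)
    have "- s\<^sup>2 + 7/2 * s - 3/2 \<le> 0" using q[OF s] s s0 by simp
    then have "(- s\<^sup>2 + 7/2 * s - 3/2) * exp (- s) * s \<le> 0" using s s0 by (intro mult_nonpos_nonneg) auto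
    then show "\<exists>D. ((\<lambda>z. shell_rate (s0 * exp z)) has_real_derivative D) (at w) \<and> D \<le> 0" using hdt[of w] unfolding s_def by blast
  qed
  have d1: "((\<lambda>z. expw p1 (s0 * exp z) + z * shell_rate (s0 * exp t)) has_real_derivative - shell_rate (s0 * exp z) + shell_rate (s0 * exp t)) (at z)" for z
  proof -
    have "((\<lambda>z. expw p1 (s0 * exp z)) has_real_derivative - ((s0 * exp z - 3/2) * exp (- (s0 * exp z))) * (s0 * exp z)) (at z)"
      by (rule DERIV_chain2[OF expw_p1_deriv]) (auto intro!: derivative_eq_intros)
    from DERIV_add[OF this DERIV_mult[OF DERIV_ident DERIV_const[of "shell_rate (s0 * exp t)"]]]
    show ?thesis by (rule DERIV_cong) (simp add: shell_rate_def)
  qed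
  have "expw p1 (s0 * exp t) + t * shell_rate (s0 * exp t) \<le> expw p1 (s0 * exp 0) + 0 * shell_rate (s0 * exp t)"
  proof (rule DERIV_nonpos_imp_nonincreasing[OF t(1)])
    fix z assume "0 \<le> z" "z \<le> t"
    then have "- shell_rate (s0 * exp z) + shell_rate (s0 * exp t) \<le> 0" using hmono by simp
    then show "\<exists>D. ((\<lambda>z. expw p1 (s0 * exp z) + z * shell_rate (s0 * exp t)) has_real_derivative D) (at z) \<and> D \<le> 0" using d1 by blast
  qed
  then have "t * shell_rate (s0 * exp t) \<le> expw p1 s0 - expw p1 (exp t * s0)" by (simp add: mult.commute)
  then have 1: "6 * t * shell_rate (s0 * exp t) \<le> - latsum (1/2) rho_im p1 t" using rho_latsum_shell[OF t(1)] by (simp add: s0_def)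
  have a: "1 \<le> a" using t by (meson one_le_exp_iff order_trans)
  define b where "b = ln a"
  have b: "t \<le> b" "exp b = a" "exp (b / 2) = sqrt a"
    using a t by (auto simp: b_def ln_ge_iff powr_half_sqrt[symmetric] powr_def)
  have "exp (b / 2) * shell_rate (s0 * exp b) \<le> exp (t / 2) * shell_rate (s0 * exp t)"
  proof (rule DERIV_nonpos_imp_nonincreasing[OF b(1)])
    fix z assume z: "t \<le> z" "z \<le> b"
    define s where "s = s0 * exp z"
    have s: "s0 \<le> s" using s0e[of z] z t by (simp add: s_def)
    have "((\<lambda>z. exp (z / 2) * shell_rate (s0 * exp z)) has_real_derivative exp (z / 2) * s * exp (- s) * (- s\<^sup>2 + 4 * s - 9/4)) (at z)"
      by (rule DERIV_cong[OF DERIV_mult[OF _ hdt]])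
        (auto intro!: derivative_eq_intros simp: s_def[symmetric] shell_rate_def power2_eq_square algebra_simps)
    moreover have "exp (z / 2) * s * exp (- s) * (- s\<^sup>2 + 4 * s - 9/4) \<le> 0"
      using q[OF s] s s0 by (intro mult_nonneg_nonpos) auto
    ultimately show "\<exists>D. ((\<lambda>z. exp (z / 2) * shell_rate (s0 * exp z)) has_real_derivative D) (at z) \<and> D \<le> 0" by blast
  qed
  then have 2: "sqrt a * shell_rate (a * s0) \<le> exp (t / 2) * shell_rate (s0 * exp t)" by (simp add: b mult.commute)
  have "6 * t * (sqrt a * shell_rate (a * s0)) \<le> 6 * t * (exp (t / 2) * shell_rate (s0 * exp t))" using 2 t by (intro mult_left_mono) auto
  also have "\<dots> = exp (t / 2) * (6 * t * shell_rate (s0 * exp t))" by simp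
  also have "\<dots> \<le> exp (t / 2) * (- latsum (1/2) rho_im p1 t)" by (intro mult_left_mono 1) auto
  finally show ?thesis by (simp add: s0_def)
qed

text \<open>Both derivatives are bounded linearly in \<open>t\<close>, so the claim for the whole
  range \<open>exp t \<le> a\<close>, including the neighbourhood of \<open>t = 0\<close>, reduces
  to one inequality between coefficients.\<close>

lemma ntheta_diff_decreasing_high:
  fixes x y a t1 t2 :: real
  assumes y: "0 < y" and a: "1 \<le> a" "a \<le> 6/5" and K: "67/20 \<le> pi * y / a"
    and num: "sqrt y * axis_rate (pi * y / a) * (2 + (a\<^sup>2 + 1) / 2 * (168/1000)) + 2 * (sqrt y * axis_rate (pi * y))
      < 6 * (sqrt a * shell_rate (a * (pi / rho_im)))"
    and t: "0 \<le> t1" "t1 < t2" "exp t2 \<le> a"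
  shows "ntheta x y t2 - ntheta (1/2) rho_im t2 < ntheta x y t1 - ntheta (1/2) rho_im t1"
proof -
  have "axis_majorant y a t2 - ntheta (1/2) rho_im t2 < axis_majorant y a t1 - ntheta (1/2) rho_im t1"
  proof (rule DERIV_neg_imp_decreasing_open[OF t(2)])
    fix s assume s: "t1 < s" "s < t2"
    then have se: "0 < s" "exp s \<le> a"
      using t by (auto intro: order_trans[of "exp s" "exp t2"])
    let ?P = "2 * sqrt y * (pi * y * exp (- s) * exp (- pi * y * exp (- s)) - pi * y * exp s * exp (- pi * y * exp s))
      + sqrt y / 2 * (a * axis_rate (pi * y / a) * (168/1000)) * (exp s - exp (- s))"
    have d: "((\<lambda>t. axis_majorant y a t - ntheta (1/2) rho_im t) has_real_derivative ?P - - exp (s/2) * latsum (1/2) rho_im p1 s) (at s)"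
      by (rule DERIV_diff[OF axis_majorant_deriv ntheta_deriv(1)[OF rho_im(1)]])
    have "?P \<le> s * (sqrt y * axis_rate (pi * y / a) * (2 + (a\<^sup>2 + 1) / 2 * (168/1000)) + 2 * (sqrt y * axis_rate (pi * y)))"
    proof (rule axis_majorant_deriv_bound)
      show "14/5 \<le> pi * y / a" using K by linarith
    qed (use y a se in auto)
    also have "\<dots> < s * (6 * (sqrt a * shell_rate (a * (pi / rho_im))))" using num se by (intro mult_strict_left_mono) auto
    also have "\<dots> \<le> - (exp (s/2) * latsum (1/2) rho_im p1 s)" using rho_growth[of s a] se by simp
    finally show "\<exists>D. ((\<lambda>t. axis_majorant y a t - ntheta (1/2) rho_im t) has_real_derivative D) (at s) \<and> D < 0"
      using d by (intro exI conjI) auto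
  next
    show "continuous_on {t1..t2} (\<lambda>t. axis_majorant y a t - ntheta (1/2) rho_im t)"
      by (intro continuous_on_diff continuous_at_imp_continuous_on ballI)
        (use axis_majorant_deriv ntheta_deriv(1)[OF rho_im(1)] DERIV_isCont in blast)+
  qed
  then show ?thesis using ntheta_minus_majorant_antimono[OF y a K t(1) less_imp_le[OF t(2)] t(3), of x] by linarith
qed

section \<open>Numerical verification of the two coefficient inequalities\<close>

lemma axis_rate_upper:
  assumes "1 < x" "0 < c" "c \<le> exp x"
  shows "axis_rate x \<le> (x\<^sup>2 - x) / c"
proof -
  have "exp (- x) \<le> 1 / c" using assms by (simp add: exp_minus field_simps)
  then have "(x\<^sup>2 - x) * exp (- x) \<le> (x\<^sup>2 - x) * (1 / c)" using assms by (intro mult_left_mono) (auto simp: power2_eq_square)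
  then show ?thesis by (simp add: axis_rate_def)
qed

lemma shell_rate_lower:
  assumes s: "3 \<le> s" "s \<le> z" and c: "exp z \<le> c"
  shows "z * (z - 3/2) / c \<le> shell_rate s"
proof -
  have "shell_rate z \<le> shell_rate s"
  proof (rule DERIV_nonpos_imp_nonincreasing[OF s(2)])
    fix w assume w: "s \<le> w" "w \<le> z"
    have "(shell_rate has_real_derivative - ((w - 3) * (w - 1/2)) * exp (- w)) (at w)"
      unfolding shell_rate_def by (auto intro!: derivative_eq_intros simp: field_simps)
    moreover have "- ((w - 3) * (w - 1/2)) * exp (- w) \<le> 0" using w s by simp
    ultimately show "\<exists>D. (shell_rate has_real_derivative D) (at w) \<and> D \<le> 0" by blast
  qed
  moreover have "z * (z - 3/2) * (1 / c) \<le> z * (z - 3/2) * exp (- z)"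
  proof (rule mult_left_mono)
    have "0 < c" using c exp_gt_zero less_le_trans by blast
    then show "1 / c \<le> exp (- z)" using c by (simp add: exp_minus field_simps)
  qed (use s in auto)
  ultimately show ?thesis by (simp add: shell_rate_def)
qed

lemma high_constants_1:
  assumes "112/100 \<le> y"
  shows "67/20 \<le> pi * y / (105/100)"
    and "sqrt y * axis_rate (pi * y / (105/100)) * (2 + ((105/100)\<^sup>2 + 1) / 2 * (168/1000)) + 2 * (sqrt y * axis_rate (pi * y))
      < 6 * (sqrt (105/100) * shell_rate (105/100 * (pi / rho_im)))"
proof -
  have py: "31415/10000 * (112/100) \<le> pi * y" using assms pi_approx by (intro mult_mono) auto
  then show "67/20 \<le> pi * y / (105/100)" by simp
  have sq: "sqrt (112/100) \<le> 10584/10000" by (rule real_le_lsqrt) (auto simp: power2_eq_square)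
  \<comment> \<open>\<open>3351/1000\<close> and, below, \<open>3518/1000\<close> are lower bounds
    for \<open>pi * y / a\<close> and \<open>pi * y\<close> at the lowest point
    \<open>y = 112/100\<close>.\<close>
  have g1: "axis_rate (3351/1000) \<le> 7878201/1000000 / (2852/100)"
  proof -
    have "(2852/100 :: real) \<le> (1182403/1000000) ^ 20" by (simp add: power_divide)
    also have "\<dots> \<le> exp (real 20 * (3351/20000))" by (rule exp_ge_power) (simp_all add: power_divide)
    finally have "(2852/100 :: real) \<le> exp (3351/1000)" by simp
    from axis_rate_upper[OF _ _ this] show ?thesis by (simp add: power2_eq_square)
  qed
  have g2: "axis_rate (3518/1000) \<le> 8858324/1000000 / (337/10)"
  proof -
    have "(337/10 :: real) \<le> (1192317/1000000) ^ 20" by (simp add: power_divide)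
    also have "\<dots> \<le> exp (real 20 * (1759/10000))" by (rule exp_ge_power) (simp_all add: power_divide)
    finally have "(337/10 :: real) \<le> exp (3518/1000)" by simp
    from axis_rate_upper[OF _ _ this] show ?thesis by (simp add: power2_eq_square)
  qed
  have a1: "sqrt y * axis_rate (pi / (105/100) * y) \<le> sqrt (112/100) * axis_rate (pi / (105/100) * (112/100))"
    using assms pi_approx by (intro sqrt_axis_rate_antimono) auto
  have "axis_rate (pi / (105/100) * (112/100)) \<le> axis_rate (3351/1000)" using pi_approx by (intro axis_rate_antimono) auto
  then have a2: "sqrt (112/100) * axis_rate (pi / (105/100) * (112/100)) \<le> 10584/10000 * (7878201/1000000 / (2852/100))"
    using g1 sq pi_approx by (intro mult_mono less_imp_le[OF axis_rate_pos]) auto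
  have A: "sqrt y * axis_rate (pi * y / (105/100)) \<le> 10584/10000 * (7878201/1000000 / (2852/100))"
  proof -
    have "pi * y / c = pi / c * y" for c :: real by simp
    then show ?thesis using order_trans[OF a1 a2] by (simp only:)
  qed
  have b1: "sqrt y * axis_rate (pi * y) \<le> sqrt (112/100) * axis_rate (pi * (112/100))"
    using assms pi_approx by (intro sqrt_axis_rate_antimono) auto
  have "axis_rate (pi * (112/100)) \<le> axis_rate (3518/1000)" using pi_approx by (intro axis_rate_antimono) auto
  then have "sqrt (112/100) * axis_rate (pi * (112/100)) \<le> 10584/10000 * (8858324/1000000 / (337/10))"
    using g2 sq pi_approx by (intro mult_mono less_imp_le[OF axis_rate_pos]) auto
  then have B: "sqrt y * axis_rate (pi * y) \<le> 10584/10000 * (8858324/1000000 / (337/10))" using b1 by linarith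
  have "exp (38092/10000 :: real) \<le> 4513/100"
  proof -
    have "exp (real 20 * (19046/100000)) \<le> (1209810/1000000) ^ 20"
      by (rule exp_le_power) (simp_all add: power_divide)
    also have "\<dots> \<le> (4513/100 :: real)" by (simp add: power_divide)
    finally show ?thesis by simp
  qed
  then have h: "38092/10000 * (38092/10000 - 3/2) / (4513/100) \<le> shell_rate (105/100 * (pi / rho_im))"
  proof (intro shell_rate_lower)
    show "3 \<le> 105/100 * (pi / rho_im)" "105/100 * (pi / rho_im) \<le> 38092/10000" using pi_div_rho_im by linarith+
  qed auto
  have s: "10246/10000 \<le> sqrt (105/100)" by (rule real_le_rsqrt) (auto simp: power2_eq_square)
  have "10246/10000 * (38092/10000 * (38092/10000 - 3/2) / (4513/100)) \<le> sqrt (105/100) * shell_rate (105/100 * (pi / rho_im))"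
    by (intro mult_mono s h) auto
  moreover have "sqrt y * axis_rate (pi * y / (105/100)) * (2 + ((105/100)\<^sup>2 + 1) / 2 * (168/1000)) \<le>
     10584/10000 * (7878201/1000000 / (2852/100)) * (2 + ((105/100)\<^sup>2 + 1) / 2 * (168/1000))"
    by (intro mult_right_mono A) auto
  ultimately show "sqrt y * axis_rate (pi * y / (105/100)) * (2 + ((105/100)\<^sup>2 + 1) / 2 * (168/1000)) + 2 * (sqrt y * axis_rate (pi * y))
      < 6 * (sqrt (105/100) * shell_rate (105/100 * (pi / rho_im)))"
    using B by (simp add: power2_eq_square)
qed

lemma high_constants_2:
  assumes "3/2 \<le> y"
  shows "67/20 \<le> pi * y / (6/5)"
    and "sqrt y * axis_rate (pi * y / (6/5)) * (2 + ((6/5)\<^sup>2 + 1) / 2 * (168/1000)) + 2 * (sqrt y * axis_rate (pi * y))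
      < 6 * (sqrt (6/5) * shell_rate (6/5 * (pi / rho_im)))"
proof -
  have py: "31415/10000 * (3/2) \<le> pi * y" using assms pi_approx by (intro mult_mono) auto
  then show "67/20 \<le> pi * y / (6/5)" by simp
  have sq: "sqrt (3/2) \<le> 12248/10000" by (rule real_le_lsqrt) (auto simp: power2_eq_square)
  have g1: "axis_rate (3926/1000) \<le> 11487476/1000000 / (506/10)"
  proof -
    have "(506/10 :: real) \<le> (1216889/1000000) ^ 20" by (simp add: power_divide)
    also have "\<dots> \<le> exp (real 20 * (1963/10000))" by (rule exp_ge_power) (simp_all add: power_divide)
    finally have "(506/10 :: real) \<le> exp (3926/1000)" by simp
    from axis_rate_upper[OF _ _ this] show ?thesis by (simp add: power2_eq_square)
  qed
  have g2: "axis_rate (4712/1000) \<le> 17490944/1000000 / 111"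
  proof -
    have "(111 :: real) \<le> (1265661/1000000) ^ 20" by (simp add: power_divide)
    also have "\<dots> \<le> exp (real 20 * (589/2500))" by (rule exp_ge_power) (simp_all add: power_divide)
    finally have "(111 :: real) \<le> exp (4712/1000)" by simp
    from axis_rate_upper[OF _ _ this] show ?thesis by (simp add: power2_eq_square)
  qed
  have a1: "sqrt y * axis_rate (pi / (6/5) * y) \<le> sqrt (3/2) * axis_rate (pi / (6/5) * (3/2))"
    using assms pi_approx by (intro sqrt_axis_rate_antimono) auto
  have "axis_rate (pi / (6/5) * (3/2)) \<le> axis_rate (3926/1000)" using pi_approx by (intro axis_rate_antimono) auto
  then have a2: "sqrt (3/2) * axis_rate (pi / (6/5) * (3/2)) \<le> 12248/10000 * (11487476/1000000 / (506/10))"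
    using g1 sq pi_approx by (intro mult_mono less_imp_le[OF axis_rate_pos]) auto
  have A: "sqrt y * axis_rate (pi * y / (6/5)) \<le> 12248/10000 * (11487476/1000000 / (506/10))"
  proof -
    have "pi * y / c = pi / c * y" for c :: real by simp
    then show ?thesis using order_trans[OF a1 a2] by (simp only:)
  qed
  have b1: "sqrt y * axis_rate (pi * y) \<le> sqrt (3/2) * axis_rate (pi * (3/2))"
    using assms pi_approx by (intro sqrt_axis_rate_antimono) auto
  have "axis_rate (pi * (3/2)) \<le> axis_rate (4712/1000)" using pi_approx by (intro axis_rate_antimono) auto
  then have "sqrt (3/2) * axis_rate (pi * (3/2)) \<le> 12248/10000 * (17490944/1000000 / 111)"
    using g2 sq pi_approx by (intro mult_mono less_imp_le[OF axis_rate_pos]) auto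
  then have B: "sqrt y * axis_rate (pi * y) \<le> 12248/10000 * (17490944/1000000 / 111)" using b1 by linarith
  have "exp (43534/10000 :: real) \<le> 78"
  proof -
    have "exp (real 20 * (21767/100000)) \<le> (1243184/1000000) ^ 20"
      by (rule exp_le_power) (simp_all add: power_divide)
    also have "\<dots> \<le> (78 :: real)" by (simp add: power_divide)
    finally show ?thesis by simp
  qed
  then have h: "43534/10000 * (43534/10000 - 3/2) / 78 \<le> shell_rate (6/5 * (pi / rho_im))"
  proof (intro shell_rate_lower)
    show "3 \<le> 6/5 * (pi / rho_im)" "6/5 * (pi / rho_im) \<le> 43534/10000" using pi_div_rho_im by linarith+
  qed auto
  have s: "10954/10000 \<le> sqrt (6/5)" by (rule real_le_rsqrt) (auto simp: power2_eq_square)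
  have "10954/10000 * (43534/10000 * (43534/10000 - 3/2) / 78) \<le> sqrt (6/5) * shell_rate (6/5 * (pi / rho_im))"
    by (intro mult_mono s h) auto
  moreover have "sqrt y * axis_rate (pi * y / (6/5)) * (2 + ((6/5)\<^sup>2 + 1) / 2 * (168/1000)) \<le>
     12248/10000 * (11487476/1000000 / (506/10)) * (2 + ((6/5)\<^sup>2 + 1) / 2 * (168/1000))"
    by (intro mult_right_mono A) auto
  ultimately show "sqrt y * axis_rate (pi * y / (6/5)) * (2 + ((6/5)\<^sup>2 + 1) / 2 * (168/1000)) + 2 * (sqrt y * axis_rate (pi * y))
      < 6 * (sqrt (6/5) * shell_rate (6/5 * (pi / rho_im)))"
    using B by (simp add: power2_eq_square)
qed

section \<open>High points and large parameters\<close>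

text \<open>Beyond the first shell each term is at most \<open>l = exp (s0 - s)\<close> times its
  value at \<open>t = 0\<close>. Since the whole sum vanishes at \<open>t = 0\<close>, the tail
  there is known exactly as \<open>1/2 - 6 * expw p1 s0\<close>, and no further shell has to be
  estimated.\<close>

lemma rho_latsum_upper:
  assumes t: "0 \<le> t"
  defines "s \<equiv> exp t * (pi / rho_im)"
  shows "latsum (1/2) rho_im p1 t \<le> - (1/2) + (6 * (s - 1/2) + 6/100) * exp (- s)"
proof -
  define F where "F = ({(1, 0), (- 1, 0), (0, 1), (0, - 1), (1, - 1), (- 1, 1)} :: (int \<times> int) set)"
  define s0 where "s0 = pi / rho_im"
  define l where "l = exp (s0 - s)"
  have s0: "3627/1000 < s0" "s0 < 36277/10000" using pi_div_rho_im by (simp_all add: s0_def)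
  have h: "((\<lambda>v. expw p1 (exp t * qform (1/2) rho_im v) - l * expw p1 (exp 0 * qform (1/2) rho_im v)) has_sum
     latsum (1/2) rho_im p1 t - l * latsum (1/2) rho_im p1 0) UNIV"
    by (intro has_sum_diff_real has_sum_cmult_right latsum_cubic_eq(1)[OF rho_im(1) p1_cubic])
  have b: "((\<lambda>v. (if v \<in> {(0, 0)} then - (1/2) + l / 2 else 0) + (if v \<in> F then expw p1 s - l * expw p1 s0 else 0)) has_sum
     real (card {(0 :: int, 0 :: int)}) * (- (1/2) + l / 2) + real (card F) * (expw p1 s - l * expw p1 s0)) UNIV"
    by (intro has_sum_add has_sum_if_finite) (auto simp: F_def)
  have "latsum (1/2) rho_im p1 t - l * latsum (1/2) rho_im p1 0 \<le> real (card {(0 :: int, 0 :: int)}) * (- (1/2) + l / 2) + real (card F) * (expw p1 s - l * expw p1 s0)"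
  proof (rule has_sum_mono[OF h b])
    fix v
    show "expw p1 (exp t * qform (1/2) rho_im v) - l * expw p1 (exp 0 * qform (1/2) rho_im v) \<le> (if v \<in> {(0, 0)} then - (1/2)
        + l / 2 else 0) + (if v \<in> F then expw p1 s - l * expw p1 s0 else 0)"
    proof -
      consider "v = (0, 0)" | "v \<in> F" | "v \<noteq> (0, 0)" "v \<notin> F" by blast
      then show ?thesis
      proof cases
        case 1 then show ?thesis by (simp add: F_def qform_def p1_def)
      next
        case 2
        then have "eis_norm v = 1" "v \<noteq> (0, 0)" by (auto simp: F_def eis_norm_def)
        then have "qform (1/2) rho_im v = s0" by (simp add: qform_rho s0_def)
        then show ?thesis using 2 \<open>v \<noteq> (0, 0)\<close> by (simp add: s_def s0_def)
      next
        case 3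
        define L where "L = qform (1/2) rho_im v"
        define e where "e = exp t - 1"
        have e: "0 \<le> e" "exp t = 1 + e" using t by (auto simp: e_def)
        have L: "3 * s0 \<le> L" using far_shell[of v 0] 3 by (simp add: F_def L_def s0_def)
        have "p1 (exp t * L) \<le> p1 L * (1 + 2 * e)"
        proof -
          have "0 \<le> e * (L - 1)" using e L s0 by (intro mult_nonneg_nonneg) auto
          then show ?thesis unfolding e(2) p1_def by (simp add: algebra_simps)
        qed
        also have "\<dots> \<le> p1 L * exp (2 * e)" using L s0 by (intro mult_left_mono exp_ge_add_one_self) (auto simp: p1_def)
        finally have "expw p1 (exp t * L) \<le> p1 L * exp (2 * e) * exp (- (exp t * L))" by (intro mult_right_mono) auto
        also have "\<dots> = p1 L * exp (- L + e * (2 - L))" unfolding e(2) by (simp add: exp_add[symmetric] mult.assoc algebra_simps)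
        also have "\<dots> \<le> p1 L * exp (- L + (s0 - s))"
        proof -
          have "e * (2 - L) \<le> e * (- s0)" using e L s0 by (intro mult_left_mono) auto
          also have "\<dots> = s0 - s" by (simp add: s_def s0_def[symmetric] e_def algebra_simps)
          finally show ?thesis using L s0 by (intro mult_left_mono) (auto simp: p1_def)
        qed
        also have "\<dots> = l * expw p1 L" unfolding exp_add l_def by simp
        finally show ?thesis using 3 by (simp add: L_def)
      qed
    qed
  qed
  then have "latsum (1/2) rho_im p1 t \<le> - (1/2) + 6 * expw p1 s + l * (1/2 - 6 * expw p1 s0)"
    by (simp add: latsum_zero[OF rho_im(1)] F_def algebra_simps)
  also have "l * (1/2 - 6 * expw p1 s0) = exp (- s) * (exp s0 / 2 - 6 * (s0 - 1/2))"
  proof -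
    have "l = exp s0 * exp (- s)" by (simp add: l_def exp_add[symmetric])
    moreover have "exp s0 * expw p1 s0 = s0 - 1/2" by (simp add: p1_def mult.left_commute exp_add[symmetric])
    moreover have "E * x * (1/2 - 6 * M) = x * (E / 2 - 6 * (E * M))" for E x M :: real
      by (simp add: algebra_simps)
    ultimately show ?thesis by (simp only:)
  qed
  also have "\<dots> \<le> exp (- s) * (6/100)"
  proof -
    have "exp s0 \<le> exp (real 20 * (181385/1000000))" using s0 by simp
    also have "\<dots> \<le> (1198880/1000000) ^ 20"
      by (rule exp_le_power) (simp_all add: power_divide)
    also have "\<dots> \<le> (3764/100 :: real)" by (simp add: power_divide)
    finally show ?thesis using s0 by (intro mult_left_mono) auto
  qed
  finally show ?thesis by (simp add: p1_def[of s] algebra_simps)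
qed

section \<open>Lower bounds for the lattice sum at high points\<close>

lemma expw_p1_nonneg: "1/2 \<le> s \<Longrightarrow> 0 \<le> expw p1 s"
  by (simp add: p1_def)

lemma scaled_qform_ge_half:
  assumes "1 \<le> y" "0 \<le> t" "m \<noteq> 0"
  shows "1/2 \<le> exp t * qform x y (m, n)"
proof -
  have m: "1 \<le> (real_of_int m)\<^sup>2" using assms(3) int_abs_le_square[of m] by linarith
  have "pi * ((real_of_int m)\<^sup>2 * y\<^sup>2) / y \<le> qform x y (m, n)"
    unfolding qform_def using assms by (intro divide_right_mono mult_left_mono) (auto simp: power_mult_distrib)
  moreover have "pi * ((real_of_int m)\<^sup>2 * y\<^sup>2) / y = pi * ((real_of_int m)\<^sup>2 * y)" using assms by (simp add: power2_eq_square)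
  moreover have "3 * (1 * 1) \<le> pi * ((real_of_int m)\<^sup>2 * y)" using m assms pi_gt3 by (intro mult_mono) auto
  ultimately have l: "3 \<le> qform x y (m, n)" by linarith
  have "1 * 3 \<le> exp t * qform x y (m, n)" using l assms by (intro mult_mono) auto
  then show ?thesis by simp
qed

text \<open>The zero vector contributes \<open>- (1/2)\<close>; all other terms are nonnegative
  since their scaled norms are at least \<open>1/2\<close>, and \<open>(0, 1)\<close>,
  \<open>(0, - 1)\<close> are kept.\<close>

lemma latsum_p1_lower_first:
  assumes y: "1 \<le> y" and t: "0 \<le> t" and s: "1/2 \<le> exp t * (pi / y)"
  shows "- (1/2) + 2 * expw p1 (exp t * (pi / y)) \<le> latsum x y p1 t"
proof -
  have y0: "0 < y" using y by simp
  define S where "S = exp t * (pi / y)"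
  define F where "F = ({(0, 0), (0, 1), (0, -1)} :: (int \<times> int) set)"
  define f where "f v = (if v \<in> F then if v = (0, 0) then - (1/2) else expw p1 S else 0)" for v
  have "(f has_sum sum f F) F" by (rule has_sum_finite) (simp add: F_def)
  then have "(f has_sum sum f F) UNIV"
    by (rule has_sum_cong_neutral[THEN iffD1, rotated -1]) (auto simp: f_def)
  then have "sum f F \<le> latsum x y p1 t"
  proof (rule has_sum_mono[OF _ latsum_cubic_eq(1)[OF y0 p1_cubic]])
    fix v
    show "f v \<le> expw p1 (exp t * qform x y v)"
    proof (cases "v \<in> F")
      case True
      then show ?thesis using y0 by (auto simp: f_def F_def qform_def p1_def S_def)
    next
      case False
      obtain m n where v: "v = (m, n)" by (cases v)
      have "1/2 \<le> exp t * qform x y v"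
      proof (cases "m = 0")
        case True
        then have "n \<noteq> 0" using False by (auto simp: F_def v)
        then have "1 \<le> (real_of_int n)\<^sup>2" using int_abs_le_square[of n] by linarith
        then have "exp t * (pi / y) * 1 \<le> exp t * (pi / y) * (real_of_int n)\<^sup>2" using y0 by (intro mult_left_mono) auto
        moreover have "exp t * qform x y v = exp t * (pi / y) * (real_of_int n)\<^sup>2" by (simp add: v True qform_def)
        ultimately show ?thesis using s by linarith
      next
        case m: False
        then show ?thesis using scaled_qform_ge_half[OF y t] by (simp add: v)
      qed
      then show ?thesis using False expw_p1_nonneg by (simp add: f_def)
    qed
  qed
  then show ?thesis by (simp add: F_def f_def S_def)
qed

text \<open>For small \<open>\<sigma>\<close> the row \<open>m = 0\<close> is evaluated after a one-dimensional Poisson summation: with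
  \<open>J a = (\<Sum>n. exp (- a * (pi * n\<^sup>2)))\<close>, the identity \<open>J \<sigma> * sqrt \<sigma> = J (1 / \<sigma>)\<close> is differentiated.\<close>

lemma row_sum_lower:
  fixes \<sigma> :: real
  assumes \<sigma>: "0 < \<sigma>" "\<sigma> * pi \<le> 2"
  shows "((\<lambda>n::int. expw p1 (\<sigma> * (pi * (of_int n)\<^sup>2))) summable_on UNIV)"
    and "- (15/100) \<le> (\<Sum>\<^sub>\<infinity>n::int. expw p1 (\<sigma> * (pi * (of_int n)\<^sup>2)))"
proof -
  define c where "c n = pi * (real_of_int n)\<^sup>2" for n :: int
  define J where "J k a = (\<Sum>\<^sub>\<infinity>n::int. c n ^ k * exp (- a * c n))" for k and a :: real
  have c0: "0 \<le> c n" for n by (simp add: c_def)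
  have s0: "(\<lambda>n. exp (- a * c n)) summable_on UNIV" if "0 < a" for a
    using exp_square_summable[of "a * pi"] that by (simp add: c_def mult.assoc)
  have sm: "(\<lambda>n. c n ^ k * exp (- a * c n)) summable_on UNIV" if "0 < a" for a k
    using that by (intro exp_weight_summable c0 s0)
  have dJ: "(J 0 has_real_derivative - J 1 a) (at a)" if "0 < a" for a
    using exp_series_deriv[of UNIV c a 0] c0 s0 that by (simp add: J_def[abs_def])
  have po: "J 0 a * sqrt a = J 0 (1 / a)" if "0 < a" for a
    using gauss_poisson[OF that, of 0] that by (simp add: J_def c_def mult_ac)
  define \<tau> where "\<tau> = 1 / \<sigma>"
  have \<tau>: "0 < \<tau>" "\<sigma> * \<tau> = 1" using \<sigma> by (auto simp: \<tau>_def)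
  have "((\<lambda>a. J 0 a * sqrt a) has_real_derivative - J 1 \<sigma> * sqrt \<sigma> + J 0 \<sigma> * (inverse (sqrt \<sigma>) / 2)) (at \<sigma>)"
    using \<sigma> by (auto intro!: derivative_eq_intros dJ DERIV_real_sqrt simp: mult_ac)
  moreover have "((\<lambda>a. J 0 a * sqrt a) has_real_derivative J 1 \<tau> * \<tau>\<^sup>2) (at \<sigma>)"
  proof (rule has_field_derivative_transform_within_open[where S = "{0<..}"])
    have "((\<lambda>a. J 0 (1 / a)) has_real_derivative - J 1 (1 / \<sigma>) * (- (1 / \<sigma>\<^sup>2))) (at \<sigma>)"
      by (rule DERIV_chain2[OF dJ]) (use \<sigma> in \<open>auto intro!: derivative_eq_intros simp: power2_eq_square\<close>)
    then show "((\<lambda>a. J 0 (1 / a)) has_real_derivative J 1 \<tau> * \<tau>\<^sup>2) (at \<sigma>)"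
      by (simp add: \<tau>_def power_divide)
  qed (use \<sigma> po in auto)
  ultimately have e: "- J 1 \<sigma> * sqrt \<sigma> + J 0 \<sigma> * (inverse (sqrt \<sigma>) / 2) = J 1 \<tau> * \<tau>\<^sup>2"
    by (rule DERIV_unique)
  have h: "((\<lambda>n. expw p1 (\<sigma> * c n)) has_sum \<sigma> * J 1 \<sigma> - 1/2 * J 0 \<sigma>) UNIV"
  proof -
    have "((\<lambda>n. \<sigma> * (c n ^ 1 * exp (- \<sigma> * c n)) - 1/2 * (c n ^ 0 * exp (- \<sigma> * c n))) has_sum \<sigma> * J 1 \<sigma> - 1/2 * J 0 \<sigma>) UNIV"
      unfolding J_def by (intro has_sum_diff_real has_sum_cmult_right has_sum_infsum sm \<sigma>)
    then show ?thesis by (simp add: p1_def algebra_simps)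
  qed
  then show "(\<lambda>n::int. expw p1 (\<sigma> * (pi * (of_int n)\<^sup>2))) summable_on UNIV"
    unfolding c_def by (rule has_sum_imp_summable)
  \<comment> \<open>The differentiated identity times \<open>sqrt \<sigma>\<close>: the row sum
    turns into a rapidly decaying sum at \<open>\<tau> = 1 / \<sigma>\<close>.\<close>
  have "(\<sigma> * J 1 \<sigma> - 1/2 * J 0 \<sigma>) = - (sqrt \<sigma> * (J 1 \<tau> * \<tau>\<^sup>2))"
  proof -
    have "sqrt \<sigma> * sqrt \<sigma> = \<sigma>" "sqrt \<sigma> * inverse (sqrt \<sigma>) = 1" using \<sigma> by simp_all
    moreover have "r * (- b * r + a * (i / 2)) = - b * (r * r) + a * (r * i) / 2" for r a b i :: real
      by (simp add: algebra_simps)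
    ultimately show ?thesis unfolding e[symmetric] by (simp only:) simp
  qed
  have J1: "J 1 \<tau> \<le> pi * exp (- \<tau> * pi) * (8/3)"
  proof -
    have q: "2 * 2 \<le> \<tau> * pi"
    proof -
      have "\<tau> * (\<sigma> * pi) \<le> \<tau> * 2" using \<sigma> \<tau> by (intro mult_left_mono) auto
      then have "pi \<le> \<tau> * 2" using \<tau> by (simp add: mult.left_commute mult.assoc[symmetric] mult.commute)
      then have "3/2 * 3 \<le> \<tau> * pi" using pi_gt3 by (intro mult_mono) linarith+
      then show ?thesis by simp
    qed
    \<comment> \<open>Geometric majorant with ratio \<open>4 / 16\<close>: \<open>n\<^sup>2\<close>
      is at most \<open>4 ^ (\<bar>n\<bar> - 1)\<close>, and the exponential loses at least a factor
      \<open>16\<close> per step. The term \<open>n = 0\<close> is zero and is taken out.\<close>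
    have g: "((\<lambda>n::int. 4 * (1/4::real) ^ nat \<bar>n\<bar> - (if n \<in> {0} then 4 else 0)) has_sum (4 * (5/3) - 4)) UNIV"
    proof (rule has_sum_diff_real)
      show "((\<lambda>n::int. 4 * (1/4::real) ^ nat \<bar>n\<bar>) has_sum (4 * (5/3))) UNIV"
        using has_sum_cmult_right[OF has_sum_geometric_int[of "1/4"], of 4] by simp
      show "((\<lambda>n::int. if n \<in> {0} then 4 else 0 :: real) has_sum 4) UNIV"
        using has_sum_if_finite[of "{0 :: int}" 4] by simp
    qed
    have "J 1 \<tau> \<le> pi * exp (- \<tau> * pi) * (4 * (5/3) - 4)"
      unfolding J_def
    proof (rule has_sum_mono[OF has_sum_infsum[OF sm[OF \<tau>(1)]] has_sum_cmult_right[OF g]])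
      fix n :: int
      show "c n ^ 1 * exp (- \<tau> * c n) \<le> pi * exp (- \<tau> * pi) * (4 * (1/4) ^ nat \<bar>n\<bar> - (if n \<in> {0} then 4 else 0))"
      proof (cases "n = 0")
        case True then show ?thesis by (simp add: c_def)
      next
        case False
        then obtain j where j: "nat \<bar>n\<bar> = Suc j" by (cases "nat \<bar>n\<bar>") auto
        then have nj: "(real_of_int n)\<^sup>2 = (1 + real j)\<^sup>2"
        proof -
          have "\<bar>real_of_int n\<bar> = real (nat \<bar>n\<bar>)" by simp
          then show ?thesis unfolding j by (metis power2_abs of_nat_Suc)
        qed
        have 1: "(1 + real j)\<^sup>2 \<le> 4 ^ j"
        proof -
          have "1 + real j \<le> 2 ^ j" by (induction j) auto
          then have "(1 + real j)\<^sup>2 \<le> (2 ^ j)\<^sup>2" by (intro power_mono) auto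
          moreover have "((2::real) ^ j)\<^sup>2 = (2 * 2) ^ j" unfolding power2_eq_square by (simp only: power_mult_distrib)
          ultimately show ?thesis by simp
        qed
        have 2: "exp (- \<tau> * (pi * (1 + real j)\<^sup>2)) \<le> exp (- \<tau> * pi) * (1/16) ^ j"
        proof -
          have "\<tau> * pi * (1 + 2 * real j + (real j)\<^sup>2) = \<tau> * (pi * (1 + real j)\<^sup>2)" by (simp add: power2_eq_square algebra_simps)
          moreover have "4 * real j \<le> \<tau> * pi * (2 * real j + (real j)\<^sup>2)"
            using q by (intro mult_mono) auto
          ultimately have "- \<tau> * (pi * (1 + real j)\<^sup>2) \<le> - \<tau> * pi + - 4 * real j" by (simp add: algebra_simps)
          then have "exp (- \<tau> * (pi * (1 + real j)\<^sup>2)) \<le> exp (- \<tau> * pi) * exp (- 4 * real j)"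
            unfolding exp_add[symmetric] by simp
          also have "exp (- 4 * real j) = exp (- 4) ^ j" by (simp add: exp_of_nat_mult[symmetric] mult.commute)
          also have "\<dots> \<le> (1/16) ^ j"
          proof (rule power_mono)
            have "(16::real) \<le> (2) ^ 4" by simp
            also have "\<dots> \<le> exp (real 4 * 1)" by (rule exp_ge_power) auto
            finally show "exp (- 4) \<le> (1/16::real)" by (simp add: exp_minus field_simps)
          qed auto
          finally show ?thesis by simp
        qed
        have "c n ^ 1 * exp (- \<tau> * c n) = pi * ((1 + real j)\<^sup>2 * exp (- \<tau> * (pi * (1 + real j)\<^sup>2)))" by (simp add: c_def nj)
        also have "\<dots> \<le> pi * (4 ^ j * (exp (- \<tau> * pi) * (1/16) ^ j))"
          using 1 2 by (intro mult_left_mono mult_mono) auto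
        also have "\<dots> = pi * exp (- \<tau> * pi) * (4 * (1/4) ^ nat \<bar>n\<bar>)"
        proof -
          have "(4::real) ^ j * (1/16) ^ j = (1/4) ^ j" by (simp add: power_mult_distrib[symmetric])
          then show ?thesis unfolding j by simp
        qed
        finally show ?thesis using False by simp
      qed
    qed
    then show ?thesis by simp
  qed
  have "sqrt \<sigma> * (J 1 \<tau> * \<tau>\<^sup>2) \<le> 15/100"
  proof -
    define w where "w = \<tau> * pi"
    have w: "49/10 \<le> w"
    proof -
      have "\<tau> * (\<sigma> * pi) \<le> \<tau> * 2" using \<sigma> \<tau> by (intro mult_left_mono) auto
      then have "pi \<le> \<tau> * 2" using \<tau> by (simp add: mult.left_commute mult.assoc[symmetric] mult.commute)
      moreover have "314/100 \<le> pi" using pi_approx by simp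
      ultimately have "157/100 * (314/100) \<le> w" unfolding w_def by (intro mult_mono) linarith+
      then show ?thesis by simp
    qed
    have st: "sqrt \<sigma> * \<tau> \<le> (1 + \<tau>) / 2"
    proof -
      have "sqrt \<sigma> * \<tau> = sqrt (\<sigma> * \<tau> * \<tau>)" using \<tau>(1) by (simp only: real_sqrt_mult mult.assoc) simp
      also have "\<dots> = sqrt (1 * \<tau>)" using \<tau> by simp
      also have "\<dots> \<le> (1 + \<tau>) / 2" using \<tau> by (intro arith_geo_mean_sqrt) auto
      finally show ?thesis .
    qed
    have \<tau>w: "\<tau> \<le> w / 3" using pi_gt3 \<tau> mult_left_mono[of 3 pi \<tau>] by (simp add: w_def)
    have "sqrt \<sigma> * (J 1 \<tau> * \<tau>\<^sup>2) \<le> sqrt \<sigma> * (pi * exp (- \<tau> * pi) * (8/3) * \<tau>\<^sup>2)"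
      using J1 \<sigma> by (intro mult_left_mono mult_right_mono) auto
    also have "\<dots> = (8/3) * (w * exp (- w) * (sqrt \<sigma> * \<tau>))" by (simp add: w_def power2_eq_square)
    also have "\<dots> \<le> (8/3) * (w * exp (- w) * ((1 + w / 3) / 2))"
      using st \<tau>w w by (intro mult_left_mono) auto
    also have "\<dots> \<le> 15/100"
    proof -
      define q where "q = w - 49/10"
      have q: "0 \<le> q" "w = 49/10 + q" using w by (auto simp: q_def)
      have "(8/3) * (w * ((1 + w / 3) / 2)) \<le> 15/100 * (130 * (1 + q + q\<^sup>2/2))"
        unfolding q(2) using q(1) by (simp add: power2_eq_square field_simps)
      also have "\<dots> \<le> 15/100 * (exp (49/10) * exp q)"
      proof (intro mult_left_mono mult_mono)
        have "(130::real) \<le> (1277/1000) ^ 20" by (simp add: power_divide)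
        also have "\<dots> \<le> exp (real 20 * (49/200))" by (rule exp_ge_power) (simp_all add: power_divide)
        finally show "(130::real) \<le> exp (49/10)" by simp
        show "1 + q + q\<^sup>2 / 2 \<le> exp q" using exp_ge_cubic[of q] zero_le_power[OF q(1), of 3] by linarith
      qed (use q in auto)
      also have "\<dots> = 15/100 * exp w" by (simp add: q(2) exp_add)
      finally have "(8/3) * (w * ((1 + w / 3) / 2)) * exp (- w) \<le> 15/100 * exp w * exp (- w)" by (intro mult_right_mono) auto
      also have "\<dots> = 15/100" by (simp add: mult.assoc exp_add[symmetric])
      finally show ?thesis by (simp add: mult_ac)
    qed
    finally show ?thesis .
  qed
  then show "- (15/100) \<le> (\<Sum>\<^sub>\<infinity>n::int. expw p1 (\<sigma> * (pi * (of_int n)\<^sup>2)))"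
    using infsumI[OF h] \<open>_ = - (sqrt \<sigma> * (J 1 \<tau> * \<tau>\<^sup>2))\<close> by (simp add: c_def)
qed

text \<open>With small spacing many terms of the row \<open>m = 0\<close> are negative, so this row
  is kept as a whole; the other rows are nonnegative since \<open>y \<ge> 1\<close>.\<close>

lemma latsum_p1_lower_row:
  assumes y: "1 \<le> y" and t: "0 \<le> t" and s: "exp t * (pi / y) \<le> 2"
  shows "- (15/100) \<le> latsum x y p1 t"
proof -
  have y0: "0 < y" using y by simp
  define \<sigma> where "\<sigma> = exp t / y"
  have \<sigma>: "0 < \<sigma>" "\<sigma> * pi \<le> 2" using s y0 by (simp_all add: \<sigma>_def)
  note r = row_sum_lower[OF \<sigma>]
  define f where "f v = (if fst v = 0 then expw p1 (\<sigma> * (pi * (of_int (snd v))\<^sup>2)) else 0)" for v :: "int \<times> int"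
  have "((\<lambda>v. f v) has_sum (\<Sum>\<^sub>\<infinity>n::int. expw p1 (\<sigma> * (pi * (of_int n)\<^sup>2)))) (Pair 0 ` UNIV)"
    using r(1) by (subst has_sum_reindex) (auto simp: inj_on_def f_def o_def intro!: has_sum_infsum)
  then have "(f has_sum (\<Sum>\<^sub>\<infinity>n::int. expw p1 (\<sigma> * (pi * (of_int n)\<^sup>2)))) UNIV"
    by (rule has_sum_cong_neutral[THEN iffD1, rotated -1]) (auto simp: f_def)
  then have "(\<Sum>\<^sub>\<infinity>n::int. expw p1 (\<sigma> * (pi * (of_int n)\<^sup>2))) \<le> latsum x y p1 t"
  proof (rule has_sum_mono[OF _ latsum_cubic_eq(1)[OF y0 p1_cubic]])
    fix v :: "int \<times> int"
    obtain m n where v: "v = (m, n)" by (cases v)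
    show "f v \<le> expw p1 (exp t * qform x y v)"
    proof (cases "m = 0")
      case True
      then have "exp t * qform x y v = \<sigma> * (pi * (of_int n)\<^sup>2)" by (simp add: v qform_def \<sigma>_def)
      then show ?thesis using True by (simp add: f_def v)
    next
      case False
      then show ?thesis using expw_p1_nonneg[OF scaled_qform_ge_half[OF y t False]] by (simp add: f_def v)
    qed
  qed
  then show ?thesis using r(2) by linarith
qed

text \<open>\<open>q\<close> bounds \<open>rho_im / y\<close>, hence \<open>s1 \<le> q * s\<close>.
  If \<open>s1 > 2\<close>, \<open>expw p1\<close> is decreasing there and its two shortest vectors
  beat the first shell at rho by \<open>num\<close>; otherwise the whole row does.\<close>

lemma latsum_p1_less_high_aux:
  fixes q S x y t :: real
  assumes num: "\<And>s. S \<le> s \<Longrightarrow> 6 * (s - 1/2) + 6/100 < 2 * (q * s - 1/2) * exp ((1 - q) * s)"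
    and S: "435/100 \<le> S" "S \<le> exp t * (pi / rho_im)" and y: "1 \<le> y" "rho_im \<le> q * y" and t: "0 \<le> t"
  shows "latsum (1/2) rho_im p1 t < latsum x y p1 t"
proof -
  define s where "s = exp t * (pi / rho_im)"
  define s1 where "s1 = exp t * (pi / y)"
  have s: "435/100 \<le> s" "S \<le> s" using S unfolding s_def by linarith+
  have s1q: "s1 \<le> q * s"
  proof -
    have "1 / y \<le> q / rho_im" using y rho_im(1) by (simp add: field_simps)
    then have "exp t * pi * (1 / y) \<le> exp t * pi * (q / rho_im)" by (intro mult_left_mono) auto
    then show ?thesis by (simp add: s1_def s_def mult_ac)
  qed
  have up: "latsum (1/2) rho_im p1 t \<le> - (1/2) + (6 * (s - 1/2) + 6/100) * exp (- s)"
    unfolding s_def by (rule rho_latsum_upper[OF t])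
  show ?thesis
  proof (cases "s1 \<le> 2")
    case True
    have "- (15/100) \<le> latsum x y p1 t" using True y t by (intro latsum_p1_lower_row) (auto simp: s1_def)
    \<comment> \<open>\<open>35/100\<close> is the gap between the row bound
      \<open>- (15/100)\<close> and the contribution \<open>- (1/2)\<close> of the zero vector at
      rho.\<close>
    moreover have "(6 * (s - 1/2) + 6/100) * exp (- s) < 35/100"
    proof -
      define p where "p = s - 435/100"
      have p: "0 \<le> p" "s = 435/100 + p" using s by (auto simp: p_def)
      have "6 * (s - 1/2) + 6/100 < 35/100 * (77 * (1 + p))" using p by simp
      also have "\<dots> \<le> 35/100 * (exp (435/100) * exp p)"
      proof (intro mult_left_mono mult_mono)
        have "(77::real) \<le> (12428/10000) ^ 20" by (simp add: power_divide)
        also have "\<dots> \<le> exp (real 20 * (435/2000))" by (rule exp_ge_power) (simp_all add: power_divide)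
        finally show "(77::real) \<le> exp (435/100)" by simp
        show "1 + p \<le> exp p" by (rule exp_ge_add_one_self)
      qed (use p in auto)
      also have "\<dots> = 35/100 * exp s" by (simp add: p(2) exp_add)
      finally have "(6 * (s - 1/2) + 6/100) * exp (- s) < 35/100 * exp s * exp (- s)" by (intro mult_strict_right_mono) auto
      then show ?thesis by (simp add: mult.assoc exp_add[symmetric])
    qed
    ultimately show ?thesis using up by linarith
  next
    case False
    have "- (1/2) + 2 * expw p1 s1 \<le> latsum x y p1 t" unfolding s1_def
      by (rule latsum_p1_lower_first[OF y(1) t]) (use False in \<open>unfold s1_def, linarith\<close>)
    moreover have "expw p1 (q * s) \<le> expw p1 s1" using False s1q by (intro expw_p1_antimono) auto
    moreover have "(6 * (s - 1/2) + 6/100) * exp (- s) < 2 * expw p1 (q * s)"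
    proof -
      have "(6 * (s - 1/2) + 6/100) * exp (- s) < 2 * (q * s - 1/2) * exp ((1 - q) * s) * exp (- s)"
        using num[OF s(2)] by (intro mult_strict_right_mono) auto
      also have "\<dots> = 2 * (q * s - 1/2) * (exp ((1 - q) * s) * exp (- s))" by (simp only: mult.assoc)
      also have "exp ((1 - q) * s) * exp (- s) = exp (- (q * s))" by (simp add: exp_add[symmetric] algebra_simps)
      finally show ?thesis by (simp only: p1_def mult.assoc)
    qed
    ultimately show ?thesis using up by linarith
  qed
qed

text \<open>In the two regions \<open>7734/10000\<close> and \<open>5774/10000\<close> bound
  \<open>rho_im / y\<close> from above, while \<open>6891/1000\<close> and \<open>4352/1000\<close>
  bound \<open>exp t * (pi / rho_im)\<close> from below.\<close>

theorem latsum_p1_less_high: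
  fixes x y t :: real
  assumes "112/100 \<le> y \<and> 19/10 \<le> exp t \<or> 3/2 \<le> y \<and> 6/5 \<le> exp t"
  shows "latsum (1/2) rho_im p1 t < latsum x y p1 t"
proof -
  have "1 \<le> exp t" using assms by linarith
  then have t: "0 \<le> t" by simp
  from assms show ?thesis
  proof
    assume a: "112/100 \<le> y \<and> 19/10 \<le> exp t"
    show ?thesis
    proof (rule latsum_p1_less_high_aux[where q = "7734/10000" and S = "6891/1000"])
      fix s :: real assume "6891/1000 \<le> s"
      define p where "p = s - 6891/1000"
      have p: "0 \<le> p" "s = 6891/1000 + p" using \<open>6891/1000 \<le> s\<close> by (auto simp: p_def)
      have e: "47/10 * (1 + 2266/10000 * p) \<le> exp ((1 - 7734/10000) * s)"
      proof -
        have "47/10 * (1 + 2266/10000 * p) \<le> exp (1561/1000) * exp (2266/10000 * p)"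
        proof (rule mult_mono)
          have "(47/10::real) \<le> (1365/1000) ^ 5" by (simp add: power_divide)
          also have "\<dots> \<le> exp (real 5 * (3122/10000))" by (rule exp_ge_power) (simp_all add: power_divide)
          finally show "(47/10::real) \<le> exp (1561/1000)" by simp
        qed (use p in \<open>auto intro: exp_ge_add_one_self\<close>)
        also have "\<dots> \<le> exp ((1 - 7734/10000) * s)" unfolding exp_add[symmetric] p(2) by simp
        finally show ?thesis .
      qed
      have "6 * (s - 1/2) + 6/100 < 2 * (7734/10000 * s - 1/2) * (47/10 * (1 + 2266/10000 * p))"
      proof -
        have "0 \<le> p * p" using p by simp
        then show ?thesis unfolding p(2) using p(1) by (simp add: field_simps; linarith)
      qed
      also have "\<dots> \<le> 2 * (7734/10000 * s - 1/2) * exp ((1 - 7734/10000) * s)"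
        using e p by (intro mult_left_mono) auto
      finally show "6 * (s - 1/2) + 6/100 < 2 * (7734/10000 * s - 1/2) * exp ((1 - 7734/10000) * s)" .
    next
      have "19/10 * (3627/1000) \<le> exp t * (pi / rho_im)" using a pi_div_rho_im by (intro mult_mono) auto
      then show "6891/1000 \<le> exp t * (pi / rho_im)" by linarith
      show "1 \<le> y" "rho_im \<le> 7734/10000 * y" using a rho_im by linarith+
    qed (use t in auto)
  next
    assume a: "3/2 \<le> y \<and> 6/5 \<le> exp t"
    show ?thesis
    proof (rule latsum_p1_less_high_aux[where q = "5774/10000" and S = "4352/1000"])
      fix s :: real assume "4352/1000 \<le> s"
      define p where "p = s - 4352/1000"
      have p: "0 \<le> p" "s = 4352/1000 + p" using \<open>4352/1000 \<le> s\<close> by (auto simp: p_def)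
      have e: "62/10 * (1 + 4226/10000 * p) \<le> exp ((1 - 5774/10000) * s)"
      proof -
        have "62/10 * (1 + 4226/10000 * p) \<le> exp (1839/1000) * exp (4226/10000 * p)"
        proof (rule mult_mono)
          have "(62/10::real) \<le> (144425/100000) ^ 5" by (simp add: power_divide)
          also have "\<dots> \<le> exp (real 5 * (3678/10000))" by (rule exp_ge_power) (simp_all add: power_divide)
          finally show "(62/10::real) \<le> exp (1839/1000)" by simp
        qed (use p in \<open>auto intro: exp_ge_add_one_self\<close>)
        also have "\<dots> \<le> exp ((1 - 5774/10000) * s)" unfolding exp_add[symmetric] p(2) by simp
        finally show ?thesis .
      qed
      have "6 * (s - 1/2) + 6/100 < 2 * (5774/10000 * s - 1/2) * (62/10 * (1 + 4226/10000 * p))"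
      proof -
        have "0 \<le> p * p" using p by simp
        then show ?thesis unfolding p(2) using p(1) by (simp add: field_simps; linarith)
      qed
      also have "\<dots> \<le> 2 * (5774/10000 * s - 1/2) * exp ((1 - 5774/10000) * s)"
        using e p by (intro mult_left_mono) auto
      finally show "6 * (s - 1/2) + 6/100 < 2 * (5774/10000 * s - 1/2) * exp ((1 - 5774/10000) * s)" .
    next
      have "6/5 * (3627/1000) \<le> exp t * (pi / rho_im)" using a pi_div_rho_im by (intro mult_mono) auto
      then show "4352/1000 \<le> exp t * (pi / rho_im)" by linarith
      show "1 \<le> y" "rho_im \<le> 5774/10000 * y" using a rho_im by linarith+
    qed (use t in auto)
  qed
qed

section \<open>Monotonicity of the ratio on the fundamental domain\<close>

text \<open>Strictness is asked only inside the interval because the two derivatives coincide at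
  \<open>t = 0\<close>.\<close>

lemma ntheta_diff_decreasing:
  fixes x1 y1 x2 y2 t1 t2 :: real
  assumes y: "0 < y1" "0 < y2" and t: "t1 < t2"
    and less: "\<And>s. t1 < s \<Longrightarrow> s < t2 \<Longrightarrow> latsum x2 y2 p1 s < latsum x1 y1 p1 s"
  shows "ntheta x1 y1 t2 - ntheta x2 y2 t2 < ntheta x1 y1 t1 - ntheta x2 y2 t1"
proof (rule DERIV_neg_imp_decreasing_open[OF t])
  fix s assume "t1 < s" "s < t2"
  then have "exp (s/2) * latsum x2 y2 p1 s < exp (s/2) * latsum x1 y1 p1 s" using less by simp
  then show "\<exists>D. ((\<lambda>t. ntheta x1 y1 t - ntheta x2 y2 t) has_real_derivative D) (at s) \<and> D < 0"
    using DERIV_diff[OF ntheta_deriv(1)[OF y(1), of x1 s] ntheta_deriv(1)[OF y(2), of x2 s]] by (intro exI conjI) auto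
next
  show "continuous_on {t1..t2} (\<lambda>t. ntheta x1 y1 t - ntheta x2 y2 t)"
    by (intro continuous_on_diff continuous_at_imp_continuous_on ballI)
      (use ntheta_deriv(1)[OF y(1)] ntheta_deriv(1)[OF y(2)] DERIV_isCont in blast)+
qed

lemma strict_decreasing_glue:
  fixes f :: "real \<Rightarrow> real"
  assumes "\<And>s t. P s \<Longrightarrow> s < t \<Longrightarrow> t \<le> b \<Longrightarrow> f t < f s"
    and "\<And>s t. b \<le> s \<Longrightarrow> s < t \<Longrightarrow> Q t \<Longrightarrow> f t < f s"
    and "P s" "s < t" "Q t"
  shows "f t < f s"
proof -
  consider "t \<le> b" | "b \<le> s" | "s < b" "b < t" by linarith
  then show ?thesis
  proof cases
    case 3
    then have "f t < f b" "f b < f s" using assms by auto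
    then show ?thesis by simp
  qed (use assms in auto)
qed

text \<open>In other words, the hyperbolic distance to rho is at most \<open>ln (1769/1000)\<close>;
  \<open>y\<^sup>2\<close> is replaced by its chord over \<open>[866/1000, 112/100]\<close>.\<close>

lemma fundamental_domain_orbit_mean:
  assumes x: "0 \<le> x" "x \<le> 1" and y: "rho_im \<le> y" "y \<le> 112/100"
  shows "2 * ((x\<^sup>2 + y\<^sup>2 + 1 - x) / (2 * rho_im * y)) \<le> 1769/1000 + 1000/1769"
proof -
  have y0: "0 < y" "866/1000 \<le> y" using y rho_im by linarith+
  have "x * x \<le> 1 * x" using x by (intro mult_right_mono) auto
  then have xx: "x\<^sup>2 \<le> x" by (simp add: power2_eq_square)
  have "0 \<le> (y - 866/1000) * (112/100 - y)" using y y0 by (intro mult_nonneg_nonneg) auto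
  then have "y\<^sup>2 + 1 \<le> 20209/10000 * y" using y0 by (simp add: power2_eq_square field_simps)
  then have "x\<^sup>2 + y\<^sup>2 + 1 - x \<le> 20209/10000 * y" using xx by simp
  also have "\<dots> \<le> 20209/10000 * y * (rho_im / (866/1000))" using rho_im y0 by simp
  also have "\<dots> = 20209/8660 * (rho_im * y)" by simp
  also have "\<dots> \<le> (1769/1000 + 1000/1769) * (rho_im * y)" using rho_im y0 by (intro mult_right_mono) auto
  finally have "(x\<^sup>2 + y\<^sup>2 + 1 - x) / (rho_im * y) \<le> 1769/1000 + 1000/1769" using rho_im(1) y0 by (simp add: pos_divide_le_eq)
  moreover have "2 * (a / (2 * b * c)) = a / (b * c)" for a b c :: real by simp
  ultimately show ?thesis by (simp only:)
qed

text \<open>Up to \<open>y = 112/100\<close> the line serves until \<open>exp t = 19/10\<close> and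
  the orbits afterwards. Between \<open>112/100\<close> and \<open>3/2\<close> the majorant serves
  until \<open>105/100\<close>, the line until \<open>19/10\<close>, the shortest vectors
  afterwards. Above \<open>3/2\<close> the majorant and the shortest vectors meet at
  \<open>6/5\<close>.\<close>

theorem delta_strict_decreasing:
  fixes x y t1 t2 :: real
  assumes x: "0 \<le> x" "x \<le> 1/2" and xy: "1 \<le> x\<^sup>2 + y\<^sup>2" and y: "0 < y" and ne: "(x, y) \<noteq> (1/2, rho_im)"
    and t: "0 \<le> t1" "t1 < t2"
  shows "ntheta x y t2 - ntheta (1/2) rho_im t2 < ntheta x y t1 - ntheta (1/2) rho_im t1"
proof -
  define \<delta> where "\<delta> t = ntheta x y t - ntheta (1/2) rho_im t" for t
  have x2: "x\<^sup>2 \<le> (1/2)\<^sup>2" using x by (intro power_mono) auto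
  have yr: "rho_im < y"
  proof (rule ccontr)
    assume "\<not> rho_im < y"
    then have "y\<^sup>2 \<le> rho_im\<^sup>2" using y by (intro power_mono) auto
    then have "(1/2)\<^sup>2 \<le> x\<^sup>2" "rho_im\<^sup>2 \<le> y\<^sup>2" using xy x2 rho_im(2) by (simp_all add: power_divide)
    then have "1/2 \<le> x" "rho_im \<le> y" using x y by (auto intro: power2_le_imp_le)
    then show False using ne x \<open>\<not> rho_im < y\<close> by auto
  qed
  have lne: "x\<^sup>2 + y\<^sup>2 + 1 - x \<noteq> 2 * rho_im * y"
  proof -
    \<comment> \<open>The squared Euclidean distance between \<open>x + \<i> * y\<close> and
      rho.\<close>
    have "x\<^sup>2 + y\<^sup>2 + 1 - x - 2 * rho_im * y = (x - 1/2)\<^sup>2 + (y - rho_im)\<^sup>2"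
      using rho_im(2) by (simp add: power2_diff power_divide)
    moreover have "0 < (y - rho_im)\<^sup>2" using yr by simp
    ultimately show ?thesis by (smt (verit) zero_le_power2)
  qed
  have ln: "exp s \<le> a \<longleftrightarrow> s \<le> ln a" "a \<le> exp s \<longleftrightarrow> ln a \<le> s" if "0 < a" for a s :: real
    using that by (metis exp_le_cancel_iff exp_ln)+
  have line: "\<delta> s2 < \<delta> s1" if "0 \<le> s1" "s1 < s2" "s2 \<le> ln (19/10)"
    "\<And>s. s1 < s \<Longrightarrow> s < s2 \<Longrightarrow> latsum (1/2) rho_im p1 s < latsum (1/2) y p1 s" for s1 s2
  proof -
    have "exp s2 \<le> 19/10" using that(3) ln(1)[of "19/10" s2] by simp
    then have "ntheta x y s2 - ntheta (1/2) y s2 \<le> ntheta x y s1 - ntheta (1/2) y s1" using that yr by (intro ntheta_minus_line_antimono) auto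
    moreover have "ntheta (1/2) y s2 - ntheta (1/2) rho_im s2 < ntheta (1/2) y s1 - ntheta (1/2) rho_im s1"
      by (rule ntheta_diff_decreasing[OF y rho_im(1) that(2,4)])
    ultimately show ?thesis by (simp add: \<delta>_def)
  qed
  have dl: "\<delta> s2 < \<delta> s1" if "s1 < s2" "\<And>s. s1 < s \<Longrightarrow> s < s2 \<Longrightarrow> latsum (1/2) rho_im p1 s < latsum x y p1 s" for s1 s2
    unfolding \<delta>_def by (rule ntheta_diff_decreasing[OF y rho_im(1) that])
  consider "y \<le> 112/100" | "112/100 \<le> y" "y \<le> 3/2" | "3/2 \<le> y" by linarith
  then have "\<delta> t2 < \<delta> t1"
  proof cases
    case 1
    show ?thesis
    proof (rule strict_decreasing_glue[where f = \<delta> and P = "\<lambda>s. 0 \<le> s" and Q = "\<lambda>_. True" and b = "ln (19/10)"])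
      show "\<delta> t < \<delta> s" if "0 \<le> s" "s < t" "t \<le> ln (19/10)" for s t
        using that yr 1 by (intro line latsum_p1_less_line_low) auto
      show "\<delta> t < \<delta> s" if "ln (19/10) \<le> s" "s < t" for s t
      proof (rule dl[OF that(2)])
        fix r assume "s < r"
        then have "19/10 \<le> exp r" using that ln(2)[of "19/10" r] by simp
        then have "19/10 * (3627/1000) \<le> exp r * (pi / rho_im)" using pi_div_rho_im by (intro mult_mono) auto
        then have "689/100 \<le> exp r * (pi / rho_im)" by linarith
        then show "latsum (1/2) rho_im p1 r < latsum x y p1 r"
          using x yr 1 by (intro latsum_p1_less_orbit y fundamental_domain_orbit_mean lne) auto
      qed
    qed (use t in auto)
  next
    case 2
    show ?thesis
    proof (rule strict_decreasing_glue[where f = \<delta> and P = "\<lambda>s. 0 \<le> s" and Q = "\<lambda>_. True" and b = "ln (19/10)"])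
      show "\<delta> t < \<delta> s" if "0 \<le> s" "s < t" "t \<le> ln (19/10)" for s t
      proof (rule strict_decreasing_glue[where f = \<delta> and P = "\<lambda>s. 0 \<le> s" and Q = "\<lambda>t. t \<le> ln (19/10)" and b = "ln (105/100)"])
        show "\<delta> t < \<delta> s" if "0 \<le> s" "s < t" "t \<le> ln (105/100)" for s t
          unfolding \<delta>_def using that 2 ln(1)[of "105/100" t] by (intro ntheta_diff_decreasing_high[OF y _ _ high_constants_1]) auto
        show "\<delta> t < \<delta> s" if "ln (105/100) \<le> s" "s < t" "t \<le> ln (19/10)" for s t
        proof (rule line)
          have "0 < ln (105/100 :: real)" by simp
          then show "0 \<le> s" using that by linarith
          fix r assume "s < r"
          then have "105/100 \<le> exp r" using that ln(2)[of "105/100" r] by simp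
          then have "105/100 * (3627/1000) \<le> exp r * (pi / rho_im)" using pi_div_rho_im by (intro mult_mono) auto
          then have "19/5 \<le> exp r * (pi / rho_im)" by linarith
          then show "latsum (1/2) rho_im p1 r < latsum (1/2) y p1 r" using yr 2 by (intro latsum_p1_less_line)
        qed (use that in auto)
      qed (use that in auto)
      show "\<delta> t < \<delta> s" if "ln (19/10) \<le> s" "s < t" for s t
      proof (rule dl[OF that(2)])
        fix r assume "s < r"
        then have "19/10 \<le> exp r" using that ln(2)[of "19/10" r] by simp
        then show "latsum (1/2) rho_im p1 r < latsum x y p1 r" using 2 by (intro latsum_p1_less_high) auto
      qed
    qed (use t in auto)
  next
    case 3
    show ?thesis
    proof (rule strict_decreasing_glue[where f = \<delta> and P = "\<lambda>s. 0 \<le> s" and Q = "\<lambda>_. True" and b = "ln (6/5)"])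
      show "\<delta> t < \<delta> s" if "0 \<le> s" "s < t" "t \<le> ln (6/5)" for s t
        unfolding \<delta>_def using that 3 ln(1)[of "6/5" t] by (intro ntheta_diff_decreasing_high[OF y _ _ high_constants_2]) auto
      show "\<delta> t < \<delta> s" if "ln (6/5) \<le> s" "s < t" for s t
      proof (rule dl[OF that(2)])
        fix r assume "s < r"
        then have "6/5 \<le> exp r" using that ln(2)[of "6/5" r] by simp
        then show "latsum (1/2) rho_im p1 r < latsum x y p1 r" using 3 by (intro latsum_p1_less_high) auto
      qed
    qed (use t in auto)
  qed
  then show ?thesis by (simp add: \<delta>_def)
qed

section \<open>From the difference to the ratio\<close>

lemma ntheta_lower: "0 < y \<Longrightarrow> exp (t/2) \<le> ntheta x y t"
proof -
  assume y: "0 < y"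
  have "(\<Sum>\<^sub>\<infinity>v\<in>{(0::int, 0::int)}. exp (- exp t * qform x y v)) \<le> (\<Sum>\<^sub>\<infinity>v. exp (- exp t * qform x y v))"
    using qform_exp_summable[OF y, of "exp t" x] by (intro infsum_mono_neutral) auto
  then have "1 \<le> theta_moment x y 0 (exp t)" by (simp add: theta_moment_def qform_def)
  then show ?thesis by (simp add: ntheta_def)
qed

lemma ntheta_pos: "0 < y \<Longrightarrow> 0 < ntheta x y t"
  using ntheta_lower[of y t x] exp_gt_zero[of "t/2"] by linarith

text \<open>Nonzero vectors have norm at least three at rho, so raising the parameter from
  \<open>1\<close> to \<open>exp t\<close> gains a factor
  \<open>exp (- 3 * (exp t - 1)) \<le> exp (- 3 * t)\<close> in each term. Beyond the zero vector
  the sum is therefore negligible for large \<open>t\<close>.\<close>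

lemma ntheta_rho_upper:
  assumes t: "0 \<le> t"
  shows "ntheta (1/2) rho_im t \<le> exp (t/2) + theta_moment (1/2) rho_im 0 1 * exp (- 2 * t)"
proof -
  define e where "e = exp (- 3 * (exp t - 1))"
  have s: "((\<lambda>v. exp (- a * qform (1/2) rho_im v)) has_sum theta_moment (1/2) rho_im 0 a) UNIV" if "0 < a" for a
    using qform_exp_summable[OF rho_im(1) that] by (simp add: theta_moment_def)
  have i: "((\<lambda>v. if v \<in> {(0, 0)} then 1 else 0 :: real) has_sum 1) (UNIV :: (int \<times> int) set)"
    using has_sum_if_finite[of "{(0 :: int, 0 :: int)}" 1] by simp
  have "theta_moment (1/2) rho_im 0 (exp t) \<le> 1 + e * theta_moment (1/2) rho_im 0 1"
  proof (rule has_sum_mono[OF s[of "exp t"] has_sum_add[OF i has_sum_cmult_right[OF s[of 1]]]])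
    fix v :: "int \<times> int"
    show "exp (- exp t * qform (1/2) rho_im v) \<le> (if v \<in> {(0, 0)} then 1 else 0) + e * exp (- 1 * qform (1/2) rho_im v)"
    proof (cases "v = (0, 0)")
      case False
      have "(1::real) \<le> of_int (eis_norm v)" using eis_norm_pos[OF False] by simp
      then have "pi / rho_im * 1 \<le> pi / rho_im * of_int (eis_norm v)" using rho_im(1) by (intro mult_left_mono) auto
      then have "3 \<le> pi / rho_im * of_int (eis_norm v)" using pi_div_rho_im by linarith
      then have l: "3 \<le> qform (1/2) rho_im v" by (simp add: qform_rho)
      then have "(exp t - 1) * 3 \<le> (exp t - 1) * qform (1/2) rho_im v" using t by (intro mult_left_mono) auto
      then show ?thesis using False by (simp add: e_def exp_add[symmetric] algebra_simps)
    qed (simp add: e_def qform_def)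
  qed auto
  also have "e \<le> exp (- 3 * t)"
  proof -
    have "1 + t \<le> E \<Longrightarrow> - 3 * (E - 1) \<le> - 3 * t" for E by simp
    from this[OF exp_ge_add_one_self[of t]] show ?thesis unfolding e_def exp_le_cancel_iff .
  qed
  finally have "theta_moment (1/2) rho_im 0 (exp t) \<le> 1 + exp (- 3 * t) * theta_moment (1/2) rho_im 0 1"
    using infsum_nonneg[of UNIV "\<lambda>v. exp (- 1 * qform (1/2) rho_im v)"] by (simp add: theta_moment_def mult_right_mono)
  then have "ntheta (1/2) rho_im t \<le> exp (t/2) * (1 + exp (- 3 * t) * theta_moment (1/2) rho_im 0 1)" unfolding ntheta_def by (intro mult_left_mono) auto
  also have "\<dots> = exp (t/2) + theta_moment (1/2) rho_im 0 1 * exp (t/2 - 3 * t)" 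
  proof -
    have "exp (t/2) * exp (- 3 * t) = exp (t/2 - 3 * t)" by (simp add: exp_add[symmetric])
    moreover have "E * (1 + F * M) = E + M * (E * F)" for E F M :: real by (simp add: algebra_simps)
    ultimately show ?thesis by (simp only:)
  qed
  also have "\<dots> \<le> exp (t/2) + theta_moment (1/2) rho_im 0 1 * exp (- 2 * t)"
    using t infsum_nonneg[of UNIV "\<lambda>v. exp (- 1 * qform (1/2) rho_im v)"] by (intro add_left_mono mult_left_mono) (auto simp: theta_moment_def)
  finally show ?thesis .
qed

theorem ntheta_ratio_less:
  fixes x y t1 t2 :: real
  assumes x: "0 \<le> x" "x \<le> 1/2" and xy: "1 \<le> x\<^sup>2 + y\<^sup>2" and y: "0 < y" and ne: "(x, y) \<noteq> (1/2, rho_im)"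
    and t: "0 \<le> t1" "t1 < t2"
  shows "ntheta x y t2 * ntheta (1/2) rho_im t1 < ntheta x y t1 * ntheta (1/2) rho_im t2"
proof -
  define \<delta> where "\<delta> t = ntheta x y t - ntheta (1/2) rho_im t" for t
  have dec: "\<delta> t < \<delta> s" if "0 \<le> s" "s < t" for s t
    unfolding \<delta>_def by (rule delta_strict_decreasing[OF x xy y ne that])
  have "0 \<le> \<delta> t2"
  proof (rule ccontr)
    assume n: "\<not> 0 \<le> \<delta> t2"
    define C where "C = theta_moment (1/2) rho_im 0 1"
    \<comment> \<open>So large that the lower bound \<open>- (C * exp (- 2 * s))\<close> for
      \<open>\<delta> s\<close> is at least \<open>\<delta> t2\<close>, contrary to
      monotonicity.\<close>
    define s where "s = max (t2 + 1) (C / (- \<delta> t2))"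
    have s: "t2 < s" "C / (- \<delta> t2) \<le> s" "0 \<le> s" using t by (auto simp: s_def)
    have "\<delta> s < \<delta> t2" using dec s t by simp
    have "- (C * exp (- 2 * s)) \<le> \<delta> s"
      using ntheta_rho_upper[OF s(3)] ntheta_lower[OF y, of s x] by (simp add: \<delta>_def C_def)
    moreover have "C * exp (- 2 * s) \<le> - \<delta> t2"
    proof -
      have "C \<le> - \<delta> t2 * s" using s(2) n by (simp add: field_simps)
      also have "\<dots> \<le> - \<delta> t2 * exp (2 * s)" 
      proof (rule mult_left_mono)
        have "1 + 2 * s \<le> exp (2 * s)" by (rule exp_ge_add_one_self)
        then show "s \<le> exp (2 * s)" using s(3) by linarith
      qed (use n in simp)
      finally have "C * exp (- 2 * s) \<le> - \<delta> t2 * exp (2 * s) * exp (- 2 * s)" by (intro mult_right_mono) auto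
      then show ?thesis by (simp add: mult.assoc exp_add[symmetric])
    qed
    ultimately show False using \<open>\<delta> s < \<delta> t2\<close> by linarith
  qed
  moreover have "\<delta> t2 < \<delta> t1" using dec t by simp
  moreover have "ntheta (1/2) rho_im t1 \<le> ntheta (1/2) rho_im t2"
  proof (rule DERIV_nonneg_imp_nondecreasing[where f = "ntheta (1/2) rho_im" and a = t1 and b = t2])
    fix s assume "t1 \<le> s" "s \<le> t2"
    then have "0 \<le> - exp (s/2) * latsum (1/2) rho_im p1 s" using rho_latsum_nonpos[of s] t by (simp add: mult_nonneg_nonpos)
    then show "\<exists>D. (ntheta (1/2) rho_im has_real_derivative D) (at s) \<and> 0 \<le> D" using ntheta_deriv(1)[OF rho_im(1)] by blast
  qed (use t in simp)
  moreover have "0 < ntheta (1/2) rho_im t1" using ntheta_pos[OF rho_im(1)] .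
  \<comment> \<open>The ratio is \<open>1\<close> plus \<open>\<delta>\<close> over
    \<open>ntheta\<close> at rho: a nonnegative decreasing numerator over a positive nondecreasing
    denominator.\<close>
  ultimately have "\<delta> t2 * ntheta (1/2) rho_im t1 < \<delta> t1 * ntheta (1/2) rho_im t2"
    by (meson less_le_trans mult_left_mono mult_strict_right_mono less_imp_le order.strict_trans2 order.trans)
  then show ?thesis by (simp add: \<delta>_def algebra_simps)
qed

section \<open>Reduction to the fundamental domain\<close>

lemma ntheta_ln:
  assumes "0 < Im z" "0 < \<alpha>"
  shows "ntheta (Re z) (Im z) (ln \<alpha>) = sqrt \<alpha> * theta \<alpha> z"
proof -
  have "exp (ln \<alpha> / 2) = sqrt \<alpha>"
    using assms(2) by (simp add: powr_half_sqrt[symmetric] powr_def)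
  then show ?thesis using assms by (simp add: ntheta_def theta_eq_moment)
qed

lemma theta_pos:
  assumes "0 < Im z" "0 < \<alpha>"
  shows "0 < theta \<alpha> z"
proof -
  have "0 < sqrt \<alpha> * theta \<alpha> z" using ntheta_pos[OF assms(1)] ntheta_ln[OF assms] by metis
  then show ?thesis using assms by (simp add: zero_less_mult_iff)
qed

text \<open>The lattice is divided by \<open>D\<close> and given a new basis by a unimodular matrix;
  \<open>Im\<close> scales by \<open>1 / \<bar>D\<bar>\<^sup>2\<close> as the squared norms do, so
  the terms are merely reindexed.\<close>

lemma theta_modular:
  fixes a b c d :: int
  assumes z: "0 < Im z" and det: "a * d - b * c = 1"
  shows "0 < Im ((of_int a * z + of_int b) / (of_int c * z + of_int d))"
    and "theta \<alpha> ((of_int a * z + of_int b) / (of_int c * z + of_int d)) = theta \<alpha> z"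
proof -
  define D where "D = of_int c * z + of_int d"
  define w where "w = (of_int a * z + of_int b) / D"
  have D0: "D \<noteq> 0"
  proof
    assume "D = 0"
    then have "Im D = 0" "Re D = 0" by simp_all
    then have "c = 0" "d = 0" using z by (auto simp: D_def)
    then show False using det by simp
  qed
  then have nD: "0 < (cmod D)\<^sup>2" by simp
  have det': "of_int a * of_int d - of_int b * of_int c = (1::real)" using det by (metis of_int_1 of_int_diff of_int_mult)
  have Imw: "Im w = Im z / (cmod D)\<^sup>2"
  proof -
    have "Im w = Im ((of_int a * z + of_int b) * cnj D) / (cmod D)\<^sup>2"
      unfolding w_def by (subst complex_div_cnj) (simp only: of_real_power[symmetric] Im_divide_of_real)
    also have "Im ((of_int a * z + of_int b) * cnj D) = (of_int a * of_int d - of_int b * of_int c) * Im z"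
      by (simp add: D_def algebra_simps)
    finally show ?thesis using det' by simp
  qed
  then show im: "0 < Im ((of_int a * z + of_int b) / (of_int c * z + of_int d))"
    using z nD by (simp add: w_def D_def)
  have key: "(cmod (of_int m * w + of_int n))\<^sup>2 / Im w = (cmod (of_int (m * a + n * c) * z + of_int (m * b + n * d)))\<^sup>2 / Im z" for m n
  proof -
    have "(of_int m * w + of_int n) * D = of_int (m * a + n * c) * z + of_int (m * b + n * d)"
      using D0 by (simp add: w_def D_def algebra_simps) (simp add: field_simps)
    then have "of_int m * w + of_int n = (of_int (m * a + n * c) * z + of_int (m * b + n * d)) / D"
      using D0 by (metis nonzero_mult_div_cancel_right)
    then have "(cmod (of_int m * w + of_int n))\<^sup>2 = (cmod (of_int (m * a + n * c) * z + of_int (m * b + n * d)))\<^sup>2 / (cmod D)\<^sup>2"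
      by (simp add: norm_divide power_divide)
    then show ?thesis unfolding Imw using nD by simp
  qed
  have "theta \<alpha> w = theta \<alpha> z"
    unfolding theta_def
  proof (rule infsum_reindex_bij_witness[of _ "\<lambda>(p, q). (d * p - c * q, a * q - b * p)" "\<lambda>(m, n). (m * a + n * c, m * b + n * d)"])
    fix v :: "int \<times> int"
    obtain m n where v: "v = (m, n)" by (cases v)
    have da: "a * d = 1 + b * c" using det by simp
    have 5: "j * (a * d) - j * (b * c) = j" for j by (simp add: da algebra_simps)
    have 1: "d * (m * a + n * c) - c * (m * b + n * d) = m * (a * d) - m * (b * c)" by (simp add: algebra_simps)
    have 2: "a * (m * b + n * d) - b * (m * a + n * c) = n * (a * d) - n * (b * c)" by (simp add: algebra_simps)
    show "(case (case v of (m, n) \<Rightarrow> (m * a + n * c, m * b + n * d)) of (p, q) \<Rightarrow> (d * p - c * q, a * q - b * p)) = v"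
      unfolding v prod.case 1 2 5 ..
    have 3: "(d * m - c * n) * a + (a * n - b * m) * c = m * (a * d) - m * (b * c)" by (simp add: algebra_simps)
    have 4: "(d * m - c * n) * b + (a * n - b * m) * d = n * (a * d) - n * (b * c)" by (simp add: algebra_simps)
    show "(case (case v of (p, q) \<Rightarrow> (d * p - c * q, a * q - b * p)) of (m, n) \<Rightarrow> (m * a + n * c, m * b + n * d)) = v"
      unfolding v prod.case 3 4 5 ..
    have "- pi * \<alpha> * (cmod (of_int m * w + of_int n))\<^sup>2 / Im w = - pi * \<alpha> * ((cmod (of_int m * w + of_int n))\<^sup>2 / Im w)" by simp
    then show "(case case v of (m, n) \<Rightarrow> (m * a + n * c, m * b + n * d) of
        (m, n) \<Rightarrow> exp (- pi * \<alpha> * (cmod (of_int m * z + of_int n))\<^sup>2 / Im z))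
      = (case v of (m, n) \<Rightarrow> exp (- pi * \<alpha> * (cmod (of_int m * w + of_int n))\<^sup>2 / Im w))"
      unfolding v by (simp only: prod.case key) simp
  qed auto
  then show "theta \<alpha> ((of_int a * z + of_int b) / (of_int c * z + of_int d)) = theta \<alpha> z" by (simp add: w_def D_def)
qed

text \<open>The reflection \<open>(m, n) \<mapsto> (m, - n)\<close>; it halves the fundamental
  domain to nonnegative real parts.\<close>

lemma theta_moment_minus: "theta_moment (- x) y k a = theta_moment x y k a"
  unfolding theta_moment_def
  by (rule infsum_reindex_bij_witness[of _ "\<lambda>(m, n). (m, - n)" "\<lambda>(m, n). (m, - n)"])
    (auto simp: qform_def power2_eq_square algebra_simps)

lemma finite_qform_le:
  assumes y: "0 < y"
  shows "finite {v. qform x y v \<le> B}"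
proof -
  define d where "d = pi * y / (x\<^sup>2 + y\<^sup>2 + 1)"
  have d: "0 < d" using y by (simp add: d_def add_pos_nonneg add_nonneg_pos)
  define K where "K = \<lceil>B / d\<rceil>"
  have "{v. qform x y v \<le> B} \<subseteq> {- K..K} \<times> {- K..K}"
  proof
    fix v assume "v \<in> {v. qform x y v \<le> B}"
    then obtain m n where v: "v = (m, n)" "qform x y (m, n) \<le> B" by (cases v) auto
    have "d * (\<bar>real_of_int m\<bar> + \<bar>real_of_int n\<bar>) \<le> B" using qform_lower[OF y, of x m n] v by (simp add: d_def)
    then have "\<bar>real_of_int m\<bar> + \<bar>real_of_int n\<bar> \<le> B / d" using d by (simp add: field_simps)
    also have "\<dots> \<le> of_int K" by (simp add: K_def)
    finally have "\<bar>m\<bar> \<le> K" "\<bar>n\<bar> \<le> K" by linarith+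
    then show "v \<in> {- K..K} \<times> {- K..K}" by (auto simp: v)
  qed
  then show ?thesis by (rule finite_subset) auto
qed

lemma qform_eq_cmod: "qform (Re z) (Im z) (m, n) = pi * (cmod (of_int m * z + of_int n))\<^sup>2 / Im z"
  by (simp add: qform_def cmod_power2)

text \<open>The pair \<open>(c, d)\<close> is a shortest non-zero vector of the lattice, hence coprime.\<close>

lemma fundamental_domain_reduction:
  assumes z: "0 < Im z"
  obtains a b c d :: int and w where "a * d - b * c = 1"
    "w = (of_int a * z + of_int b) / (of_int c * z + of_int d)" "\<bar>Re w\<bar> \<le> 1/2" "1 \<le> cmod w"
proof -
  let ?l = "qform (Re z) (Im z)"
  define A where "A = {v. ?l v \<le> ?l (0, 1)} - {(0, 0)}"
  have A: "finite A" "(0, 1) \<in> A" using finite_qform_le[OF z] by (auto simp: A_def)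
  define v where "v = arg_min_on ?l A"
  have v: "v \<in> A" "\<And>u. u \<in> A \<Longrightarrow> ?l v \<le> ?l u"
    using A unfolding v_def by (auto intro: arg_min_if_finite(1) arg_min_least)
  have min: "?l v \<le> ?l u" if "u \<noteq> (0, 0)" for u
  proof (cases "u \<in> A")
    case False
    then have "?l (0, 1) \<le> ?l u" using that by (auto simp: A_def)
    then show ?thesis using v(2)[OF A(2)] by linarith
  qed (rule v(2))
  obtain c d where cd: "v = (c, d)" by (cases v)
  have cd0: "(c, d) \<noteq> (0, 0)" using v(1) cd by (auto simp: A_def)
  have "coprime c d"
  proof -
    define g where "g = gcd c d"
    have g: "1 \<le> g" using cd0 by (simp add: g_def) (metis gcd_eq_0_iff gcd_ge_0_int int_one_le_iff_zero_less le_less)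
    obtain c' d' where c': "c = g * c'" "d = g * d'" by (metis dvdE gcd_dvd1 gcd_dvd2 g_def)
    have "(c', d') \<noteq> (0, 0)" using cd0 c' by auto
    then have le: "?l (c, d) \<le> ?l (c', d')" using min cd by simp
    have "?l (c, d) = (of_int g)\<^sup>2 * ?l (c', d')" by (simp add: qform_def c' power2_eq_square algebra_simps)
    moreover have "0 < ?l (c', d')"
    proof -
      have "0 < (of_int c' * Re z + of_int d')\<^sup>2 + (of_int c' * Im z)\<^sup>2"
        using \<open>(c', d') \<noteq> (0, 0)\<close> z by (cases "c' = 0") (auto intro: add_nonneg_pos)
      then show ?thesis using z by (simp add: qform_def)
    qed
    ultimately have "(of_int g)\<^sup>2 * ?l (c', d') \<le> 1 * ?l (c', d')" using le by simp
    then have "(of_int g)\<^sup>2 \<le> (1::real)" using \<open>0 < ?l (c', d')\<close> by (simp only: mult_le_cancel_right_pos)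
    then have "g * g \<le> 1" by (metis of_int_1 of_int_le_iff of_int_mult power2_eq_square)
    moreover have "g * 1 \<le> g * g" using g by (intro mult_left_mono) auto
    ultimately have "g = 1" using g by linarith
    then show ?thesis by (simp add: g_def coprime_iff_gcd_eq_1)
  qed
  then obtain p q where pq: "p * c + q * d = 1" using bezout_int[of c d] by (auto simp: coprime_iff_gcd_eq_1)
  define D where "D = of_int c * z + of_int d"
  define w0 where "w0 = (of_int q * z + of_int (- p)) / D"
  \<comment> \<open>A translation moves the real part into the strip and changes only the numerator
    row \<open>(a, b)\<close>.\<close>
  define k where "k = round (Re w0)"
  define a where "a = q - k * c"
  define b where "b = - p - k * d"
  have D0: "D \<noteq> 0"
  proof
    assume "D = 0"
    then have "Im D = 0" "Re D = 0" by simp_all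
    then have "c = 0" "d = 0" using z by (auto simp: D_def)
    then show False using cd0 by simp
  qed
  have det: "a * d - b * c = 1" using pq by (simp add: a_def b_def algebra_simps)
  define w where "w = (of_int a * z + of_int b) / D"
  have w: "w = w0 - of_int k"
    using D0 by (simp add: w_def w0_def a_def b_def D_def diff_divide_distrib[symmetric] algebra_simps) (simp add: field_simps)
  show thesis
  proof
    show "a * d - b * c = 1" by (rule det)
    show "w = (of_int a * z + of_int b) / (of_int c * z + of_int d)" by (simp add: w_def D_def)
    show "\<bar>Re w\<bar> \<le> 1/2" using of_int_round_abs_le[of "Re w0"] by (simp add: w k_def abs_minus_commute)
    \<comment> \<open>\<open>(a, b)\<close> is another nonzero vector, so minimality of
      \<open>(c, d)\<close> gives \<open>\<bar>w\<bar> \<ge> 1\<close>.\<close>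
    have "(a, b) \<noteq> (0, 0)" using det by auto
    then have "?l (c, d) \<le> ?l (a, b)" using min cd by simp
    then have "(cmod D)\<^sup>2 \<le> (cmod (of_int a * z + of_int b))\<^sup>2"
      using z by (simp add: qform_eq_cmod D_def divide_le_cancel)
    then have "cmod D \<le> cmod (of_int a * z + of_int b)" by (rule power2_le_imp_le) simp
    then show "1 \<le> cmod w" using D0 by (simp add: w_def norm_divide)
  qed
qed

lemma exp_pi_third: "exp (\<i> * pi / 3) = Complex (1/2) rho_im"
proof -
  have "exp (\<i> * pi / 3) = cis (pi / 3)" by (simp add: cis_conv_exp)
  also have "\<dots> = Complex (1/2) rho_im" by (simp add: complex_eq_iff cos_60 sin_60 rho_im_def)
  finally show ?thesis .
qed

lemma theta_inverse:
  assumes "0 < Im z" "0 < \<alpha>"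
  shows "theta (1 / \<alpha>) z = \<alpha> * theta \<alpha> z"
proof -
  have "sqrt (1 / \<alpha>) * theta (1 / \<alpha>) z = sqrt \<alpha> * theta \<alpha> z"
    using ntheta_even[OF assms(1), of "Re z" "ln \<alpha>"] ntheta_ln[OF assms] ntheta_ln[OF assms(1), of "1 / \<alpha>"] assms(2)
    by (simp add: ln_div)
  then have "sqrt \<alpha> * (sqrt (1 / \<alpha>) * theta (1 / \<alpha>) z) = sqrt \<alpha> * sqrt \<alpha> * theta \<alpha> z" by simp
  then show ?thesis using assms(2) by (simp add: real_sqrt_divide)
qed

text \<open>By evenness \<open>ln \<alpha>\<close> may be replaced by its modulus, and the two
  conditions on \<open>\<beta>\<close> together say
  \<open>\<bar>ln \<alpha>\<bar> < ln \<beta>\<close>. The point \<open>rho - 1\<close> is the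
  mirror image of rho, the other corner of the domain.\<close>

lemma theta_ratio_domain:
  assumes w: "0 < Im w" "\<bar>Re w\<bar> \<le> 1/2" "1 \<le> cmod w" "w \<noteq> Complex (1/2) rho_im" "w \<noteq> Complex (1/2) rho_im - 1"
    and \<alpha>: "0 < \<alpha>" "\<alpha> < \<beta>" "1 / \<alpha> < \<beta>"
  shows "theta \<beta> w * theta \<alpha> (Complex (1/2) rho_im) < theta \<beta> (Complex (1/2) rho_im) * theta \<alpha> w"
proof -
  have \<beta>: "0 < \<beta>" using \<alpha> by linarith
  have uab: "ntheta \<bar>Re w\<bar> (Im w) t = ntheta (Re w) (Im w) t" for t
    by (cases "0 \<le> Re w") (simp_all add: ntheta_def theta_moment_minus)
  have ev: "ntheta x y \<bar>ln \<alpha>\<bar> = ntheta x y (ln \<alpha>)" if "0 < y" for x y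
    using ntheta_even[OF that, of x "ln \<alpha>"] by (cases "0 \<le> ln \<alpha>") simp_all
  have "1 \<le> (cmod w)\<^sup>2" using w(3) by simp
  then have n: "1 \<le> \<bar>Re w\<bar>\<^sup>2 + (Im w)\<^sup>2" by (simp add: cmod_power2)
  have ne: "(\<bar>Re w\<bar>, Im w) \<noteq> (1/2, rho_im)"
  proof
    assume "(\<bar>Re w\<bar>, Im w) = (1/2, rho_im)"
    then have "Im w = rho_im" "Re w = 1/2 \<or> Re w = - (1/2)" by (auto simp: abs_if split: if_splits)
    then show False using w(4,5) by (auto simp: complex_eq_iff)
  qed
  have "ln \<alpha> < ln \<beta>" using \<alpha> \<beta> by simp
  moreover have "ln (1 / \<alpha>) < ln \<beta>" using \<alpha> \<beta> by (intro ln_less_cancel_iff[THEN iffD2]) auto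
  ultimately have t: "\<bar>ln \<alpha>\<bar> < ln \<beta>" using \<alpha> by (simp add: ln_div abs_less_iff)
  have "ntheta \<bar>Re w\<bar> (Im w) (ln \<beta>) * ntheta (1/2) rho_im \<bar>ln \<alpha>\<bar> < ntheta \<bar>Re w\<bar> (Im w) \<bar>ln \<alpha>\<bar> * ntheta (1/2) rho_im (ln \<beta>)"
    by (rule ntheta_ratio_less[OF _ w(2) n w(1) ne _ t]) auto
  then have "ntheta (Re w) (Im w) (ln \<beta>) * ntheta (1/2) rho_im (ln \<alpha>) < ntheta (Re w) (Im w) (ln \<alpha>) * ntheta (1/2) rho_im (ln \<beta>)"
    unfolding uab ev[OF w(1)] ev[OF rho_im(1)] .
  then have "(sqrt \<beta> * sqrt \<alpha>) * (theta \<beta> w * theta \<alpha> (Complex (1/2) rho_im)) < (sqrt \<beta> * sqrt \<alpha>) * (theta \<beta> (Complex (1/2) rho_im) * theta \<alpha> w)"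
    using ntheta_ln[OF w(1) \<alpha>(1)] ntheta_ln[OF w(1) \<beta>] ntheta_ln[of "Complex (1/2) rho_im", OF _ \<alpha>(1)]
      ntheta_ln[of "Complex (1/2) rho_im", OF _ \<beta>] rho_im(1) by (simp add: mult_ac)
  moreover have "0 < sqrt \<beta> * sqrt \<alpha>" using \<alpha> \<beta> by simp
  ultimately show ?thesis by (simp only: mult_less_cancel_left_pos)
qed

lemma theta_orbit:
  assumes "z \<in> modular_orbit w" "0 < Im w"
  shows "0 < Im z" "theta \<alpha> z = theta \<alpha> w"
  using assms theta_modular[of w] by (auto simp: modular_orbit_def)

lemma modular_orbit_sym:
  fixes a b c d :: int
  assumes z: "0 < Im z" and det: "a * d - b * c = 1" and w: "w = (of_int a * z + of_int b) / (of_int c * z + of_int d)"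
  shows "z = (of_int d * w + of_int (- b)) / (of_int (- c) * w + of_int a)"
proof -
  have D0: "of_int c * z + of_int d \<noteq> 0"
  proof
    assume "of_int c * z + of_int d = 0"
    then have "Im (of_int c * z + of_int d) = 0" "Re (of_int c * z + of_int d) = 0" by simp_all
    then have "c = 0" "d = 0" using z by auto
    then show False using det by simp
  qed
  have det': "of_int a * of_int d - of_int b * of_int c = (1::complex)" using det by (metis of_int_1 of_int_diff of_int_mult)
  have wD: "w * (of_int c * z + of_int d) = of_int a * z + of_int b" using D0 w by simp
  have "(of_int d * w + of_int (- b)) * (of_int c * z + of_int d) = of_int d * (w * (of_int c * z + of_int d)) - of_int b * (of_int c * z + of_int d)"
    by (simp add: algebra_simps)
  also have "\<dots> = (of_int a * of_int d - of_int b * of_int c) * z" unfolding wD by (simp add: algebra_simps)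
  finally have 1: "(of_int d * w + of_int (- b)) * (of_int c * z + of_int d) = z" using det' by simp
  have "(of_int (- c) * w + of_int a) * (of_int c * z + of_int d) = of_int a * (of_int c * z + of_int d) - of_int c * (w * (of_int c * z + of_int d))"
    by (simp add: algebra_simps)
  also have "\<dots> = of_int a * of_int d - of_int b * of_int c" unfolding wD by (simp add: algebra_simps)
  finally have 2: "(of_int (- c) * w + of_int a) * (of_int c * z + of_int d) = 1" using det' by simp
  have "(of_int d * w + of_int (- b)) / (of_int (- c) * w + of_int a)
      = ((of_int d * w + of_int (- b)) * (of_int c * z + of_int d)) / ((of_int (- c) * w + of_int a) * (of_int c * z + of_int d))"
    using D0 by simp
  then show ?thesis unfolding 1 2 by simp
qed

lemma theta_ratio_strict:
  assumes z: "0 < Im z" "z \<notin> modular_orbit (Complex (1/2) rho_im)" and \<alpha>: "0 < \<alpha>" "\<alpha> < \<beta>" "1 / \<alpha> < \<beta>"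
  shows "theta \<beta> z * theta \<alpha> (Complex (1/2) rho_im) < theta \<beta> (Complex (1/2) rho_im) * theta \<alpha> z"
proof -
  obtain a b c d :: int and w where det: "a * d - b * c = 1"
    and w: "w = (of_int a * z + of_int b) / (of_int c * z + of_int d)" "\<bar>Re w\<bar> \<le> 1/2" "1 \<le> cmod w"
    by (rule fundamental_domain_reduction[OF z(1)], rule that)
  have w0: "0 < Im w" "theta \<gamma> w = theta \<gamma> z" for \<gamma>
    unfolding w(1) by (rule theta_modular[OF z(1) det])+
  note zw = modular_orbit_sym[OF z(1) det w(1)]
  have 1: "w \<noteq> Complex (1/2) rho_im"
  proof
    assume e: "w = Complex (1/2) rho_im"
    have "d * a - (- b) * (- c) = 1" using det by (simp add: mult.commute)
    then have "z \<in> modular_orbit (Complex (1/2) rho_im)" using zw unfolding e modular_orbit_def by blast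
    then show False using z by simp
  qed
  have 2: "w \<noteq> Complex (1/2) rho_im - 1"
  proof
    assume e: "w = Complex (1/2) rho_im - 1"
    \<comment> \<open>The translation by \<open>- 1\<close> is absorbed into the matrix, so both
      corners lead to the orbit of rho.\<close>
    have "d * (a + c) - (- b - d) * (- c) = 1" using det by (simp add: algebra_simps)
    moreover have "z = (of_int d * Complex (1/2) rho_im + of_int (- b - d)) / (of_int (- c) * Complex (1/2) rho_im + of_int (a + c))"
      using zw unfolding e by (simp add: algebra_simps)
    ultimately have "z \<in> modular_orbit (Complex (1/2) rho_im)" unfolding modular_orbit_def by blast
    then show False using z by simp
  qed
  show ?thesis using theta_ratio_domain[OF w0(1) w(2,3) 1 2 \<alpha>] by (simp add: w0)
qed

text \<open>Equality occurs on the orbit of rho, for \<open>\<beta> = \<alpha>\<close>, and for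
  \<open>\<beta> = 1 / \<alpha>\<close>, where the functional equation makes the ratio
  constant.\<close>

lemma theta_ratio_le:
  assumes z: "0 < Im z" and \<alpha>: "0 < \<alpha>" "\<alpha> \<le> \<beta>" "1 / \<alpha> \<le> \<beta>"
  shows "theta \<beta> z * theta \<alpha> (Complex (1/2) rho_im) \<le> theta \<beta> (Complex (1/2) rho_im) * theta \<alpha> z"
proof -
  have r: "0 < Im (Complex (1/2) rho_im)" using rho_im(1) by simp
  consider "z \<in> modular_orbit (Complex (1/2) rho_im)" | "\<beta> = \<alpha>" | "\<beta> = 1 / \<alpha>"
    | "z \<notin> modular_orbit (Complex (1/2) rho_im)" "\<alpha> < \<beta>" "1 / \<alpha> < \<beta>" using \<alpha> by linarith
  then show ?thesis
  proof cases
    case 1 then show ?thesis using theta_orbit(2)[OF _ r] by simp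
  next
    case 3 then show ?thesis using theta_inverse[OF z \<alpha>(1)] theta_inverse[OF r \<alpha>(1)] by simp
  next
    case 4 then show ?thesis using theta_ratio_strict[OF z _ \<alpha>(1)] by (simp add: less_imp_le)
  qed simp
qed

text \<open>After cross-multiplication the comparison of quotients expands into a double sum over
  pairs \<open>(k, j)\<close> with coefficients \<open>b k * a j \<ge> 0\<close>, each settled by a
  single ratio; one pair with positive coefficient and nonconstant ratio makes it strict.\<close>

theorem theorem1p2:
  fixes N :: nat and \<alpha> \<beta> a b :: "nat \<Rightarrow> real"
  assumes "2 \<le> N"
    and "\<forall>j\<in>{1..N}. 0 < \<alpha> j \<and> 0 < \<beta> j"
    and "Min (\<beta> ` {1..N}) \<ge> Max (\<alpha> ` {1..N})"
    and "Max (\<alpha> ` {1..N}) \<ge> 1"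
    and "\<forall>j\<in>{1..N}. \<forall>k\<in>{1..N}. 1 / \<alpha> j \<le> \<beta> k"
    and "\<forall>j\<in>{1..N}. 0 \<le> a j \<and> 0 \<le> b j"
  shows "modular_orbit (exp (\<i> * pi / 3))
           \<subseteq> arg_max_set (theta_quotient N b \<beta> a \<alpha>) upper_half_plane
       \<and> ((\<exists>j\<in>{1..N}. \<exists>k\<in>{1..N}. 0 < a j \<and> 0 < b k \<and> \<beta> k \<noteq> \<alpha> j \<and> \<beta> k \<noteq> 1 / \<alpha> j) \<longrightarrow>
          arg_max_set (theta_quotient N b \<beta> a \<alpha>) upper_half_plane
            = modular_orbit (exp (\<i> * pi / 3)))"
proof -
  define \<rho> where "\<rho> = Complex (1/2) rho_im"
  define Q where "Q = theta_quotient N b \<beta> a \<alpha>"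
  define S where "S z = (\<Sum>j = 1..N. a j * theta (\<alpha> j) z)" for z
  define R where "R z = (\<Sum>k = 1..N. b k * theta (\<beta> k) z)" for z
  have Q: "Q z = R z / S z" for z by (simp add: Q_def theta_quotient_def S_def R_def)
  have \<rho>: "0 < Im \<rho>" using rho_im(1) by (simp add: \<rho>_def)
  have pos: "0 < \<alpha> j" "0 < \<beta> j" "0 \<le> a j" "0 \<le> b j" if "j \<in> {1..N}" for j using assms that by auto
  have ab: "\<alpha> j \<le> \<beta> k" "1 / \<alpha> j \<le> \<beta> k" if "j \<in> {1..N}" "k \<in> {1..N}" for j k
  proof -
    have "\<alpha> j \<le> Max (\<alpha> ` {1..N})" "Min (\<beta> ` {1..N}) \<le> \<beta> k" using that by auto
    then show "\<alpha> j \<le> \<beta> k" using assms(3) by linarith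
    show "1 / \<alpha> j \<le> \<beta> k" using assms(5) that by blast
  qed
  have prod: "R z * S w = (\<Sum>(k, j)\<in>{1..N} \<times> {1..N}. b k * a j * (theta (\<beta> k) z * theta (\<alpha> j) w))" for z w
    unfolding R_def S_def sum_product sum.cartesian_product by (rule sum.cong) (auto simp: mult_ac)
  have le: "R z * S \<rho> \<le> R \<rho> * S z" if z: "0 < Im z" for z
    unfolding prod
  proof (rule sum_mono, clarify)
    fix k j assume "k \<in> {1..N}" "j \<in> {1..N}"
    then show "b k * a j * (theta (\<beta> k) z * theta (\<alpha> j) \<rho>) \<le> b k * a j * (theta (\<beta> k) \<rho> * theta (\<alpha> j) z)"
      using pos ab theta_ratio_le[OF z, of "\<alpha> j" "\<beta> k"] by (intro mult_left_mono) (auto simp: \<rho>_def)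
  qed
  have S0: "0 < S z" if z: "0 < Im z" and ex: "\<exists>j\<in>{1..N}. 0 < a j" for z
  proof -
    obtain j where j: "j \<in> {1..N}" "0 < a j" using ex by blast
    show ?thesis unfolding S_def
    proof (rule sum_pos2[OF _ j(1)])
      show "0 < a j * theta (\<alpha> j) z" using j pos(1)[OF j(1)] theta_pos[OF z] by simp
      show "0 \<le> a i * theta (\<alpha> i) z" if "i \<in> {1..N}" for i
        using pos(1,3)[OF that] theta_pos[OF z, of "\<alpha> i"] by simp
    qed simp
  qed
  have Qle: "Q z \<le> Q \<rho>" if z: "0 < Im z" for z
  proof (cases "\<exists>j\<in>{1..N}. 0 < a j")
    case True
    then show ?thesis using le[OF z] S0[OF z True] S0[OF \<rho> True] by (simp add: Q field_simps)
  next
    \<comment> \<open>With all \<open>a j\<close> zero both quotients are divisions by zero, with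
      value zero.\<close>
    case False
    then have "a j = 0" if "j \<in> {1..N}" for j using pos(3)[OF that] that by force
    then have "S w = 0" for w by (simp add: S_def)
    then show ?thesis by (simp add: Q)
  qed
  have orb: "0 < Im z" "Q z = Q \<rho>" if "z \<in> modular_orbit \<rho>" for z
    using theta_orbit[OF that \<rho>] by (simp_all add: Q_def theta_quotient_def)
  have sub: "modular_orbit \<rho> \<subseteq> arg_max_set Q upper_half_plane"
  proof
    fix z assume z: "z \<in> modular_orbit \<rho>"
    have "\<not> Q z < Q w" if "0 < Im w" for w using Qle[OF that] orb(2)[OF z] by simp
    then show "z \<in> arg_max_set Q upper_half_plane"
      using orb(1)[OF z] by (auto simp: arg_max_set_def is_arg_max_def upper_half_plane_def)
  qed
  have "arg_max_set Q upper_half_plane \<subseteq> modular_orbit \<rho>"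
    if ex: "\<exists>j\<in>{1..N}. \<exists>k\<in>{1..N}. 0 < a j \<and> 0 < b k \<and> \<beta> k \<noteq> \<alpha> j \<and> \<beta> k \<noteq> 1 / \<alpha> j"
  proof
    fix z assume "z \<in> arg_max_set Q upper_half_plane"
    then have "0 < Im z \<and> (\<forall>w. \<not> (0 < Im w \<and> Q z < Q w))"
      by (simp add: arg_max_set_def is_arg_max_def upper_half_plane_def)
    then have z: "0 < Im z" and max: "\<And>w. 0 < Im w \<Longrightarrow> Q w \<le> Q z" by (meson not_less)+
    obtain j k where jk: "j \<in> {1..N}" "k \<in> {1..N}" "0 < a j" "0 < b k" "\<beta> k \<noteq> \<alpha> j" "\<beta> k \<noteq> 1 / \<alpha> j" using ex by blast
    show "z \<in> modular_orbit \<rho>"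
    proof (rule ccontr)
      assume n: "z \<notin> modular_orbit \<rho>"
      have "\<alpha> j < \<beta> k" "1 / \<alpha> j < \<beta> k" using ab[OF jk(1,2)] jk(5,6) by linarith+
      then have st: "theta (\<beta> k) z * theta (\<alpha> j) \<rho> < theta (\<beta> k) \<rho> * theta (\<alpha> j) z"
        using theta_ratio_strict[OF z] n pos(1)[OF jk(1)] by (simp add: \<rho>_def)
      have "R z * S \<rho> < R \<rho> * S z"
        unfolding prod
      proof (rule sum_strict_mono_ex1)
        show "\<forall>p\<in>{1..N} \<times> {1..N}. (case p of (k, j) \<Rightarrow> b k * a j * (theta (\<beta> k) z * theta (\<alpha> j) \<rho>))
          \<le> (case p of (k, j) \<Rightarrow> b k * a j * (theta (\<beta> k) \<rho> * theta (\<alpha> j) z))"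
          using pos ab theta_ratio_le[OF z] by (auto simp: \<rho>_def intro!: mult_left_mono)
        show "\<exists>p\<in>{1..N} \<times> {1..N}. (case p of (k, j) \<Rightarrow> b k * a j * (theta (\<beta> k) z * theta (\<alpha> j) \<rho>))
          < (case p of (k, j) \<Rightarrow> b k * a j * (theta (\<beta> k) \<rho> * theta (\<alpha> j) z))"
          using jk st by (intro bexI[of _ "(k, j)"]) auto
      qed simp
      moreover have "0 < S z" "0 < S \<rho>" using S0[OF z] S0[OF \<rho>] jk by blast+
      ultimately have "Q z < Q \<rho>" by (simp add: Q field_simps)
      then show False using max[OF \<rho>] by simp
    qed
  qed
  then show ?thesis using sub unfolding exp_pi_third \<rho>_def[symmetric] Q_def[symmetric] by blast
qed

end
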